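(* For every integer $k\ge 2$ there exist an integer $n\ge 2k$, an integer $m>2$, and convex bodies $K_1,\ldots,K_m,C_1,\ldots,C_{n-2k}$ in $\mathbb{R}^n$ such that the $m\times m$ symmetric matrix $\mathrm{M}$ defined by $$\mathrm{M}_{ij} := \mathsf{V}(K_i[k],K_j[k],C_1,\ldots,C_{n-2k})$$ satisfies $$(-1)^m\det\mathrm{M} > 0.$$ In other words, the inequality $(-1)^m\det \mathrm{M}\le 0$ (Fedotov's conjecture) fails for every $k>1$ for some $m>2$.
   Context: A convex body is a nonempty compact convex subset of $\mathbb{R}^n$. Mixed volumes $\mathsf{V}(L_1,\ldots,L_n)$ of convex bodies in $\mathbb{R}^n$ are the unique symmetric coefficients such that $\mathrm{Vol}(\lambda_1L_1+\cdots+\lambda_rL_r)=\sum_{i_1,\ldots,i_n=1}^r \mathsf{V}(L_{i_1},\ldots,L_{i_n})\lambda_{i_1}\cdots\lambda_{i_n}$ for all $\lambda_1,\ldots,\lambda_r>0$ (Minkowski addition). The notation $\mathsf{V}(L_1[m_1],\ldots,L_r[m_r])$ means the mixed volume in which $L_j$ is repeated $m_j$ times, $\sum_j m_j=n$. *)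

theory Defs
  imports "HOL-Analysis.Analysis" "Jordan_Normal_Form.Determinant"
begin

definition rn :: "nat \<Rightarrow> (nat \<Rightarrow> real) set" where
  "rn n = PiE {..<n} (\<lambda>_. UNIV)"

definition convex_body :: "nat \<Rightarrow> (nat \<Rightarrow> real) set \<Rightarrow> bool" where
  "convex_body n K \<longleftrightarrow> K \<noteq> {} \<and> K \<subseteq> rn n \<and> compact K \<and>
     (\<forall>x\<in>K. \<forall>y\<in>K. \<forall>t::real. 0 \<le> t \<and> t \<le> 1 \<longrightarrow>
        (\<lambda>i\<in>{..<n}. (1 - t) * x i + t * y i) \<in> K)"

definition vol :: "nat \<Rightarrow> (nat \<Rightarrow> real) set \<Rightarrow> real" where
  "vol n K = measure (PiM {..<n} (\<lambda>_. lborel)) K"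

definition mink_comb :: "nat \<Rightarrow> (nat \<Rightarrow> real) set list \<Rightarrow> (nat \<Rightarrow> real) \<Rightarrow> (nat \<Rightarrow> real) set" where
  "mink_comb n Ls lam = {(\<lambda>i\<in>{..<n}. \<Sum>j<length Ls. lam j * x j i) | x.
       \<forall>j<length Ls. x j \<in> Ls ! j}"

definition is_mixed_volume :: "nat \<Rightarrow> ((nat \<Rightarrow> real) set list \<Rightarrow> real) \<Rightarrow> bool" where
  "is_mixed_volume n V \<longleftrightarrow>
     (\<forall>Ls Ms. mset Ls = mset Ms \<longrightarrow> V Ls = V Ms) \<and>
     (\<forall>Ls lam. Ls \<noteq> [] \<and> (\<forall>L\<in>set Ls. convex_body n L) \<and> (\<forall>j<length Ls. lam j > 0) \<longrightarrow>
        vol n (mink_comb n Ls lam) =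
          (\<Sum>f\<in>{..<n} \<rightarrow>\<^sub>E {..<length Ls}.
              V (map (\<lambda>a. Ls ! f a) [0..<n]) * (\<Prod>a<n. lam (f a))))"

definition mixed_volume :: "nat \<Rightarrow> (nat \<Rightarrow> real) set list \<Rightarrow> real" where
  "mixed_volume n Ls = (THE v. \<exists>V. is_mixed_volume n V \<and> V Ls = v)"

end

theory Submission
  imports Defs
begin

text \<open>
  In dimension \<open>n = 2 k\<close> take \<open>m = 3\<close> and the cubes \<open>K\<^sub>0 = [0,1]\<^sup>k \<times> 0\<close>, \<open>K\<^sub>1 = 0 \<times> [0,1]\<^sup>k\<close>,
  \<open>K\<^sub>2 = [0,1]\<^sup>n\<close>. Their mixed volumes are coefficients of polynomials such as \<open>(s + 1)\<^sup>k\<close>; the diagonal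
  of the matrix is \<open>0, 0, 1\<close>, all other entries equal \<open>c = 1 / (2 k choose k)\<close>, and its determinant
  \<open>c\<^sup>2 (2 c - 1)\<close> is negative because \<open>k \<ge> 2\<close> makes \<open>c < 1/2\<close>.

  The substance is Minkowski's theorem that mixed volumes exist. For polytopes one shows, by induction on
  the dimension, that the integral of a polynomial over a Minkowski combination is a polynomial in the
  coefficients: after integrating over the last coordinate, the projected body splits into finitely many cells,
  each again a Minkowski combination of polytopes, above which the upper and the lower boundary are affine,
  with coefficients linear in those of the combination. LP duality shows that the cells cover; overlaps lie in hyperplanes.
  The polarization formula expresses the coefficients by finitely many volumes, and in this form
  the expansion passes to limits of polytopes, hence holds for all convex bodies.
\<close>

section \<open>Homogeneous polynomials and measurability\<close>

text \<open>\<open>mixed_volume\<close> is a definite description, so it carries no information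
  until two facts are known: some \<open>V\<close> satisfies \<open>is_mixed_volume\<close>, and all
  such \<open>V\<close> agree on the list at hand. Agreement is shown for lists of two boxes, where
  it is the uniqueness of the coefficients of a polynomial in one variable. Existence takes most of
  the work. Volume alone does not support the induction on the dimension: integrating out one
  coordinate leaves a difference of boundary heights, and these are linear in the point and the
  coefficients jointly. So the induction runs over integrals of polynomials that are homogeneous in
  both. Polarization evaluates volumes at coefficients that may be 0, whereas
  \<open>is_mixed_volume\<close> speaks of positive ones; hence the hypotheses
  \<open>0 \<le> l j\<close> in the polytope part. As for the example, the third cube is the
  Minkowski sum of the other two. For k = 1 the matrix has c = 1/2 and is singular; raising k lowers
  c and tips the sign of the determinant.\<close>

inductive hpoly :: "nat \<Rightarrow> nat \<Rightarrow> nat \<Rightarrow> ((nat \<Rightarrow> real) \<Rightarrow> (nat \<Rightarrow> real) \<Rightarrow> real) \<Rightarrow> bool"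
  for n r where
  zero: "hpoly n r d (\<lambda>x l. 0)"
| const: "hpoly n r 0 (\<lambda>x l. c)"
| xvar: "hpoly n r d q \<Longrightarrow> i < n \<Longrightarrow> hpoly n r (Suc d) (\<lambda>x l. x i * q x l)"
| lvar: "hpoly n r d q \<Longrightarrow> j < r \<Longrightarrow> hpoly n r (Suc d) (\<lambda>x l. l j * q x l)"
| add: "hpoly n r d q \<Longrightarrow> hpoly n r d q' \<Longrightarrow> hpoly n r d (\<lambda>x l. q x l + q' x l)"

lemma hpoly_scale:
  assumes "hpoly n r d q"
  shows "hpoly n r d (\<lambda>x l. c * q x l)"
  using assms
proof induction
  case (zero d)
  show ?case using hpoly.zero by simp
next
  case (const c')
  show ?case using hpoly.const[of n r "c * c'"] by simp
next
  case (xvar d q i)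
  then show ?case using hpoly.xvar[OF xvar.IH xvar.hyps(2)] by (simp add: mult.left_commute)
next
  case (lvar d q i)
  then show ?case using hpoly.lvar[OF lvar.IH lvar.hyps(2)] by (simp add: mult.left_commute)
next
  case (add d q q')
  then show ?case using hpoly.add[OF add.IH] by (simp add: distrib_left)
qed

lemma hpoly_mult:
  assumes "hpoly n r d q" "hpoly n r e p"
  shows "hpoly n r (d + e) (\<lambda>x l. q x l * p x l)"
  using assms(1)
proof induction
  case (zero d)
  show ?case using hpoly.zero by simp
next
  case (const c)
  show ?case using hpoly_scale[OF assms(2)] by simp
next
  case (xvar d q i)
  then show ?case using hpoly.xvar[OF xvar.IH xvar.hyps(2)] by (simp add: mult.assoc)
next
  case (lvar d q i)
  then show ?case using hpoly.lvar[OF lvar.IH lvar.hyps(2)] by (simp add: mult.assoc)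
next
  case (add d q q')
  then show ?case using hpoly.add[OF add.IH] by (simp add: distrib_right)
qed

lemma hpoly_sum:
  assumes "finite I" "\<And>i. i \<in> I \<Longrightarrow> hpoly n r d (q i)"
  shows "hpoly n r d (\<lambda>x l. \<Sum>i\<in>I. q i x l)"
  using assms
proof (induction I rule: finite_induct)
  case empty
  then show ?case using hpoly.zero by simp
next
  case (insert i I)
  then show ?case using hpoly.add[of n r d "q i" "\<lambda>x l. \<Sum>i\<in>I. q i x l"] by simp
qed

lemma hpoly_diff:
  assumes "hpoly n r d q" "hpoly n r d p"
  shows "hpoly n r d (\<lambda>x l. q x l - p x l)"
  using hpoly.add[OF assms(1) hpoly_scale[OF assms(2), of "-1"]] by simp

lemma hpoly_power:
  assumes "hpoly n r 1 q"
  shows "hpoly n r e (\<lambda>x l. q x l ^ e)"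
proof (induction e)
  case 0
  show ?case using hpoly.const[of n r 1] by simp
next
  case (Suc e)
  show ?case using hpoly_mult[OF assms Suc] by simp
qed

lemma hpoly_affine:
  "hpoly n r 1 (\<lambda>x l. (\<Sum>j<r. l j * h j) - (\<Sum>i<n. w i * x i))"
proof (rule hpoly_diff)
  have "hpoly n r 1 (\<lambda>x l. l j * h j)" if "j < r" for j
    using hpoly.lvar[OF hpoly.const that, of n "h j"] by simp
  then show "hpoly n r 1 (\<lambda>x l. \<Sum>j<r. l j * h j)" by (intro hpoly_sum) auto
  have "hpoly n r 1 (\<lambda>x l. w i * x i)" if "i < n" for i
    using hpoly.xvar[OF hpoly.const that, of r "w i"] by (simp add: mult.commute)
  then show "hpoly n r 1 (\<lambda>x l. \<Sum>i<n. w i * x i)" by (intro hpoly_sum) auto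
qed

text \<open>Along a fiber over the first \<open>n\<close> coordinates the factors
  \<open>qs e\<close> are constant, so integrating over the last coordinate comes down to
  integrating single powers of it.\<close>

lemma hpoly_expand_last:
  assumes "hpoly (Suc n) r d q"
  shows "\<exists>qs. (\<forall>e\<le>d. hpoly n r (d - e) (qs e)) \<and> (\<forall>x l. q x l = (\<Sum>e\<le>d. x n ^ e * qs e x l))"
  using assms
proof induction
  case (zero d)
  show ?case by (rule exI[of _ "\<lambda>e x l. 0"]) (auto intro: hpoly.zero)
next
  case (const c)
  show ?case by (rule exI[of _ "\<lambda>e x l. c"]) (auto intro: hpoly.const)
next
  case (xvar d q i)
  then obtain qs where qs: "\<forall>e\<le>d. hpoly n r (d - e) (qs e)"
    and q: "\<And>x l. q x l = (\<Sum>e\<le>d. x n ^ e * qs e x l)" by blast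
  show ?case
  proof (cases "i = n")
    case True
    \<comment> \<open>Multiplying by the last variable itself shifts all coefficients up by one
      power, which leaves 0 at exponent 0.\<close>
    show ?thesis
    proof (rule exI[of _ "\<lambda>e. if e = 0 then (\<lambda>x l. 0) else qs (e - 1)"], intro conjI allI impI)
      fix e assume "e \<le> Suc d"
      then show "hpoly n r (Suc d - e) (if e = 0 then (\<lambda>x l. 0) else qs (e - 1))"
        using qs by (cases e) (auto intro: hpoly.zero)
    next
      fix x l
      show "x i * q x l = (\<Sum>e\<le>Suc d. x n ^ e * (if e = 0 then (\<lambda>x l. 0) else qs (e - 1)) x l)"
        by (subst sum.atMost_Suc_shift) (simp add: True q sum_distrib_left mult.assoc)
    qed
  next
    case False
    then have i: "i < n" using xvar by simp
    show ?thesis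
    proof (rule exI[of _ "\<lambda>e. if e = Suc d then (\<lambda>x l. 0) else (\<lambda>x l. x i * qs e x l)"], intro conjI allI impI)
      fix e assume "e \<le> Suc d"
      then show "hpoly n r (Suc d - e) (if e = Suc d then (\<lambda>x l. 0) else (\<lambda>x l. x i * qs e x l))"
        using qs hpoly.xvar[OF _ i, of r "d - e" "qs e"] by (auto intro: hpoly.zero simp: Suc_diff_le)
    next
      fix x l
      show "x i * q x l = (\<Sum>e\<le>Suc d. x n ^ e * (if e = Suc d then (\<lambda>x l. 0) else (\<lambda>x l. x i * qs e x l)) x l)"
        by (auto simp: q sum_distrib_left mult_ac intro!: sum.cong)
    qed
  qed
next
  case (lvar d q i)
  then obtain qs where qs: "\<forall>e\<le>d. hpoly n r (d - e) (qs e)"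
    and q: "\<And>x l. q x l = (\<Sum>e\<le>d. x n ^ e * qs e x l)" by blast
  show ?case
  proof (rule exI[of _ "\<lambda>e. if e = Suc d then (\<lambda>x l. 0) else (\<lambda>x l. l i * qs e x l)"], intro conjI allI impI)
    fix e assume "e \<le> Suc d"
    then show "hpoly n r (Suc d - e) (if e = Suc d then (\<lambda>x l. 0) else (\<lambda>x l. l i * qs e x l))"
      using qs hpoly.lvar[OF _ lvar.hyps(2), of n "d - e" "qs e"] by (auto intro: hpoly.zero simp: Suc_diff_le)
  next
    fix x l
    show "l i * q x l = (\<Sum>e\<le>Suc d. x n ^ e * (if e = Suc d then (\<lambda>x l. 0) else (\<lambda>x l. l i * qs e x l)) x l)"
      by (auto simp: q sum_distrib_left mult_ac intro!: sum.cong)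
  qed
next
  case (add d q q')
  then obtain qs qs' where qs: "\<forall>e\<le>d. hpoly n r (d - e) (qs e)" "\<forall>e\<le>d. hpoly n r (d - e) (qs' e)"
    and q: "\<And>x l. q x l = (\<Sum>e\<le>d. x n ^ e * qs e x l)" "\<And>x l. q' x l = (\<Sum>e\<le>d. x n ^ e * qs' e x l)" by blast
  show ?case
    by (rule exI[of _ "\<lambda>e x l. qs e x l + qs' e x l"])
      (use qs in \<open>auto simp: q sum.distrib distrib_left intro: hpoly.add\<close>)
qed

lemma hpoly_cong_x:
  assumes "hpoly n r d q" "\<And>i. i < n \<Longrightarrow> x i = y i"
  shows "q x l = q y l"
  using assms by induction auto

lemma hpoly_continuous:
  assumes "hpoly n r d q"
  shows "continuous_on UNIV (\<lambda>x. q x l)"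
  using assms by induction (auto intro!: continuous_intros continuous_on_product_coordinates)

section \<open>Lebesgue measure on \<open>rn n\<close>: measurability, finiteness and integrability
  on compact sets\<close>

abbreviation Leb :: "nat \<Rightarrow> (nat \<Rightarrow> real) measure" where
  "Leb n \<equiv> PiM {..<n} (\<lambda>_. lborel)"

lemma hpoly_measurable:
  assumes "hpoly n r d q"
  shows "(\<lambda>x. q x l) \<in> borel_measurable (Leb n)"
  using assms
proof induction
  case (xvar d q i)
  have "(\<lambda>x. x i) \<in> borel_measurable (Leb n)"
    using measurable_component_singleton[of i "{..<n}" "\<lambda>_. lborel :: real measure"] xvar by simp
  with xvar show ?case by measurable
qed auto

text \<open>Tychonoff for the type-class topology. Bodies live in a function space over all of
  \<open>nat\<close>, so surplus indices have to receive some compact factor as well, usually a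
  singleton.\<close>

lemma compact_PiE_UNIV:
  fixes X :: "'a \<Rightarrow> 'b :: topological_space set"
  assumes "\<And>i. compact (X i)"
  shows "compact (PiE UNIV X)"
  using assms compactin_PiE[of "\<lambda>_. euclidean" UNIV X]
  by (simp add: euclidean_product_topology)

lemma closed_rn: "closed (rn n)"
proof -
  have "rn n = (\<Inter>i\<in>{n..}. {x. x i = undefined})"
    by (auto simp: rn_def PiE_def extensional_def)
  moreover have "closed {x :: nat \<Rightarrow> real. x i = undefined}" for i
    by (intro closed_Collect_eq continuous_on_product_coordinates continuous_on_const)
  ultimately show ?thesis by auto
qed

lemma space_Leb: "space (Leb n) = rn n"
  by (simp add: space_PiM rn_def)

text \<open>The map \<open>?g\<close> resets all coordinates from \<open>n\<close> on to
  \<open>undefined\<close>. It is measurable into the full countable product, where Borel and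
  product-measurable sets coincide, and it is the identity on \<open>rn n\<close>.\<close>

lemma closed_measurable:
  assumes "closed K" "K \<subseteq> rn n"
  shows "K \<in> sets (Leb n)"
proof -
  let ?g = "\<lambda>x i. if i < n then x i else undefined :: real"
  have "?g \<in> measurable (Leb n) (PiM UNIV (\<lambda>_. borel))"
  proof (rule measurable_PiM_single')
    fix i
    show "(\<lambda>x. ?g x i) \<in> borel_measurable (Leb n)"
      using measurable_component_singleton[of i "{..<n}" "\<lambda>_. lborel :: real measure"]
      by (cases "i < n") auto
  qed auto
  moreover have "K \<in> sets (PiM UNIV (\<lambda>_. borel))"
    using assms(1) by (simp add: sets_PiM_equal_borel)
  ultimately have "?g -` K \<inter> space (Leb n) \<in> sets (Leb n)" by (rule measurable_sets)
  moreover have "?g x = x" if "x \<in> rn n" for x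
    using that by (auto simp: rn_def PiE_def extensional_def)
  then have "?g -` K \<inter> space (Leb n) = K"
    using assms(2) unfolding space_Leb by fastforce
  ultimately show ?thesis by simp
qed

lemma compact_coordinate_bound:
  fixes K :: "(nat \<Rightarrow> real) set"
  assumes "compact K"
  obtains B where "B > 0" "\<And>x i. x \<in> K \<Longrightarrow> i < n \<Longrightarrow> \<bar>x i\<bar> \<le> B"
proof -
  have "\<exists>b. \<forall>x\<in>K. \<bar>x i\<bar> \<le> b" for i
  proof -
    have "bounded ((\<lambda>x. x i) ` K)"
      by (intro compact_imp_bounded compact_continuous_image assms continuous_on_subset[OF continuous_on_product_coordinates]) auto
    then show ?thesis unfolding bounded_iff by auto
  qed
  then obtain b where b: "\<And>i x. x \<in> K \<Longrightarrow> \<bar>x i\<bar> \<le> b i" by metis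
  show ?thesis
  proof (rule that[of "1 + (\<Sum>i<n. \<bar>b i\<bar>)"])
    show "0 < 1 + (\<Sum>i<n. \<bar>b i\<bar>)" by (simp add: add_pos_nonneg sum_nonneg)
    fix x i assume "x \<in> K" "i < n"
    then have "\<bar>b i\<bar> \<le> (\<Sum>i<n. \<bar>b i\<bar>)" by (intro member_le_sum) auto
    with b[OF \<open>x \<in> K\<close>, of i] show "\<bar>x i\<bar> \<le> 1 + (\<Sum>i<n. \<bar>b i\<bar>)" by linarith
  qed
qed

interpretation Leb: product_sigma_finite "\<lambda>_ :: nat. lborel :: real measure" ..

lemma emeasure_box:
  "emeasure (Leb n) (PiE {..<n} (\<lambda>i. {a i..b i})) = (\<Prod>i<n. ennreal (b i - a i))"
  by (subst Leb.emeasure_PiM) (auto intro!: prod.cong simp: emeasure_lborel_Icc_eq ennreal_neg)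

lemma compact_finite_measure:
  assumes "compact K" "K \<subseteq> rn n"
  shows "emeasure (Leb n) K < \<infinity>"
proof -
  obtain B where B: "B > 0" "\<And>x i. x \<in> K \<Longrightarrow> i < n \<Longrightarrow> \<bar>x i\<bar> \<le> B"
    using compact_coordinate_bound[OF assms(1)] by blast
  have "K \<subseteq> PiE {..<n} (\<lambda>i. {-B..B})"
    using B(2) assms(2) by (force simp: rn_def PiE_iff abs_le_iff)
  then have "emeasure (Leb n) K \<le> emeasure (Leb n) (PiE {..<n} (\<lambda>i. {-B..B}))"
    by (intro emeasure_mono sets_PiM_I_finite) auto
  also have "\<dots> < \<infinity>" by (simp add: emeasure_box[of n "\<lambda>_. -B" "\<lambda>_. B"] power_eq_top_ennreal top.not_eq_extremum[symmetric])
  finally show ?thesis .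
qed

lemma hpoly_integrable:
  assumes "compact K" "K \<subseteq> rn n" "hpoly n r d q"
  shows "integrable (Leb n) (\<lambda>x. indicator K x * q x l)"
proof -
  have "bounded ((\<lambda>x. q x l) ` K)"
    by (intro compact_imp_bounded compact_continuous_image assms(1)
        continuous_on_subset[OF hpoly_continuous[OF assms(3)]]) auto
  then obtain b where b: "\<And>x. x \<in> K \<Longrightarrow> \<bar>q x l\<bar> \<le> b" unfolding bounded_iff by auto
  have K: "K \<in> sets (Leb n)" using assms closed_measurable compact_imp_closed by blast
  have "integrable (Leb n) (\<lambda>x. indicator K x *\<^sub>R q x l)"
    by (rule integrableI_bounded_set_indicator[where B=b])
      (use K b compact_finite_measure[OF assms(1,2)] hpoly_measurable[OF assms(3)] in auto)
  then show ?thesis by simp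
qed

section \<open>Farkas' lemma\<close>

text \<open>A pair \<open>(b, \<beta>)\<close> stands for the inequality
  \<open>(\<Sum>i<n. w i * b i) \<le> \<beta>\<close> in the unknown \<open>w\<close>; the closure
  collects the inequalities that follow by positive combination.\<close>

inductive_set conic :: "((nat \<Rightarrow> real) \<times> real) set \<Rightarrow> ((nat \<Rightarrow> real) \<times> real) set" for S where
  base: "s \<in> S \<Longrightarrow> s \<in> conic S"
| add: "(b, \<beta>) \<in> conic S \<Longrightarrow> (b', \<beta>') \<in> conic S \<Longrightarrow> (\<lambda>i. b i + b' i, \<beta> + \<beta>') \<in> conic S"
| scale: "(b, \<beta>) \<in> conic S \<Longrightarrow> 0 < t \<Longrightarrow> (\<lambda>i. t * b i, t * \<beta>) \<in> conic S"

lemma conic_subset: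
  assumes "S' \<subseteq> conic S"
  shows "conic S' \<subseteq> conic S"
proof
  fix s assume "s \<in> conic S'"
  then show "s \<in> conic S"
    by induction (use assms in \<open>auto intro: conic.intros\<close>)
qed

lemma separating_real:
  fixes L U :: "real set"
  assumes "finite L" "finite U" "\<And>x y. x \<in> L \<Longrightarrow> y \<in> U \<Longrightarrow> x \<le> y"
  shows "\<exists>t. (\<forall>x\<in>L. x \<le> t) \<and> (\<forall>y\<in>U. t \<le> y)"
proof (cases "L = {}")
  case True
  then show ?thesis using assms(2) by (cases "U = {}") (auto intro!: exI[of _ "Min U"])
next
  case False
  then show ?thesis using assms by (intro exI[of _ "Max L"]) auto
qed

text \<open>Fourier-Motzkin elimination of the unknown \<open>w n\<close>: inequalities with
  positive coefficient bound it from above, those with negative coefficient from below, and each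
  pair of opposite signs yields an inequality free of it. A contradiction derived from the reduced
  system is derived from the original one too.\<close>

lemma farkas:
  fixes S :: "((nat \<Rightarrow> real) \<times> real) set"
  assumes "finite S"
  shows "(\<exists>w. \<forall>(b, \<beta>)\<in>S. (\<Sum>i<n. w i * b i) \<le> \<beta>) \<or>
         (\<exists>(b, \<beta>)\<in>conic S. (\<forall>i<n. b i = 0) \<and> \<beta> < 0)"
  using assms
proof (induction n arbitrary: S)
  case 0
  show ?case
  proof (cases "\<forall>(b, \<beta>)\<in>S. 0 \<le> \<beta>")
    case False
    then show ?thesis by (auto intro!: bexI[OF _ conic.base])
  qed auto
next
  case (Suc n)
  define P N Z where "P = {s\<in>S. fst s n > 0}" and "N = {s\<in>S. fst s n < 0}" and "Z = {s\<in>S. fst s n = 0}"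
  \<comment> \<open>The multipliers \<open>- fst q n\<close> and \<open>fst p n\<close> are positive
    and make the coordinates \<open>n\<close> cancel.\<close>
  define comb where "comb = (\<lambda>(p, q). (\<lambda>i. (- fst q n) * fst p i + fst p n * fst q i,
      (- fst q n) * snd p + fst p n * snd q :: real))"
  define S' where "S' = Z \<union> comb ` (P \<times> N)"
  have fin: "finite P" "finite N" "finite Z" "finite S'"
    using Suc.prems by (auto simp: P_def N_def Z_def S'_def)
  have comb_conic: "comb (p, q) \<in> conic S" if "p \<in> P" "q \<in> N" for p q
  proof -
    have "(fst p, snd p) \<in> conic S" "(fst q, snd q) \<in> conic S"
      using that by (auto simp: P_def N_def intro: conic.base)
    then show ?thesis
      using that conic.add[OF conic.scale conic.scale, of "fst p" "snd p" S "- fst q n" "fst q" "snd q" "fst p n"]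
      by (auto simp: comb_def P_def N_def)
  qed
  have sub: "S' \<subseteq> conic S" using comb_conic by (auto simp: S'_def Z_def intro: conic.base)
  \<comment> \<open>This turns a contradiction with \<open>n\<close> vanishing coordinates into one
    with \<open>Suc n\<close>.\<close>
  have zero: "fst s n = 0" if "s \<in> conic S'" for s
    using that
  proof induction
    case (base s)
    then show ?case by (auto simp: S'_def Z_def comb_def)
  qed auto
  from Suc.IH[OF fin(4)] show ?case
  proof
    assume "\<exists>(b, \<beta>)\<in>conic S'. (\<forall>i<n. b i = 0) \<and> \<beta> < 0"
    then obtain b \<beta> where b: "(b, \<beta>) \<in> conic S'" "\<forall>i<n. b i = 0" "\<beta> < 0" by auto
    moreover have "(b, \<beta>) \<in> conic S" using b(1) conic_subset[OF sub] by blast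
    moreover have "\<forall>i<Suc n. b i = 0" using b(2) zero[OF b(1)] by (auto simp: less_Suc_eq)
    ultimately show ?thesis by blast
  next
    assume "\<exists>w. \<forall>(b, \<beta>)\<in>S'. (\<Sum>i<n. w i * b i) \<le> \<beta>"
    then obtain w where w: "\<And>s. s \<in> S' \<Longrightarrow> (\<Sum>i<n. w i * fst s i) \<le> snd s" by fastforce
    define X where "X s = snd s - (\<Sum>i<n. w i * fst s i)" for s
    have pair: "X q / fst q n \<le> X p / fst p n" if "p \<in> P" "q \<in> N" for p q
    proof -
      have "(\<Sum>i<n. w i * ((- fst q n) * fst p i + fst p n * fst q i)) \<le> (- fst q n) * snd p + fst p n * snd q"
      proof -
        have "comb (p, q) \<in> S'" using that unfolding S'_def by blast
        from w[OF this] show ?thesis by (simp add: comb_def)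
      qed
      also have "(\<Sum>i<n. w i * ((- fst q n) * fst p i + fst p n * fst q i)) =
        (- fst q n) * (\<Sum>i<n. w i * fst p i) + fst p n * (\<Sum>i<n. w i * fst q i)"
        unfolding sum_distrib_left sum.distrib[symmetric] by (intro sum.cong refl) (simp add: algebra_simps)
      finally have "(- fst q n) * X p + fst p n * X q \<ge> 0" by (simp add: X_def algebra_simps)
      moreover have "fst p n > 0" "fst q n < 0" using that by (auto simp: P_def N_def)
      ultimately show ?thesis by (simp add: field_simps)
    qed
    \<comment> \<open>Any \<open>t\<close> between the lower bounds from \<open>N\<close> and the
      upper bounds from \<open>P\<close> can serve as the value of the eliminated unknown.\<close>
    have "\<exists>t. (\<forall>x\<in>(\<lambda>q. X q / fst q n) ` N. x \<le> t) \<and> (\<forall>y\<in>(\<lambda>p. X p / fst p n) ` P. t \<le> y)"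
      by (rule separating_real) (use fin pair in auto)
    then obtain t where t: "\<And>q. q \<in> N \<Longrightarrow> X q / fst q n \<le> t" "\<And>p. p \<in> P \<Longrightarrow> t \<le> X p / fst p n"
      by auto
    have "(\<Sum>i<Suc n. (w(n := t)) i * fst s i) \<le> snd s" if s: "s \<in> S" for s
    proof -
      have "t * fst s n \<le> X s"
      proof (cases "fst s n" "0 :: real" rule: linorder_cases)
        case less
        then show ?thesis using t(1)[of s] s by (simp add: N_def field_simps)
      next
        case equal
        then show ?thesis using w[of s] s by (simp add: S'_def Z_def X_def)
      next
        case greater
        then show ?thesis using t(2)[of s] s by (simp add: P_def field_simps)
      qed
      then show ?thesis by (simp add: X_def)
    qed
    then show ?thesis by (intro disjI1 exI[of _ "w(n := t)"]) auto
  qed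
qed

section \<open>Minkowski combinations of polytopes\<close>

lemma compact_mink_comb:
  assumes "\<forall>L\<in>set Ls. compact L"
  shows "compact (mink_comb n Ls l)"
proof -
  \<comment> \<open>Indices beyond the list get a singleton, so that the product over all of
    \<open>nat\<close> stays compact.\<close>
  let ?X = "\<lambda>j. if j < length Ls then Ls ! j else {\<lambda>_. 0}"
  let ?f = "\<lambda>x i. if i < n then \<Sum>j<length Ls. l j * x j i else undefined"
  have "compact (PiE UNIV ?X)" using assms by (intro compact_PiE_UNIV) auto
  moreover have "continuous_on (PiE UNIV ?X) ?f"
  proof (rule continuous_on_coordinatewise_then_product)
    fix i
    have "continuous_on UNIV (\<lambda>x :: nat \<Rightarrow> nat \<Rightarrow> real. x j i)" for j
      using continuous_on_compose2[OF continuous_on_product_coordinates[of i] continuous_on_product_coordinates[of j]] by auto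
    then have "continuous_on UNIV (\<lambda>x. if i < n then \<Sum>j<length Ls. l j * x j i else undefined)"
      by (cases "i < n") (auto intro!: continuous_intros)
    then show "continuous_on (PiE UNIV ?X) (\<lambda>x. if i < n then \<Sum>j<length Ls. l j * x j i else undefined)"
      by (rule continuous_on_subset) auto
  qed
  ultimately have "compact (?f ` PiE UNIV ?X)" by (rule compact_continuous_image[rotated])
  moreover have "mink_comb n Ls l = ?f ` PiE UNIV ?X"
  proof
    show "mink_comb n Ls l \<subseteq> ?f ` PiE UNIV ?X"
    proof
      fix y assume "y \<in> mink_comb n Ls l"
      then obtain x where y: "y = (\<lambda>i\<in>{..<n}. \<Sum>j<length Ls. l j * x j i)" and x: "\<forall>j<length Ls. x j \<in> Ls ! j"
        by (auto simp: mink_comb_def)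
      show "y \<in> ?f ` PiE UNIV ?X"
        by (rule image_eqI[of _ _ "\<lambda>j. if j < length Ls then x j else (\<lambda>_. 0)"])
          (use x in \<open>auto simp: y restrict_def fun_eq_iff PiE_iff\<close>)
    qed
    show "?f ` PiE UNIV ?X \<subseteq> mink_comb n Ls l"
    proof
      fix y assume "y \<in> ?f ` PiE UNIV ?X"
      then obtain x where x: "x \<in> PiE UNIV ?X" and y: "y = ?f x" by blast
      have "x j \<in> Ls ! j" if "j < length Ls" for j using PiE_mem[OF x, of j] that by simp
      then show "y \<in> mink_comb n Ls l"
        unfolding mink_comb_def by (intro CollectI exI[of _ x]) (auto simp: y restrict_def fun_eq_iff)
    qed
  qed
  ultimately show ?thesis by simp
qed

definition pt_hull :: "nat \<Rightarrow> (nat \<Rightarrow> real) set \<Rightarrow> (nat \<Rightarrow> real) set" where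
  "pt_hull n A = {(\<lambda>i\<in>{..<n}. \<Sum>a\<in>A. c a * a i) | c. (\<forall>a\<in>A. 0 \<le> c a) \<and> sum c A = 1}"

lemma compact_pt_hull:
  assumes "finite A"
  shows "compact (pt_hull n A)"
proof -
  let ?C = "PiE UNIV (\<lambda>_. {0..1::real}) \<inter> {c. sum c A = 1}"
  let ?f = "\<lambda>c i. if i < n then \<Sum>a\<in>A. c a * a i else undefined"
  have "closed {c :: (nat \<Rightarrow> real) \<Rightarrow> real. sum c A = 1}"
    by (intro closed_Collect_eq continuous_intros continuous_on_product_coordinates)
  then have "compact ?C" by (intro compact_Int_closed compact_PiE_UNIV) auto
  moreover have "continuous_on ?C ?f"
  proof (rule continuous_on_coordinatewise_then_product)
    fix i
    have "continuous_on UNIV (\<lambda>c :: (nat \<Rightarrow> real) \<Rightarrow> real. if i < n then \<Sum>a\<in>A. c a * a i else undefined)"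
      by (cases "i < n") (auto intro!: continuous_intros continuous_on_product_coordinates)
    then show "continuous_on ?C (\<lambda>c. if i < n then \<Sum>a\<in>A. c a * a i else undefined)"
      by (rule continuous_on_subset) auto
  qed
  ultimately have "compact (?f ` ?C)" by (rule compact_continuous_image[rotated])
  moreover have "pt_hull n A = ?f ` ?C"
  proof
    show "pt_hull n A \<subseteq> ?f ` ?C"
    proof
      fix y assume "y \<in> pt_hull n A"
      then obtain c where y: "y = (\<lambda>i\<in>{..<n}. \<Sum>a\<in>A. c a * a i)" and c: "\<And>a. a \<in> A \<Longrightarrow> 0 \<le> c a" "sum c A = 1"
        by (auto simp: pt_hull_def)
      have "c a \<le> 1" if "a \<in> A" for a
        using member_le_sum[of a A c] that c assms by auto
      then show "y \<in> ?f ` ?C"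
        by (intro image_eqI[of _ _ "\<lambda>a. if a \<in> A then c a else 0"])
          (use c in \<open>auto simp: y restrict_def fun_eq_iff PiE_iff intro!: sum.cong\<close>)
    qed
    show "?f ` ?C \<subseteq> pt_hull n A"
      unfolding pt_hull_def by (auto simp: restrict_def fun_eq_iff PiE_iff)
  qed
  ultimately show ?thesis by simp
qed

text \<open>The points of \<open>A j\<close> may have more than \<open>n\<close> coordinates, and
  only the first \<open>n\<close> are read. Passing from \<open>Suc n\<close> to \<open>n\<close>
  thus projects the body while \<open>A\<close> stays the same. Moreover \<open>A\<close> is
  independent of \<open>l\<close>, so one family of point sets describes the bodies for all
  coefficients.\<close>

definition polysum :: "nat \<Rightarrow> nat \<Rightarrow> (nat \<Rightarrow> (nat \<Rightarrow> real) set) \<Rightarrow> (nat \<Rightarrow> real) \<Rightarrow> (nat \<Rightarrow> real) set" where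
  "polysum n r A l = {(\<lambda>i\<in>{..<n}. \<Sum>j<r. l j * (\<Sum>a\<in>A j. c j a * a i)) | c.
     \<forall>j<r. (\<forall>a\<in>A j. 0 \<le> c j a) \<and> sum (c j) (A j) = 1}"

lemma polysum_eq_mink_comb: "polysum n r A l = mink_comb n (map (\<lambda>j. pt_hull n (A j)) [0..<r]) l"
proof
  show "polysum n r A l \<subseteq> mink_comb n (map (\<lambda>j. pt_hull n (A j)) [0..<r]) l"
  proof
    fix y assume "y \<in> polysum n r A l"
    then obtain c where y: "y = (\<lambda>i\<in>{..<n}. \<Sum>j<r. l j * (\<Sum>a\<in>A j. c j a * a i))"
      and c: "\<forall>j<r. (\<forall>a\<in>A j. 0 \<le> c j a) \<and> sum (c j) (A j) = 1" by (auto simp: polysum_def)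
    show "y \<in> mink_comb n (map (\<lambda>j. pt_hull n (A j)) [0..<r]) l"
      unfolding mink_comb_def
      by (intro CollectI exI[of _ "\<lambda>j. \<lambda>i\<in>{..<n}. \<Sum>a\<in>A j. c j a * a i"] conjI)
        (use c in \<open>auto simp: y pt_hull_def\<close>)
  qed
  show "mink_comb n (map (\<lambda>j. pt_hull n (A j)) [0..<r]) l \<subseteq> polysum n r A l"
  proof
    fix y assume "y \<in> mink_comb n (map (\<lambda>j. pt_hull n (A j)) [0..<r]) l"
    then obtain x where y: "y = (\<lambda>i\<in>{..<n}. \<Sum>j<r. l j * x j i)" and x: "\<And>j. j < r \<Longrightarrow> x j \<in> pt_hull n (A j)"
      by (auto simp: mink_comb_def)
    have "\<forall>j. \<exists>c. j < r \<longrightarrow> x j = (\<lambda>i\<in>{..<n}. \<Sum>a\<in>A j. c a * a i) \<and> (\<forall>a\<in>A j. 0 \<le> c a) \<and> sum c (A j) = 1"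
      using x by (auto simp: pt_hull_def)
    from choice[OF this] obtain c where c: "\<forall>j<r. x j = (\<lambda>i\<in>{..<n}. \<Sum>a\<in>A j. c j a * a i) \<and>
      (\<forall>a\<in>A j. 0 \<le> c j a) \<and> sum (c j) (A j) = 1" ..
    show "y \<in> polysum n r A l"
      unfolding polysum_def
      by (intro CollectI exI[of _ c] conjI) (use c in \<open>auto simp: y fun_eq_iff restrict_def intro!: sum.cong\<close>)
  qed
qed

lemma compact_polysum:
  assumes "\<forall>j<r. finite (A j)"
  shows "compact (polysum n r A l)"
  unfolding polysum_eq_mink_comb using assms by (intro compact_mink_comb) (auto intro: compact_pt_hull)

lemma restrict_in_rn: "restrict f {..<n} \<in> rn n"
  by (auto simp: rn_def)

lemma mink_comb_subset_rn: "mink_comb n Ls l \<subseteq> rn n"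
  unfolding mink_comb_def by (blast intro: restrict_in_rn)

lemma polysum_subset_rn: "polysum n r A l \<subseteq> rn n"
  unfolding polysum_def by (blast intro: restrict_in_rn)

lemma polysum_sets:
  assumes "\<forall>j<r. finite (A j)"
  shows "polysum n r A l \<in> sets (Leb n)"
  using assms by (intro closed_measurable compact_imp_closed compact_polysum polysum_subset_rn)

lemma polysum_convex:
  assumes "x \<in> polysum n r A l" "y \<in> polysum n r A l" "0 \<le> u" "0 \<le> v" "u + v = 1"
  shows "(\<lambda>i\<in>{..<n}. u * x i + v * y i) \<in> polysum n r A l"
proof -
  obtain c where x: "x = (\<lambda>i\<in>{..<n}. \<Sum>j<r. l j * (\<Sum>a\<in>A j. c j a * a i))"
    and c: "\<forall>j<r. (\<forall>a\<in>A j. 0 \<le> c j a) \<and> sum (c j) (A j) = 1"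
    using assms(1) by (auto simp: polysum_def)
  obtain d where y: "y = (\<lambda>i\<in>{..<n}. \<Sum>j<r. l j * (\<Sum>a\<in>A j. d j a * a i))"
    and d: "\<forall>j<r. (\<forall>a\<in>A j. 0 \<le> d j a) \<and> sum (d j) (A j) = 1"
    using assms(2) by (auto simp: polysum_def)
  show ?thesis
    unfolding polysum_def
  proof (intro CollectI exI[of _ "\<lambda>j a. u * c j a + v * d j a"] conjI allI impI ballI)
    show "(\<lambda>i\<in>{..<n}. u * x i + v * y i) =
      (\<lambda>i\<in>{..<n}. \<Sum>j<r. l j * (\<Sum>a\<in>A j. (u * c j a + v * d j a) * a i))"
    proof (rule restrict_ext)
      fix i assume "i \<in> {..<n}"
      then have "u * x i + v * y i =
        (\<Sum>j<r. u * (l j * (\<Sum>a\<in>A j. c j a * a i)) + v * (l j * (\<Sum>a\<in>A j. d j a * a i)))"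
        by (simp add: x y sum_distrib_left sum.distrib)
      also have "\<dots> = (\<Sum>j<r. l j * (\<Sum>a\<in>A j. (u * c j a + v * d j a) * a i))"
      proof (intro sum.cong refl)
        fix j
        have "(\<Sum>a\<in>A j. (u * c j a + v * d j a) * a i) = u * (\<Sum>a\<in>A j. c j a * a i) + v * (\<Sum>a\<in>A j. d j a * a i)"
          unfolding sum_distrib_left sum.distrib[symmetric] by (intro sum.cong refl) (simp add: distrib_right mult.assoc)
        then show "u * (l j * (\<Sum>a\<in>A j. c j a * a i)) + v * (l j * (\<Sum>a\<in>A j. d j a * a i)) =
          l j * (\<Sum>a\<in>A j. (u * c j a + v * d j a) * a i)" by (simp add: algebra_simps)
      qed
      finally show "u * x i + v * y i = (\<Sum>j<r. l j * (\<Sum>a\<in>A j. (u * c j a + v * d j a) * a i))" .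
    qed
    fix j assume "j < r"
    then show "(\<Sum>a\<in>A j. u * c j a + v * d j a) = 1"
      using c d assms(5) by (simp only: sum.distrib sum_distrib_left[symmetric] mult_1_right)
    fix a assume "a \<in> A j"
    then show "0 \<le> u * c j a + v * d j a" using \<open>j < r\<close> c d assms(3,4) by (meson add_nonneg_nonneg mult_nonneg_nonneg)
  qed
qed

section \<open>Cells of the upper and lower boundary\<close>

text \<open>With \<open>\<sigma> = 1\<close> the faces are upper faces in direction of the last coordinate, with \<open>\<sigma> = -1\<close> lower ones.\<close>

definition lift_val :: "nat \<Rightarrow> real \<Rightarrow> (nat \<Rightarrow> real) \<Rightarrow> (nat \<Rightarrow> real) \<Rightarrow> real" where
  "lift_val n \<sigma> w a = (\<Sum>i<n. w i * a i) + \<sigma> * a n"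

definition face :: "nat \<Rightarrow> real \<Rightarrow> (nat \<Rightarrow> real) \<Rightarrow> (nat \<Rightarrow> real) set \<Rightarrow> (nat \<Rightarrow> real) set" where
  "face n \<sigma> w B = {a\<in>B. \<forall>b\<in>B. lift_val n \<sigma> w b \<le> lift_val n \<sigma> w a}"

text \<open>For finite nonempty \<open>B\<close> this is the support function of its convex hull at
  \<open>(w, \<sigma>)\<close>.\<close>

definition face_val :: "nat \<Rightarrow> real \<Rightarrow> (nat \<Rightarrow> real) \<Rightarrow> (nat \<Rightarrow> real) set \<Rightarrow> real" where
  "face_val n \<sigma> w B = Max (lift_val n \<sigma> w ` B)"

lemma face_subset: "face n \<sigma> w B \<subseteq> B"
  by (auto simp: face_def)

lemma face_nonempty:
  assumes "finite B" "B \<noteq> {}"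
  shows "face n \<sigma> w B \<noteq> {}"
proof -
  have "Max (lift_val n \<sigma> w ` B) \<in> lift_val n \<sigma> w ` B" using assms by (intro Max_in) auto
  then obtain a where "a \<in> B" "lift_val n \<sigma> w a = Max (lift_val n \<sigma> w ` B)" by auto
  then have "a \<in> face n \<sigma> w B" using assms by (auto simp: face_def)
  then show ?thesis by auto
qed

lemma lift_val_le_face_val:
  assumes "finite B" "a \<in> B"
  shows "lift_val n \<sigma> w a \<le> face_val n \<sigma> w B"
  unfolding face_val_def using assms by (intro Max_ge) auto

lemma lift_val_eq_face_val:
  assumes "finite B" "a \<in> face n \<sigma> w B"
  shows "lift_val n \<sigma> w a = face_val n \<sigma> w B"
  unfolding face_val_def using assms by (intro Max_eqI[symmetric]) (auto simp: face_def)

lemma face_eq_iff: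
  assumes "finite B" "B \<noteq> {}" "a \<in> B"
  shows "a \<in> face n \<sigma> w B \<longleftrightarrow> lift_val n \<sigma> w a = face_val n \<sigma> w B"
  using assms lift_val_eq_face_val[OF assms(1)] lift_val_le_face_val[OF assms(1)]
  by (auto simp: face_def)

lemma face_cong:
  assumes "\<And>i. i < n \<Longrightarrow> w i = w' i"
  shows "face n \<sigma> w B = face n \<sigma> w' B"
  using assms by (simp add: face_def lift_val_def)

text \<open>For nonnegative \<open>l\<close>, a face of a Minkowski combination is the combination
  of the faces of its summands in the same direction. A cell is such a face, projected along the
  last coordinate.\<close>

abbreviation cell :: "nat \<Rightarrow> nat \<Rightarrow> real \<Rightarrow> (nat \<Rightarrow> (nat \<Rightarrow> real) set) \<Rightarrow> (nat \<Rightarrow> real) \<Rightarrow> (nat \<Rightarrow> real) \<Rightarrow> (nat \<Rightarrow> real) set" where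
  "cell n r \<sigma> A l w \<equiv> polysum n r (\<lambda>j. face n \<sigma> w (A j)) l"

text \<open>The supporting hyperplane in direction \<open>(w, \<sigma>)\<close>, solved for \<sigma>
  times the last coordinate. Being linear in \<open>x\<close> and \<open>l\<close> jointly, it keeps
  the induction among homogeneous polynomials.\<close>

definition cell_height :: "nat \<Rightarrow> nat \<Rightarrow> real \<Rightarrow> (nat \<Rightarrow> (nat \<Rightarrow> real) set) \<Rightarrow> (nat \<Rightarrow> real) \<Rightarrow> (nat \<Rightarrow> real) \<Rightarrow> (nat \<Rightarrow> real) \<Rightarrow> real" where
  "cell_height n r \<sigma> A w x l = (\<Sum>j<r. l j * face_val n \<sigma> w (A j)) - (\<Sum>i<n. w i * x i)"

lemma polysumI:
  assumes "\<And>j a. j < r \<Longrightarrow> a \<in> A j \<Longrightarrow> 0 \<le> c j a" "\<And>j. j < r \<Longrightarrow> sum (c j) (A j) = 1"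
    "x \<in> rn n" "\<And>i. i < n \<Longrightarrow> x i = (\<Sum>j<r. l j * (\<Sum>a\<in>A j. c j a * a i))"
  shows "x \<in> polysum n r A l"
  unfolding polysum_def
proof (intro CollectI exI[of _ c] conjI)
  show "x = (\<lambda>i\<in>{..<n}. \<Sum>j<r. l j * (\<Sum>a\<in>A j. c j a * a i))"
    using assms(3,4) by (auto simp: fun_eq_iff rn_def PiE_def extensional_def)
qed (use assms in auto)

lemma polysumE:
  assumes "x \<in> polysum n r A l"
  obtains c where "\<And>j a. j < r \<Longrightarrow> a \<in> A j \<Longrightarrow> 0 \<le> c j a" "\<And>j. j < r \<Longrightarrow> sum (c j) (A j) = 1"
    "\<And>i. i < n \<Longrightarrow> x i = (\<Sum>j<r. l j * (\<Sum>a\<in>A j. c j a * a i))"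
proof -
  from assms obtain c where "x = (\<lambda>i\<in>{..<n}. \<Sum>j<r. l j * (\<Sum>a\<in>A j. c j a * a i))"
    "\<forall>j<r. (\<forall>a\<in>A j. 0 \<le> c j a) \<and> sum (c j) (A j) = 1" by (auto simp: polysum_def)
  then show ?thesis by (intro that[of c]) auto
qed

lemma lift_val_combination:
  fixes x :: "nat \<Rightarrow> real"
  assumes "\<And>i. i < Suc n \<Longrightarrow> x i = (\<Sum>j<r. l j * (\<Sum>a\<in>A j. c j a * a i))"
  shows "lift_val n \<sigma> w x = (\<Sum>j<r. l j * (\<Sum>a\<in>A j. c j a * lift_val n \<sigma> w a))"
proof -
  have "(\<Sum>i<n. w i * x i) = (\<Sum>i<n. \<Sum>j<r. \<Sum>a\<in>A j. l j * (c j a * (w i * a i)))"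
    using assms by (intro sum.cong) (auto simp: sum_distrib_left mult_ac)
  also have "\<dots> = (\<Sum>j<r. \<Sum>a\<in>A j. \<Sum>i<n. l j * (c j a * (w i * a i)))"
    by (subst sum.swap) (intro sum.cong refl sum.swap)
  also have "\<dots> = (\<Sum>j<r. l j * (\<Sum>a\<in>A j. c j a * (\<Sum>i<n. w i * a i)))"
    by (simp add: sum_distrib_left)
  finally have 1: "(\<Sum>i<n. w i * x i) = (\<Sum>j<r. l j * (\<Sum>a\<in>A j. c j a * (\<Sum>i<n. w i * a i)))" .
  have 2: "\<sigma> * x n = (\<Sum>j<r. l j * (\<Sum>a\<in>A j. c j a * (\<sigma> * a n)))"
    using assms[of n] by (simp add: sum_distrib_left mult_ac)
  show ?thesis
    unfolding lift_val_def 1 2 by (simp add: sum.distrib distrib_left)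
qed

text \<open>The weights that represent \<open>x\<close> in its cell, extended by zero off the faces,
  also represent a point of the body above \<open>x\<close>. Only points attaining
  \<open>face_val\<close> carry weight, so the height is exact.\<close>

lemma cell_lift:
  assumes fin: "\<And>j. j < r \<Longrightarrow> finite (A j)" and x: "x \<in> cell n r \<sigma> A l w"
  shows "\<exists>y\<in>polysum (Suc n) r A l. (\<forall>i<n. y i = x i) \<and> \<sigma> * y n = cell_height n r \<sigma> A w x l"
proof -
  from x obtain c where c: "\<And>j a. j < r \<Longrightarrow> a \<in> face n \<sigma> w (A j) \<Longrightarrow> 0 \<le> c j a"
      "\<And>j. j < r \<Longrightarrow> sum (c j) (face n \<sigma> w (A j)) = 1"
    and xi: "\<And>i. i < n \<Longrightarrow> x i = (\<Sum>j<r. l j * (\<Sum>a\<in>face n \<sigma> w (A j). c j a * a i))"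
    by (rule polysumE) blast
  define d where "d j a = (if a \<in> face n \<sigma> w (A j) then c j a else 0)" for j a
  have ext: "(\<Sum>a\<in>A j. d j a * g a) = (\<Sum>a\<in>face n \<sigma> w (A j). c j a * g a)" if "j < r" for j g
    by (rule sum.mono_neutral_cong_right) (use fin[OF that] face_subset in \<open>auto simp: d_def\<close>)
  define y where "y = (\<lambda>i\<in>{..<Suc n}. \<Sum>j<r. l j * (\<Sum>a\<in>A j. d j a * a i))"
  have "y \<in> polysum (Suc n) r A l"
  proof (rule polysumI)
    fix j assume "j < r"
    then show "sum (d j) (A j) = 1" using ext[of j "\<lambda>_. 1"] c(2) by simp
  next
    show "y \<in> rn (Suc n)" unfolding y_def by (rule restrict_in_rn)
  qed (use c in \<open>auto simp: d_def y_def\<close>)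
  moreover have yx: "y i = x i" if "i < n" for i using that by (simp add: y_def xi ext)
  moreover have "lift_val n \<sigma> w y = (\<Sum>j<r. l j * (\<Sum>a\<in>A j. d j a * lift_val n \<sigma> w a))"
    by (rule lift_val_combination) (simp add: y_def)
  moreover have "\<dots> = (\<Sum>j<r. l j * (\<Sum>a\<in>face n \<sigma> w (A j). c j a * face_val n \<sigma> w (A j)))"
  proof (intro sum.cong refl)
    fix j assume "j \<in> {..<r}"
    then show "l j * (\<Sum>a\<in>A j. d j a * lift_val n \<sigma> w a) =
      l j * (\<Sum>a\<in>face n \<sigma> w (A j). c j a * face_val n \<sigma> w (A j))"
      using fin lift_val_eq_face_val[of "A j" _ n \<sigma> w] by (simp add: ext)
  qed
  moreover have "\<dots> = (\<Sum>j<r. l j * face_val n \<sigma> w (A j))"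
    using c(2) by (simp add: sum_distrib_right[symmetric])
  ultimately show ?thesis
    by (intro bexI[of _ y]) (auto simp: cell_height_def lift_val_def)
qed

text \<open>Weak duality: each point is bounded by the maximum over its own set, and nonnegative
  weights and coefficients preserve the bound.\<close>

lemma cell_height_upper:
  assumes fin: "\<And>j. j < r \<Longrightarrow> finite (A j)" and y: "y \<in> polysum (Suc n) r A l"
    and l: "\<And>j. j < r \<Longrightarrow> 0 \<le> l j"
  shows "\<sigma> * y n \<le> cell_height n r \<sigma> A w y l"
proof -
  from y obtain c where c: "\<And>j a. j < r \<Longrightarrow> a \<in> A j \<Longrightarrow> 0 \<le> c j a"
      "\<And>j. j < r \<Longrightarrow> sum (c j) (A j) = 1"
    and yi: "\<And>i. i < Suc n \<Longrightarrow> y i = (\<Sum>j<r. l j * (\<Sum>a\<in>A j. c j a * a i))"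
    by (rule polysumE) blast
  have "lift_val n \<sigma> w y = (\<Sum>j<r. l j * (\<Sum>a\<in>A j. c j a * lift_val n \<sigma> w a))"
    by (rule lift_val_combination[OF yi])
  also have "\<dots> \<le> (\<Sum>j<r. l j * (\<Sum>a\<in>A j. c j a * face_val n \<sigma> w (A j)))"
    using c l fin by (intro sum_mono mult_left_mono lift_val_le_face_val) auto
  also have "\<dots> = (\<Sum>j<r. l j * face_val n \<sigma> w (A j))"
    using c(2) by (simp add: sum_distrib_right[symmetric])
  finally show ?thesis by (simp add: cell_height_def lift_val_def)
qed

text \<open>LP duality: Farkas' lemma yields the direction \<open>w\<close>, complementary slackness puts the point into its cell.\<close>

lemma upper_point_in_cell:
  assumes fin: "\<And>j. j < r \<Longrightarrow> finite (A j) \<and> A j \<noteq> {}" and l: "\<And>j. j < r \<Longrightarrow> 0 \<le> l j"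
    and y: "y \<in> polysum (Suc n) r A l"
    and ymax: "\<And>z. z \<in> polysum (Suc n) r A l \<Longrightarrow> (\<And>i. i < n \<Longrightarrow> z i = y i) \<Longrightarrow> \<sigma> * z n \<le> \<sigma> * y n"
  shows "\<exists>w. restrict y {..<n} \<in> cell n r \<sigma> A l w"
proof -
  define vert where "vert a = (\<lambda>i\<in>{..<Suc n}. \<Sum>j<r. l j * a j i)" for a :: "nat \<Rightarrow> nat \<Rightarrow> real"
  \<comment> \<open>The inequality for \<open>a\<close> says
    \<open>lift_val n \<sigma> w (vert a) \<le> lift_val n \<sigma> w y\<close>: a solution
    \<open>w\<close> is a direction in which \<open>y\<close> is maximal.\<close>
  define S where "S = (\<lambda>a. (\<lambda>i. vert a i - y i, \<sigma> * (y n - vert a n))) ` PiE {..<r} A"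
  have vert: "vert a \<in> polysum (Suc n) r A l" if a: "a \<in> PiE {..<r} A" for a
  proof (rule polysumI[where c="\<lambda>j b. if b = a j then 1 else 0"])
    fix j assume j: "j < r"
    have aj: "a j \<in> A j" using a j by auto
    then show "(\<Sum>b\<in>A j. if b = a j then 1 else 0) = (1 :: real)" using fin[OF j] by simp
  next
    show "vert a \<in> rn (Suc n)" unfolding vert_def by (rule restrict_in_rn)
  next
    fix i assume "i < Suc n"
    moreover have "(\<Sum>b\<in>A j. (if b = a j then 1 else 0) * b i) = a j i" if j: "j < r" for j
    proof -
      have "a j \<in> A j" using a j by auto
      then show ?thesis using fin[OF j] by (simp add: if_distrib[of "\<lambda>u. u * _"] cong: if_cong)
    qed
    ultimately show "vert a i = (\<Sum>j<r. l j * (\<Sum>b\<in>A j. (if b = a j then 1 else 0) * b i))"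
      by (simp add: vert_def)
  qed auto
  \<comment> \<open>By convexity, a positive combination of these inequalities is a multiple of the
    one that belongs to a single point \<open>z\<close> of the body.\<close>
  have conic: "\<exists>\<kappa>\<ge>0. \<exists>z\<in>polysum (Suc n) r A l. (\<forall>i<n. fst s i = \<kappa> * (z i - y i)) \<and> snd s = \<kappa> * (\<sigma> * (y n - z n))"
    if "s \<in> conic S" for s
    using that
  proof induction
    case (base s)
    then obtain a where "a \<in> PiE {..<r} A" "s = (\<lambda>i. vert a i - y i, \<sigma> * (y n - vert a n))"
      by (auto simp: S_def)
    then show ?case using vert by (intro exI[of _ 1] conjI bexI[of _ "vert a"]) auto
  next
    case (add b \<beta> b' \<beta>')
    obtain \<kappa> z where 1: "0 \<le> \<kappa>" "z \<in> polysum (Suc n) r A l" "\<forall>i<n. b i = \<kappa> * (z i - y i)" "\<beta> = \<kappa> * (\<sigma> * (y n - z n))"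
      using add.IH(1) by auto
    obtain \<kappa>' z' where 2: "0 \<le> \<kappa>'" "z' \<in> polysum (Suc n) r A l" "\<forall>i<n. b' i = \<kappa>' * (z' i - y i)" "\<beta>' = \<kappa>' * (\<sigma> * (y n - z' n))"
      using add.IH(2) by auto
    show ?case
    proof (cases "\<kappa> + \<kappa>' = 0")
      case True
      then have "\<kappa> = 0" "\<kappa>' = 0" using 1(1) 2(1) by auto
      then show ?thesis using 1 2 by (intro exI[of _ 0] conjI bexI[of _ z]) auto
    next
      case False
      define u v where "u = \<kappa> / (\<kappa> + \<kappa>')" and "v = \<kappa>' / (\<kappa> + \<kappa>')"
      have uv: "0 \<le> u" "0 \<le> v" "u + v = 1" "(\<kappa> + \<kappa>') * u = \<kappa>" "(\<kappa> + \<kappa>') * v = \<kappa>'"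
        using False 1(1) 2(1) by (auto simp: u_def v_def add_divide_distrib[symmetric])
      let ?z = "\<lambda>i\<in>{..<Suc n}. u * z i + v * z' i"
      have key: "(\<kappa> + \<kappa>') * (u * p + v * p' - q) = \<kappa> * (p - q) + \<kappa>' * (p' - q)" for p p' q
        using uv(4,5) by (simp add: distrib_left right_diff_distrib distrib_right mult.assoc[symmetric])
      have key': "(\<kappa> + \<kappa>') * (\<sigma> * (q - (u * p + v * p'))) = \<kappa> * (\<sigma> * (q - p)) + \<kappa>' * (\<sigma> * (q - p'))" for p p' q
        using arg_cong[OF key[of p p' q], of "\<lambda>t. - \<sigma> * t"] by (simp add: algebra_simps)
      have "?z \<in> polysum (Suc n) r A l" using 1(2) 2(2) uv by (intro polysum_convex)
      then show ?thesis
        using 1 2 by (intro exI[of _ "\<kappa> + \<kappa>'"] conjI bexI[of _ ?z]) (auto simp: key key')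
    qed
  next
    case (scale b \<beta> t)
    then obtain \<kappa> z where 1: "0 \<le> \<kappa>" "z \<in> polysum (Suc n) r A l" "\<forall>i<n. b i = \<kappa> * (z i - y i)" "\<beta> = \<kappa> * (\<sigma> * (y n - z n))"
      by auto
    then show ?case using scale.hyps(2) by (intro exI[of _ "t * \<kappa>"] conjI bexI[of _ z]) auto
  qed
  \<comment> \<open>A contradiction would come from a point \<open>z\<close> with the same first
    \<open>n\<close> coordinates as \<open>y\<close> and larger \<open>\<sigma> * z n\<close>,
    against \<open>ymax\<close>.\<close>
  have no: "\<not> (\<exists>(b, \<beta>)\<in>conic S. (\<forall>i<n. b i = 0) \<and> \<beta> < 0)"
  proof
    assume "\<exists>(b, \<beta>)\<in>conic S. (\<forall>i<n. b i = 0) \<and> \<beta> < 0"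
    then obtain b \<beta> where b: "(b, \<beta>) \<in> conic S" "\<forall>i<n. b i = 0" "\<beta> < 0" by auto
    from conic[OF b(1)] obtain \<kappa> z where z: "0 \<le> \<kappa>" "z \<in> polysum (Suc n) r A l"
      "\<forall>i<n. b i = \<kappa> * (z i - y i)" "\<beta> = \<kappa> * (\<sigma> * (y n - z n))" by auto
    have "\<kappa> > 0" using z b(3) by (cases "\<kappa> = 0") auto
    then have "\<And>i. i < n \<Longrightarrow> z i = y i" using z(3) b(2) by auto
    then have "\<sigma> * z n \<le> \<sigma> * y n" using ymax z(2) by blast
    then have "0 \<le> \<sigma> * (y n - z n)" by (simp add: right_diff_distrib)
    then have "0 \<le> \<beta>" unfolding z(4) using z(1) by (rule mult_nonneg_nonneg[rotated])
    with b(3) show False by simp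
  qed
  have "finite S" unfolding S_def using fin by (intro finite_imageI finite_PiE) auto
  from farkas[OF this, of n] no obtain w where w: "\<forall>(b, \<beta>)\<in>S. (\<Sum>i<n. w i * b i) \<le> \<beta>" by auto
  \<comment> \<open>A maximal point from every summand gives a combination that reaches the full
    support value; its inequality forces \<open>y\<close> to reach that value too.\<close>
  define p where "p j = (SOME a. a \<in> face n \<sigma> w (A j))" for j
  have p: "\<forall>j<r. p j \<in> face n \<sigma> w (A j)"
    using face_nonempty fin by (simp add: p_def some_in_eq)
  define p' where "p' = restrict p {..<r}"
  have p': "p' \<in> PiE {..<r} A" using p face_subset[of n \<sigma> w] by (auto simp: p'_def)
  have "lift_val n \<sigma> w (vert p') \<le> lift_val n \<sigma> w y"
    using w p' by (auto simp: S_def lift_val_def right_diff_distrib sum_subtractf)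
  moreover have "lift_val n \<sigma> w (vert p') = (\<Sum>j<r. l j * (\<Sum>a\<in>{p' j}. 1 * lift_val n \<sigma> w a))"
    by (rule lift_val_combination) (simp add: vert_def)
  moreover have "\<dots> = (\<Sum>j<r. l j * face_val n \<sigma> w (A j))"
    using p fin by (intro sum.cong) (auto simp: p'_def lift_val_eq_face_val)
  ultimately have le: "(\<Sum>j<r. l j * face_val n \<sigma> w (A j)) \<le> lift_val n \<sigma> w y" by simp
  from y obtain c where c: "\<And>j a. j < r \<Longrightarrow> a \<in> A j \<Longrightarrow> 0 \<le> c j a"
      "\<And>j. j < r \<Longrightarrow> sum (c j) (A j) = 1"
    and yi: "\<And>i. i < Suc n \<Longrightarrow> y i = (\<Sum>j<r. l j * (\<Sum>a\<in>A j. c j a * a i))"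
    by (rule polysumE) blast
  \<comment> \<open>Complementary slackness: the gaps are nonnegative and add up to 0, so for
    \<open>l j \<noteq> 0\<close> all weight sits on the face.\<close>
  define gap where "gap j a = l j * (c j a * (face_val n \<sigma> w (A j) - lift_val n \<sigma> w a))" for j a
  have gap_nonneg: "0 \<le> gap j a" if "j < r" "a \<in> A j" for j a
    unfolding gap_def using that c l fin lift_val_le_face_val[of "A j" a n \<sigma> w] by (intro mult_nonneg_nonneg) auto
  have "(\<Sum>j<r. \<Sum>a\<in>A j. gap j a) = (\<Sum>j<r. l j * face_val n \<sigma> w (A j)) - lift_val n \<sigma> w y"
    using c(2) lift_val_combination[OF yi, where \<sigma>=\<sigma> and w=w]
    by (simp add: gap_def right_diff_distrib sum_subtractf sum_distrib_left[symmetric] sum_distrib_right[symmetric])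
  then have "(\<Sum>j<r. \<Sum>a\<in>A j. gap j a) = 0"
    using le by (intro antisym sum_nonneg) (auto intro: gap_nonneg)
  then have "\<forall>j\<in>{..<r}. (\<Sum>a\<in>A j. gap j a) = 0"
    by (subst (asm) sum_nonneg_eq_0_iff) (auto intro: sum_nonneg gap_nonneg)
  then have gap0: "gap j a = 0" if "j < r" "a \<in> A j" for j a
    using that fin gap_nonneg sum_nonneg_eq_0_iff[of "A j" "gap j"] by auto
  \<comment> \<open>For \<open>l j = 0\<close> slackness does not restrict the weights; they are
    replaced by a point mass on the face, which leaves the combination unchanged.\<close>
  define d where "d j = (if l j = 0 then (\<lambda>a. if a = p j then 1 else 0) else c j)" for j
  have c0: "c j a = 0" if "j < r" "a \<in> A j" "a \<notin> face n \<sigma> w (A j)" "l j \<noteq> 0" for j a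
    using gap0[OF that(1,2)] that fin[OF that(1)] face_eq_iff[of "A j" a n \<sigma> w] by (auto simp: gap_def)
  have restr: "(\<Sum>a\<in>face n \<sigma> w (A j). c j a * g a) = (\<Sum>a\<in>A j. c j a * g a)" if "j < r" "l j \<noteq> 0" for j g
    by (rule sum.mono_neutral_left) (use fin that face_subset c0 in auto)
  have "restrict y {..<n} \<in> cell n r \<sigma> A l w"
  proof (rule polysumI[where c=d])
    fix j a assume "j < r" "a \<in> face n \<sigma> w (A j)"
    then show "0 \<le> d j a" using c face_subset[of n \<sigma> w "A j"] by (auto simp: d_def)
  next
    fix j assume j: "j < r"
    have "finite (face n \<sigma> w (A j))" using fin[OF j] finite_subset[OF face_subset] by blast
    then show "sum (d j) (face n \<sigma> w (A j)) = 1"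
      using c(2)[OF j] restr[OF j, of "\<lambda>_. 1"] p j by (auto simp: d_def)
  next
    fix i assume "i < n"
    then show "restrict y {..<n} i = (\<Sum>j<r. l j * (\<Sum>a\<in>face n \<sigma> w (A j). d j a * a i))"
      using restr by (auto simp: yi d_def intro!: sum.cong)
  qed (rule restrict_in_rn)
  then show ?thesis by (rule exI[of _ w])
qed

section \<open>Integrals over Minkowski combinations of polytopes\<close>

text \<open>Fubini with coordinate \<open>k\<close> integrated first: as
  \<open>v k \<noteq> 0\<close>, every line parallel to that axis meets the hyperplane in a single
  point.\<close>

lemma hyperplane_null:
  assumes k: "k < n" "v k \<noteq> 0"
  shows "{x\<in>rn n. (\<Sum>i<n. v i * x i) = b} \<in> null_sets (Leb n)"
proof -
  let ?N = "{x\<in>rn n. (\<Sum>i<n. v i * x i) = b}"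
  let ?I = "{..<n} - {k}"
  have ins: "{..<n} = insert k ?I" using k by auto
  have "closed {x. (\<Sum>i<n. v i * x i) = b}"
    by (intro closed_Collect_eq continuous_intros continuous_on_product_coordinates)
  then have "closed (rn n \<inter> {x. (\<Sum>i<n. v i * x i) = b})" using closed_rn by (rule closed_Int[rotated])
  then have N: "?N \<in> sets (Leb n)" by (intro closed_measurable) (auto simp: Int_def)
  have inner: "(\<integral>\<^sup>+ y. indicator ?N (x(k := y)) \<partial>lborel) = 0" for x :: "nat \<Rightarrow> real"
  proof -
    let ?c = "(b - (\<Sum>i\<in>?I. v i * x i)) / v k"
    have "indicator ?N (x(k := y)) \<le> (indicator {?c} y :: ennreal)" for y
    proof -
      have "(\<Sum>i<n. v i * (x(k := y)) i) = v k * y + (\<Sum>i\<in>?I. v i * x i)"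
        by (subst ins, subst sum.insert) (auto intro!: sum.cong)
      then show ?thesis using k by (auto simp: indicator_def field_simps)
    qed
    then have "(\<integral>\<^sup>+ y. indicator ?N (x(k := y)) \<partial>lborel) \<le> (\<integral>\<^sup>+ y. indicator {?c} y \<partial>lborel)"
      by (intro nn_integral_mono)
    then show ?thesis by simp
  qed
  have "emeasure (Leb n) ?N = (\<integral>\<^sup>+ x. indicator ?N x \<partial>Leb n)" using N by simp
  also have "\<dots> = (\<integral>\<^sup>+ x. \<integral>\<^sup>+ y. indicator ?N (x(k := y)) \<partial>lborel \<partial>PiM ?I (\<lambda>_. lborel))"
    by (rule Leb.product_nn_integral_insert[of ?I k "indicator ?N", unfolded ins[symmetric]]) (use N in auto)
  also have "\<dots> = 0" by (simp add: inner)
  finally show ?thesis using N by (intro null_setsI)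
qed

lemma polysum_cong:
  assumes "\<And>j. j < r \<Longrightarrow> A j = B j"
  shows "polysum n r A l = polysum n r B l"
  using assms unfolding polysum_def by (intro Collect_cong ex_cong1 conj_cong) (auto intro!: restrict_ext sum.cong)

lemma cell_height_cong:
  assumes "\<And>i. i < n \<Longrightarrow> x i = y i"
  shows "cell_height n r \<sigma> A w x l = cell_height n r \<sigma> A w y l"
  using assms by (simp add: cell_height_def)

text \<open>A direction matters only through its tuple of faces, and there are finitely many tuples
  of subsets; \<open>W\<close> holds one direction per tuple, chosen independently of
  \<open>l\<close>. Faces depend only on the first \<open>n\<close> coordinates of the direction, so
  distinct representatives differ already there.\<close>

lemma finite_directions:
  fixes r :: nat
  assumes fin: "\<And>j. j < r \<Longrightarrow> finite (A j)"
  obtains W where "finite W" "\<And>w. \<exists>w'\<in>W. \<forall>j<r. face n \<sigma> w (A j) = face n \<sigma> w' (A j)"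
    "\<And>w w'. w \<in> W \<Longrightarrow> w' \<in> W \<Longrightarrow> w \<noteq> w' \<Longrightarrow> \<exists>i<n. w i \<noteq> w' i"
proof -
  define T where "T w = (\<lambda>j\<in>{..<r}. face n \<sigma> w (A j))" for w
  have "range T \<subseteq> PiE {..<r} (\<lambda>j. Pow (A j))" by (auto simp: T_def dest: subsetD[OF face_subset])
  then have finr: "finite (range T)" by (rule finite_subset) (use fin in \<open>auto intro!: finite_PiE\<close>)
  obtain W where W: "inj_on T W" "range T = T ` W" using subset_image_inj[of "range T" T UNIV] by auto
  show ?thesis
  proof
    show "finite W" using finr W by (auto dest: finite_imageD)
    fix w
    have "T w \<in> T ` W" using W(2) by auto
    then obtain w' where w': "w' \<in> W" "T w = T w'" by auto
    have "face n \<sigma> w (A j) = face n \<sigma> w' (A j)" if "j < r" for j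
      using fun_cong[OF w'(2), of j] that by (simp add: T_def)
    then show "\<exists>w'\<in>W. \<forall>j<r. face n \<sigma> w (A j) = face n \<sigma> w' (A j)" using w' by blast
  next
    fix w w' assume w: "w \<in> W" "w' \<in> W" "w \<noteq> w'"
    show "\<exists>i<n. w i \<noteq> w' i"
    proof (rule ccontr)
      assume "\<not> (\<exists>i<n. w i \<noteq> w' i)"
      then have "T w = T w'" unfolding T_def using face_cong[of n w w'] by (intro restrict_ext) auto
      with W(1) w show False by (auto dest: inj_onD)
    qed
  qed
qed

text \<open>\<open>cell_lift\<close> for one direction produces a point of the body, whose height
  weak duality bounds by that of the other direction; the roles can be exchanged.\<close>

lemma cell_height_eq:
  assumes fin: "\<And>j. j < r \<Longrightarrow> finite (A j)" and l: "\<And>j. j < r \<Longrightarrow> 0 \<le> l j"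
    and x: "x \<in> cell n r \<sigma> A l w" "x \<in> cell n r \<sigma> A l w'"
  shows "cell_height n r \<sigma> A w x l = cell_height n r \<sigma> A w' x l"
proof -
  have le: "cell_height n r \<sigma> A w x l \<le> cell_height n r \<sigma> A w' x l" if x: "x \<in> cell n r \<sigma> A l w" for w w'
  proof -
    obtain y where y: "y \<in> polysum (Suc n) r A l" "\<forall>i<n. y i = x i" "\<sigma> * y n = cell_height n r \<sigma> A w x l"
      using cell_lift[OF fin x] by auto
    with cell_height_upper[OF fin y(1) l, where \<sigma>=\<sigma> and w=w'] cell_height_cong[of n y x]
    show ?thesis by simp
  qed
  from le[OF x(1)] le[OF x(2)] show ?thesis by (rule antisym)
qed

text \<open>On an overlap the two affine heights agree, which confines \<open>x\<close> to a
  hyperplane with normal vector \<open>w - w'\<close>.\<close>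

lemma AE_cells_disjoint:
  assumes fin: "\<And>j. j < r \<Longrightarrow> finite (A j)" and l: "\<And>j. j < r \<Longrightarrow> 0 \<le> l j"
    and W: "finite W" "\<And>w w'. w \<in> W \<Longrightarrow> w' \<in> W \<Longrightarrow> w \<noteq> w' \<Longrightarrow> \<exists>i<n. w i \<noteq> w' i"
  shows "AE x in Leb n. \<forall>w\<in>W. \<forall>w'\<in>W. x \<in> cell n r \<sigma> A l w \<longrightarrow> x \<in> cell n r \<sigma> A l w' \<longrightarrow> w = w'"
proof (intro AE_finite_allI W(1))
  fix w w' assume w: "w \<in> W" "w' \<in> W"
  show "AE x in Leb n. x \<in> cell n r \<sigma> A l w \<longrightarrow> x \<in> cell n r \<sigma> A l w' \<longrightarrow> w = w'"
  proof (cases "w = w'")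
    case False
    then obtain k where k: "k < n" "w k - w' k \<noteq> 0" using W(2)[OF w] by auto
    let ?b = "(\<Sum>j<r. l j * face_val n \<sigma> w (A j)) - (\<Sum>j<r. l j * face_val n \<sigma> w' (A j))"
    show ?thesis
    proof (rule AE_I'[OF hyperplane_null[of k n "\<lambda>i. w i - w' i" ?b, OF k]])
      show "{x \<in> space (Leb n). \<not> (x \<in> cell n r \<sigma> A l w \<longrightarrow> x \<in> cell n r \<sigma> A l w' \<longrightarrow> w = w')}
        \<subseteq> {x \<in> rn n. (\<Sum>i<n. (w i - w' i) * x i) = ?b}"
      proof safe
        fix x assume "x \<in> space (Leb n)" and x: "x \<in> cell n r \<sigma> A l w" "x \<in> cell n r \<sigma> A l w'"
        then show "x \<in> rn n" by (simp add: space_Leb)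
        show "(\<Sum>i<n. (w i - w' i) * x i) = ?b"
          using cell_height_eq[OF fin l x]
          by (simp add: cell_height_def left_diff_distrib sum_subtractf)
      qed
    qed
  qed simp
qed

lemma polysum_project:
  assumes "y \<in> polysum (Suc n) r A l"
  shows "restrict y {..<n} \<in> polysum n r A l"
proof -
  from assms obtain c where "\<And>j a. j < r \<Longrightarrow> a \<in> A j \<Longrightarrow> 0 \<le> c j a" "\<And>j. j < r \<Longrightarrow> sum (c j) (A j) = 1"
    "\<And>i. i < Suc n \<Longrightarrow> y i = (\<Sum>j<r. l j * (\<Sum>a\<in>A j. c j a * a i))" by (rule polysumE) blast
  then show ?thesis by (intro polysumI[where c=c] restrict_in_rn) auto
qed

lemma polysum_lift:
  assumes "x \<in> polysum n r A l"
  shows "\<exists>y\<in>polysum (Suc n) r A l. \<forall>i<n. y i = x i"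
proof -
  from assms obtain c where c: "\<And>j a. j < r \<Longrightarrow> a \<in> A j \<Longrightarrow> 0 \<le> c j a" "\<And>j. j < r \<Longrightarrow> sum (c j) (A j) = 1"
    "\<And>i. i < n \<Longrightarrow> x i = (\<Sum>j<r. l j * (\<Sum>a\<in>A j. c j a * a i))" by (rule polysumE) blast
  then show ?thesis
    by (intro bexI[of _ "\<lambda>i\<in>{..<Suc n}. \<Sum>j<r. l j * (\<Sum>a\<in>A j. c j a * a i)"] polysumI[where c=c] restrict_in_rn) auto
qed

lemma restrict_rn: "x \<in> rn n \<Longrightarrow> (\<And>i. i < n \<Longrightarrow> y i = x i) \<Longrightarrow> restrict y {..<n} = x"
  by (auto simp: rn_def PiE_def extensional_def fun_eq_iff)

text \<open>Compactness of the fiber yields an extreme point \<open>y\<close>, and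
  \<open>upper_point_in_cell\<close> supplies the direction. Lifting \<open>x\<close> from its cell
  and weak duality pin the height of \<open>y\<close> from both sides.\<close>

lemma fiber_extreme:
  assumes fin: "\<And>j. j < r \<Longrightarrow> finite (A j) \<and> A j \<noteq> {}" and l: "\<And>j. j < r \<Longrightarrow> 0 \<le> l j"
    and x: "x \<in> polysum n r A l"
  shows "\<exists>y w. y \<in> polysum (Suc n) r A l \<and> (\<forall>i<n. y i = x i) \<and> x \<in> cell n r \<sigma> A l w \<and>
    \<sigma> * y n = cell_height n r \<sigma> A w x l \<and>
    (\<forall>z\<in>polysum (Suc n) r A l. (\<forall>i<n. z i = x i) \<longrightarrow> \<sigma> * z n \<le> \<sigma> * y n)"
proof -
  let ?T = "polysum (Suc n) r A l \<inter> {y. \<forall>i\<in>{..<n}. y i = x i}"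
  have "{y. \<forall>i\<in>{..<n}. y i = x i} = (\<Inter>i\<in>{..<n}. {y. y i = x i})" by auto
  then have "closed {y. \<forall>i\<in>{..<n}. y i = x i}"
    by (auto intro!: closed_Collect_eq continuous_on_const continuous_on_product_coordinates)
  then have "compact ?T" using fin by (intro compact_Int_closed compact_polysum) auto
  moreover have "?T \<noteq> {}" using polysum_lift[OF x] by auto
  moreover have "continuous_on ?T (\<lambda>y. \<sigma> * y n)"
    by (intro continuous_intros continuous_on_subset[OF continuous_on_product_coordinates]) auto
  ultimately obtain y where y: "y \<in> ?T" "\<forall>z\<in>?T. \<sigma> * z n \<le> \<sigma> * y n"
    using continuous_attains_sup[of ?T "\<lambda>y. \<sigma> * y n"] by blast
  have yx: "\<And>i. i < n \<Longrightarrow> y i = x i" using y by auto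
  have "restrict y {..<n} = x" using subsetD[OF polysum_subset_rn x] yx by (rule restrict_rn)
  moreover have "\<exists>w. restrict y {..<n} \<in> cell n r \<sigma> A l w"
    by (rule upper_point_in_cell[OF fin l]) (use y in auto)
  ultimately obtain w where w: "x \<in> cell n r \<sigma> A l w" by auto
  obtain z where z: "z \<in> polysum (Suc n) r A l" "\<forall>i<n. z i = x i" "\<sigma> * z n = cell_height n r \<sigma> A w x l"
    using cell_lift[OF _ w] fin by blast
  have "\<sigma> * y n \<le> cell_height n r \<sigma> A w y l"
    by (rule cell_height_upper) (use y fin l in auto)
  also have "\<dots> = cell_height n r \<sigma> A w x l" using yx by (rule cell_height_cong)
  finally have "\<sigma> * y n = cell_height n r \<sigma> A w x l" using z y(2) by force
  then show ?thesis using w y by (intro exI[of _ y] exI[of _ w]) auto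
qed

lemma fiber_interval:
  assumes x: "x \<in> rn n" and y: "y \<in> polysum (Suc n) r A l" "\<And>i. i < n \<Longrightarrow> y i = x i"
    and z: "z \<in> polysum (Suc n) r A l" "\<And>i. i < n \<Longrightarrow> z i = x i"
    and s: "z n \<le> s" "s \<le> y n"
  shows "x(n := s) \<in> polysum (Suc n) r A l"
proof -
  \<comment> \<open>In a degenerate fiber \<open>s\<close> equals both endpoints, and the parameter
    0 represents it.\<close>
  define t where "t = (if y n = z n then 0 else (s - z n) / (y n - z n))"
  have t: "0 \<le> t" "t \<le> 1" "(1 - t) * z n + t * y n = s"
    using s by (auto simp: t_def field_simps)
  have "(\<lambda>i\<in>{..<Suc n}. (1 - t) * z i + t * y i) \<in> polysum (Suc n) r A l"
    using y z t by (intro polysum_convex) auto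
  moreover have "(\<lambda>i\<in>{..<Suc n}. (1 - t) * z i + t * y i) = x(n := s)"
  proof
    fix i
    show "(\<lambda>i\<in>{..<Suc n}. (1 - t) * z i + t * y i) i = (x(n := s)) i"
      using t y(2)[of i] z(2)[of i] x
      by (cases "i < n"; cases "i = n") (auto simp: algebra_simps rn_def PiE_def extensional_def)
  qed
  ultimately show ?thesis by simp
qed

lemma cell_subset:
  assumes fin: "\<And>j. j < r \<Longrightarrow> finite (A j)" and x: "x \<in> cell n r \<sigma> A l w"
  shows "x \<in> polysum n r A l"
proof -
  obtain y where y: "y \<in> polysum (Suc n) r A l" "\<forall>i<n. y i = x i" using cell_lift[OF fin x] by auto
  have "restrict y {..<n} = x" using subsetD[OF polysum_subset_rn x] y by (intro restrict_rn) auto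
  with polysum_project[OF y(1)] show ?thesis by simp
qed

text \<open>The direction \<open>w\<close> may lie outside \<open>W\<close>. Its representative has
  the same faces, hence the same cell, and by \<open>cell_height_eq\<close> the same height at
  \<open>x\<close>; disjointness removes all other terms.\<close>

lemma sum_over_cells:
  assumes fin: "\<And>j. j < r \<Longrightarrow> finite (A j)" and l: "\<And>j. j < r \<Longrightarrow> 0 \<le> l j"
    and W: "finite W" "\<And>w. \<exists>w'\<in>W. \<forall>j<r. face n \<sigma> w (A j) = face n \<sigma> w' (A j)"
    and disj: "\<forall>w\<in>W. \<forall>w'\<in>W. x \<in> cell n r \<sigma> A l w \<longrightarrow> x \<in> cell n r \<sigma> A l w' \<longrightarrow> w = w'"
    and w: "x \<in> cell n r \<sigma> A l w"
  shows "(\<Sum>w\<in>W. indicator (cell n r \<sigma> A l w) x * G (cell_height n r \<sigma> A w x l)) = (G (cell_height n r \<sigma> A w x l) :: real)"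
proof -
  obtain w' where w': "w' \<in> W" "\<forall>j<r. face n \<sigma> w (A j) = face n \<sigma> w' (A j)" using W(2) by blast
  have xw': "x \<in> cell n r \<sigma> A l w'"
    using w polysum_cong[of r "\<lambda>j. face n \<sigma> w (A j)" "\<lambda>j. face n \<sigma> w' (A j)"] w' by auto
  have "(\<Sum>w\<in>W. indicator (cell n r \<sigma> A l w) x * G (cell_height n r \<sigma> A w x l)) =
    (\<Sum>w\<in>{w'}. indicator (cell n r \<sigma> A l w) x * G (cell_height n r \<sigma> A w x l))"
    using w' xw' disj W(1) by (intro sum.mono_neutral_right) (auto simp: indicator_def)
  also have "\<dots> = G (cell_height n r \<sigma> A w x l)"
    using xw' cell_height_eq[OF fin l w xw'] by simp
  finally show ?thesis .
qed

lemma hpoly_Suc: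
  assumes "hpoly n r d q"
  shows "hpoly (Suc n) r d q"
  using assms by induction (auto intro: hpoly.intros)

text \<open>Over a point of the projection the fiber is the interval between the extreme points for
  \<sigma> = -1 and \<sigma> = 1, so integrating \<open>s ^ e\<close> gives a difference of powers
  of its endpoints. The sums over directions only rewrite these endpoints; the lower one is the
  negative of a height because \<open>cell_height\<close> measures \<sigma> times the last
  coordinate.\<close>

lemma fiber_integral:
  assumes fin: "\<And>j. j < r \<Longrightarrow> finite (A j) \<and> A j \<noteq> {}" and l: "\<And>j. j < r \<Longrightarrow> 0 \<le> l j"
    and q: "hpoly n r d q" and x: "x \<in> rn n"
    and W: "finite W" "\<And>w. \<exists>w'\<in>W. \<forall>j<r. face n 1 w (A j) = face n 1 w' (A j)"
      "\<forall>w\<in>W. \<forall>w'\<in>W. x \<in> cell n r 1 A l w \<longrightarrow> x \<in> cell n r 1 A l w' \<longrightarrow> w = w'"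
    and W': "finite W'" "\<And>w. \<exists>w'\<in>W'. \<forall>j<r. face n (-1) w (A j) = face n (-1) w' (A j)"
      "\<forall>w\<in>W'. \<forall>w'\<in>W'. x \<in> cell n r (-1) A l w \<longrightarrow> x \<in> cell n r (-1) A l w' \<longrightarrow> w = w'"
  shows "(\<integral>s. indicator (polysum (Suc n) r A l) (x(n := s)) * ((x(n := s)) n ^ e * q (x(n := s)) l) \<partial>lborel) =
    (\<Sum>w\<in>W. indicator (cell n r 1 A l w) x * (q x l * cell_height n r 1 A w x l ^ Suc e / Suc e)) -
    (\<Sum>w\<in>W'. indicator (cell n r (-1) A l w) x * (q x l * (- cell_height n r (-1) A w x l) ^ Suc e / Suc e))"
proof (cases "x \<in> polysum n r A l")
  case False
  have "x(n := s) \<notin> polysum (Suc n) r A l" for s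
  proof
    assume "x(n := s) \<in> polysum (Suc n) r A l"
    from polysum_project[OF this] restrict_rn[OF x, of "x(n := s)"] False show False by simp
  qed
  moreover have "x \<notin> cell n r \<sigma> A l w" for w \<sigma> using cell_subset[of r A x n \<sigma> w l] fin False by auto
  ultimately show ?thesis by simp
next
  case True
  have "\<exists>y w. y \<in> polysum (Suc n) r A l \<and> (\<forall>i<n. y i = x i) \<and> x \<in> cell n r 1 A l w \<and>
      1 * y n = cell_height n r 1 A w x l \<and>
      (\<forall>z\<in>polysum (Suc n) r A l. (\<forall>i<n. z i = x i) \<longrightarrow> 1 * z n \<le> 1 * y n)"
    by (rule fiber_extreme) (use fin l True in auto)
  then obtain y w where y0: "y \<in> polysum (Suc n) r A l \<and> (\<forall>i<n. y i = x i) \<and> x \<in> cell n r 1 A l w \<and>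
      1 * y n = cell_height n r 1 A w x l \<and>
      (\<forall>z\<in>polysum (Suc n) r A l. (\<forall>i<n. z i = x i) \<longrightarrow> 1 * z n \<le> 1 * y n)"
    by (elim exE)
  have y: "y \<in> polysum (Suc n) r A l" "\<forall>i<n. y i = x i" "x \<in> cell n r 1 A l w"
      "y n = cell_height n r 1 A w x l"
      "\<forall>z\<in>polysum (Suc n) r A l. (\<forall>i<n. z i = x i) \<longrightarrow> z n \<le> y n"
    using y0 by auto
  have "\<exists>z w'. z \<in> polysum (Suc n) r A l \<and> (\<forall>i<n. z i = x i) \<and> x \<in> cell n r (-1) A l w' \<and>
      -1 * z n = cell_height n r (-1) A w' x l \<and>
      (\<forall>y\<in>polysum (Suc n) r A l. (\<forall>i<n. y i = x i) \<longrightarrow> -1 * y n \<le> -1 * z n)"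
    by (rule fiber_extreme) (use fin l True in auto)
  then obtain z w' where z0: "z \<in> polysum (Suc n) r A l \<and> (\<forall>i<n. z i = x i) \<and> x \<in> cell n r (-1) A l w' \<and>
      -1 * z n = cell_height n r (-1) A w' x l \<and>
      (\<forall>y\<in>polysum (Suc n) r A l. (\<forall>i<n. y i = x i) \<longrightarrow> -1 * y n \<le> -1 * z n)"
    by (elim exE)
  have z: "z \<in> polysum (Suc n) r A l" "\<forall>i<n. z i = x i" "x \<in> cell n r (-1) A l w'"
      "z n = - cell_height n r (-1) A w' x l"
      "\<forall>y\<in>polysum (Suc n) r A l. (\<forall>i<n. y i = x i) \<longrightarrow> z n \<le> y n"
    using z0 by auto
  have "x(n := s) \<in> polysum (Suc n) r A l \<longleftrightarrow> s \<in> {z n..y n}" for s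
  proof
    assume "x(n := s) \<in> polysum (Suc n) r A l"
    with y(5) z(5) show "s \<in> {z n..y n}" by force
  next
    assume "s \<in> {z n..y n}"
    with y z x show "x(n := s) \<in> polysum (Suc n) r A l" by (intro fiber_interval[of x n y r A l z]) auto
  qed
  then have ind: "indicator (polysum (Suc n) r A l) (x(n := s)) = (indicator {z n..y n} s :: real)" for s
    by (simp add: indicator_def)
  have "q (x(n := s)) l = q x l" for s by (rule hpoly_cong_x[OF q]) auto
  then have "(\<integral>s. indicator (polysum (Suc n) r A l) (x(n := s)) * ((x(n := s)) n ^ e * q (x(n := s)) l) \<partial>lborel)
    = (\<integral>s. q x l * (s ^ e * indicator {z n..y n} s) \<partial>lborel)"
    by (intro Bochner_Integration.integral_cong refl) (simp add: ind)
  also have "\<dots> = q x l * (y n ^ Suc e - z n ^ Suc e) / Suc e"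
    using y(5) z(1,2) by (subst integral_mult_right_zero, subst integral_power) auto
  also have "\<dots> = q x l * y n ^ Suc e / Suc e - q x l * z n ^ Suc e / Suc e"
    by (simp add: right_diff_distrib diff_divide_distrib)
  also have "q x l * y n ^ Suc e / Suc e =
    (\<Sum>w\<in>W. indicator (cell n r 1 A l w) x * (q x l * cell_height n r 1 A w x l ^ Suc e / Suc e))"
    unfolding y(4)
    by (rule sum_over_cells[symmetric, where G="\<lambda>h. q x l * h ^ Suc e / Suc e"]) (use fin l W y(3) in auto)
  also have "q x l * z n ^ Suc e / Suc e =
    (\<Sum>w\<in>W'. indicator (cell n r (-1) A l w) x * (q x l * (- cell_height n r (-1) A w x l) ^ Suc e / Suc e))"
    unfolding z(4)
    by (rule sum_over_cells[symmetric, where G="\<lambda>h. q x l * (- h) ^ Suc e / Suc e"]) (use fin l W' z(3) in auto)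
  finally show ?thesis .
qed

lemma hpoly_cell_height: "hpoly n r 1 (cell_height n r \<sigma> A w)"
  unfolding cell_height_def by (rule hpoly_affine)

text \<open>By Fubini, one integrates first over the last coordinate; the upper and the lower boundary are piecewise
  affine, with pieces \<open>cell n r \<sigma> A l w\<close> that are again Minkowski combinations of polytopes.\<close>

lemma integral_polysum_step:
  assumes fin: "\<And>j. j < r \<Longrightarrow> finite (A j) \<and> A j \<noteq> {}" and q: "hpoly n r d q"
    and IH: "\<And>d q A. hpoly n r d q \<Longrightarrow> (\<And>j. j < r \<Longrightarrow> finite (A j) \<and> A j \<noteq> {}) \<Longrightarrow>
      \<exists>p. hpoly 0 r (d + n) p \<and> (\<forall>x l. (\<forall>j<r. 0 \<le> l j) \<longrightarrow> (\<integral>x. indicator (polysum n r A l) x * q x l \<partial>Leb n) = p x l)"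
  shows "\<exists>p. hpoly 0 r (d + e + Suc n) p \<and> (\<forall>x l. (\<forall>j<r. 0 \<le> l j) \<longrightarrow>
    (\<integral>x. indicator (polysum (Suc n) r A l) x * (x n ^ e * q x l) \<partial>Leb (Suc n)) = p x l)"
proof -
  obtain W where W: "finite W" "\<And>w. \<exists>w'\<in>W. \<forall>j<r. face n 1 w (A j) = face n 1 w' (A j)"
    "\<And>w w'. w \<in> W \<Longrightarrow> w' \<in> W \<Longrightarrow> w \<noteq> w' \<Longrightarrow> \<exists>i<n. w i \<noteq> w' i"
    using finite_directions[of r A n 1] fin by blast
  obtain W' where W': "finite W'" "\<And>w. \<exists>w'\<in>W'. \<forall>j<r. face n (-1) w (A j) = face n (-1) w' (A j)"
    "\<And>w w'. w \<in> W' \<Longrightarrow> w' \<in> W' \<Longrightarrow> w \<noteq> w' \<Longrightarrow> \<exists>i<n. w i \<noteq> w' i"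
    using finite_directions[of r A n "-1"] fin by blast
  \<comment> \<open>The primitive \<open>s ^ Suc e / Suc e\<close> at the upper boundary, and in
    \<open>Q'\<close> at the lower one, times the factor that is constant along the fiber.\<close>
  define Q where "Q w x l = q x l * cell_height n r 1 A w x l ^ Suc e / Suc e" for w x l
  define Q' where "Q' w x l = q x l * (- cell_height n r (-1) A w x l) ^ Suc e / Suc e" for w x l
  have Q: "hpoly n r (d + Suc e) (Q w)" for w
    using hpoly_scale[OF hpoly_mult[OF q hpoly_power[OF hpoly_cell_height[of n r 1 A w], of "Suc e"]], of "1 / Suc e"]
    by (simp add: Q_def[abs_def])
  have neg: "hpoly n r 1 (\<lambda>x l. - cell_height n r (-1) A w x l)" for w
    using hpoly_scale[OF hpoly_cell_height[of n r "-1" A w], of "-1"] by simp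
  have Q': "hpoly n r (d + Suc e) (Q' w)" for w
    using hpoly_scale[OF hpoly_mult[OF q hpoly_power[OF neg[of w], of "Suc e"]], of "1 / Suc e"]
    by (simp add: Q'_def[abs_def] del: power_Suc)
  have ne: "finite (face n \<sigma> w (A j)) \<and> face n \<sigma> w (A j) \<noteq> {}" if "j < r" for \<sigma> w j
    using fin[OF that] face_nonempty finite_subset[OF face_subset] by blast
  \<comment> \<open>The point sets \<open>face n 1 w (A j)\<close> are the same for all
    \<open>l\<close>, so a single polynomial \<open>P w\<close> serves every \<open>l\<close> at
    once.\<close>
  have "\<forall>w. \<exists>p. hpoly 0 r (d + Suc e + n) p \<and>
    (\<forall>x l. (\<forall>j<r. 0 \<le> l j) \<longrightarrow> (\<integral>x. indicator (cell n r 1 A l w) x * Q w x l \<partial>Leb n) = p x l)"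
    by (intro allI IH[OF Q] ne)
  from choice[OF this] obtain P where P0: "\<forall>w. hpoly 0 r (d + Suc e + n) (P w) \<and>
    (\<forall>x l. (\<forall>j<r. 0 \<le> l j) \<longrightarrow> (\<integral>x. indicator (cell n r 1 A l w) x * Q w x l \<partial>Leb n) = P w x l)" ..
  have P: "\<And>w. hpoly 0 r (d + Suc e + n) (P w)"
    "\<And>w x l. (\<forall>j<r. 0 \<le> l j) \<Longrightarrow> (\<integral>x. indicator (cell n r 1 A l w) x * Q w x l \<partial>Leb n) = P w x l"
    using P0 by blast+
  have "\<forall>w. \<exists>p. hpoly 0 r (d + Suc e + n) p \<and>
    (\<forall>x l. (\<forall>j<r. 0 \<le> l j) \<longrightarrow> (\<integral>x. indicator (cell n r (-1) A l w) x * Q' w x l \<partial>Leb n) = p x l)"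
    by (intro allI IH[OF Q'] ne)
  from choice[OF this] obtain P' where P'0: "\<forall>w. hpoly 0 r (d + Suc e + n) (P' w) \<and>
    (\<forall>x l. (\<forall>j<r. 0 \<le> l j) \<longrightarrow> (\<integral>x. indicator (cell n r (-1) A l w) x * Q' w x l \<partial>Leb n) = P' w x l)" ..
  have P': "\<And>w. hpoly 0 r (d + Suc e + n) (P' w)"
    "\<And>w x l. (\<forall>j<r. 0 \<le> l j) \<Longrightarrow> (\<integral>x. indicator (cell n r (-1) A l w) x * Q' w x l \<partial>Leb n) = P' w x l"
    using P'0 by blast+
  show ?thesis
  proof (intro exI[of _ "\<lambda>x l. (\<Sum>w\<in>W. P w x l) - (\<Sum>w\<in>W'. P' w x l)"] conjI allI impI)
    show "hpoly 0 r (d + e + Suc n) (\<lambda>x l. (\<Sum>w\<in>W. P w x l) - (\<Sum>w\<in>W'. P' w x l))"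
      using P(1) P'(1) W(1) W'(1) by (intro hpoly_diff hpoly_sum) auto
  next
    fix x0 :: "nat \<Rightarrow> real" and l :: "nat \<Rightarrow> real"
    assume l: "\<forall>j<r. 0 \<le> l j"
    let ?f = "\<lambda>x. indicator (polysum (Suc n) r A l) x * (x n ^ e * q x l) :: real"
    let ?g = "\<lambda>x. (\<Sum>w\<in>W. indicator (cell n r 1 A l w) x * Q w x l) -
      (\<Sum>w\<in>W'. indicator (cell n r (-1) A l w) x * Q' w x l)"
    have "hpoly (Suc n) r (e + d) (\<lambda>x l. x n ^ e * q x l)"
      using hpoly.xvar[OF hpoly.const[of "Suc n" r 1], of n]
      by (intro hpoly_mult hpoly_power hpoly_Suc[OF q]) simp
    then have intf: "integrable (Leb (Suc n)) ?f"
      using fin by (intro hpoly_integrable compact_polysum polysum_subset_rn) auto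
    then have intf': "integrable (PiM (insert n {..<n}) (\<lambda>_. lborel)) ?f" by (simp add: lessThan_Suc)
    have int: "integrable (Leb n) (\<lambda>x. indicator (cell n r 1 A l w) x * Q w x l)"
      "integrable (Leb n) (\<lambda>x. indicator (cell n r (-1) A l w) x * Q' w x l)" for w
      using ne by (intro hpoly_integrable[OF _ _ Q] hpoly_integrable[OF _ _ Q'] compact_polysum polysum_subset_rn; auto)+
    have "(\<integral>x. ?f x \<partial>Leb (Suc n)) = (\<integral>x. (\<integral>s. ?f (x(n := s)) \<partial>lborel) \<partial>Leb n)"
      unfolding lessThan_Suc by (rule Leb.product_integral_insert) (use intf' in auto)
    also have "\<dots> = (\<integral>x. ?g x \<partial>Leb n)"
    proof (rule integral_cong_AE)
      have "(\<lambda>(x, s). ?f (x(n := s))) \<in> borel_measurable (Leb n \<Otimes>\<^sub>M lborel)"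
        using measurable_compose[OF measurable_add_dim borel_measurable_integrable[OF intf']]
        by (simp add: case_prod_unfold)
      then show "(\<lambda>x. \<integral>s. ?f (x(n := s)) \<partial>lborel) \<in> borel_measurable (Leb n)"
        by (rule lborel.borel_measurable_lebesgue_integral)
      show "?g \<in> borel_measurable (Leb n)"
        using int by (intro borel_measurable_diff borel_measurable_sum borel_measurable_integrable)
      have "AE x in Leb n. \<forall>w\<in>W. \<forall>w'\<in>W. x \<in> cell n r 1 A l w \<longrightarrow> x \<in> cell n r 1 A l w' \<longrightarrow> w = w'"
        by (rule AE_cells_disjoint) (use fin l W in auto)
      moreover have "AE x in Leb n. \<forall>w\<in>W'. \<forall>w'\<in>W'. x \<in> cell n r (-1) A l w \<longrightarrow> x \<in> cell n r (-1) A l w' \<longrightarrow> w = w'"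
        by (rule AE_cells_disjoint) (use fin l W' in auto)
      moreover have "AE x in Leb n. x \<in> rn n" by (rule AE_I2) (simp add: space_Leb)
      ultimately show "AE x in Leb n. (\<integral>s. ?f (x(n := s)) \<partial>lborel) = ?g x"
      proof eventually_elim
        case (elim x)
        show ?case
          unfolding Q_def Q'_def
          by (rule fiber_integral[OF fin _ q elim(3) W(1,2) elim(1) W'(1,2) elim(2)]) (use l in auto)
      qed
    qed
    also have "\<dots> = (\<Sum>w\<in>W. P w x0 l) - (\<Sum>w\<in>W'. P' w x0 l)"
      using int P(2)[OF l] P'(2)[OF l]
      by (subst Bochner_Integration.integral_diff) (auto intro!: Bochner_Integration.integrable_sum simp: Bochner_Integration.integral_sum)
    finally show "(\<integral>x. ?f x \<partial>Leb (Suc n)) = (\<Sum>w\<in>W. P w x0 l) - (\<Sum>w\<in>W'. P' w x0 l)" .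
  qed
qed

lemma polysum_nonempty:
  assumes fin: "\<And>j. j < r \<Longrightarrow> finite (A j) \<and> A j \<noteq> {}"
  shows "polysum n r A l \<noteq> {}"
proof -
  have "(\<lambda>i\<in>{..<n}. \<Sum>j<r. l j * (\<Sum>a\<in>A j. 1 / card (A j) * a i)) \<in> polysum n r A l"
    by (rule polysumI[where c="\<lambda>j a. 1 / card (A j)"]) (use fin in \<open>auto intro: restrict_in_rn\<close>)
  then show ?thesis by auto
qed

text \<open>Both \<open>q\<close> and \<open>A\<close> have to vary in the induction, since a step
  replaces \<open>A\<close> by tuples of faces and multiplies by powers of heights. Each integration
  raises the degree by one and consumes one coordinate; in \<open>hpoly 0 r\<close> only the
  variables \<open>l\<close> are left.\<close>

lemma integral_polysum_hpoly:
  assumes "hpoly n r d q" "\<And>j. j < r \<Longrightarrow> finite (A j) \<and> A j \<noteq> {}"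
  shows "\<exists>p. hpoly 0 r (d + n) p \<and>
    (\<forall>x l. (\<forall>j<r. 0 \<le> l j) \<longrightarrow> (\<integral>x. indicator (polysum n r A l) x * q x l \<partial>Leb n) = p x l)"
  using assms
proof (induction n arbitrary: d q A)
  case 0
  \<comment> \<open>\<open>Leb 0\<close> is the unit mass at the only point of
    \<open>rn 0\<close>.\<close>
  have "polysum 0 r A l = {\<lambda>_. undefined}" for l
    using polysum_nonempty[of r A 0 l] 0(2) polysum_subset_rn[of 0 r A l] by (auto simp: rn_def)
  then have "(\<integral>x. indicator (polysum 0 r A l) x * q x l \<partial>Leb 0) = q x l" for x l
    using hpoly_cong_x[OF 0(1), of "\<lambda>_. undefined" x l]
    by (simp add: PiM_empty lebesgue_integral_count_space_finite)
  note eq = this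
  show ?case
  proof (intro exI[of _ q] conjI allI impI)
    show "hpoly 0 r (d + 0) q" using 0(1) by simp
  qed (rule eq)
next
  case (Suc n)
  obtain qs where qs: "\<And>e. e \<le> d \<Longrightarrow> hpoly n r (d - e) (qs e)"
    and q: "\<And>x l. q x l = (\<Sum>e\<le>d. x n ^ e * qs e x l)"
    using hpoly_expand_last[OF Suc.prems(1)] by blast
  have "\<forall>e. \<exists>p. e \<le> d \<longrightarrow> hpoly 0 r (d - e + e + Suc n) p \<and> (\<forall>x l. (\<forall>j<r. 0 \<le> l j) \<longrightarrow>
    (\<integral>x. indicator (polysum (Suc n) r A l) x * (x n ^ e * qs e x l) \<partial>Leb (Suc n)) = p x l)"
  proof (rule allI)
    fix e
    show "\<exists>p. e \<le> d \<longrightarrow> hpoly 0 r (d - e + e + Suc n) p \<and> (\<forall>x l. (\<forall>j<r. 0 \<le> l j) \<longrightarrow>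
      (\<integral>x. indicator (polysum (Suc n) r A l) x * (x n ^ e * qs e x l) \<partial>Leb (Suc n)) = p x l)"
    proof (cases "e \<le> d")
      case True
      have "\<exists>p. hpoly 0 r (d - e + e + Suc n) p \<and> (\<forall>x l. (\<forall>j<r. 0 \<le> l j) \<longrightarrow>
        (\<integral>x. indicator (polysum (Suc n) r A l) x * (x n ^ e * qs e x l) \<partial>Leb (Suc n)) = p x l)"
        by (rule integral_polysum_step[OF Suc.prems(2) qs[OF True] Suc.IH])
      then show ?thesis by (simp only: True simp_thms)
    qed simp
  qed
  from choice[OF this] obtain P where P0: "\<forall>e. e \<le> d \<longrightarrow> hpoly 0 r (d - e + e + Suc n) (P e) \<and>
    (\<forall>x l. (\<forall>j<r. 0 \<le> l j) \<longrightarrow>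
      (\<integral>x. indicator (polysum (Suc n) r A l) x * (x n ^ e * qs e x l) \<partial>Leb (Suc n)) = P e x l)" ..
  have P: "hpoly 0 r (d + Suc n) (P e)"
    "(\<forall>j<r. 0 \<le> l j) \<Longrightarrow>
      (\<integral>x. indicator (polysum (Suc n) r A l) x * (x n ^ e * qs e x l) \<partial>Leb (Suc n)) = P e x l" if "e \<le> d" for e x l
    using P0[rule_format, OF that] that by simp_all
  have int: "integrable (Leb (Suc n)) (\<lambda>x. indicator (polysum (Suc n) r A l) x * (x n ^ e * qs e x l))" if "e \<le> d" for e l
  proof (rule hpoly_integrable)
    show "hpoly (Suc n) r (e + (d - e)) (\<lambda>x l. x n ^ e * qs e x l)"
      using hpoly.xvar[OF hpoly.const[of "Suc n" r 1], of n]
      by (intro hpoly_mult hpoly_power hpoly_Suc[OF qs] that) simp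
  qed (use Suc.prems in \<open>auto intro!: compact_polysum polysum_subset_rn\<close>)
  show ?case
  proof (intro exI[of _ "\<lambda>x l. \<Sum>e\<le>d. P e x l"] conjI allI impI)
    show "hpoly 0 r (d + Suc n) (\<lambda>x l. \<Sum>e\<le>d. P e x l)" by (intro hpoly_sum P(1)) auto
    fix x0 :: "nat \<Rightarrow> real" and l :: "nat \<Rightarrow> real"
    assume l: "\<forall>j<r. 0 \<le> l j"
    have "(\<integral>x. indicator (polysum (Suc n) r A l) x * q x l \<partial>Leb (Suc n)) =
      (\<integral>x. (\<Sum>e\<le>d. indicator (polysum (Suc n) r A l) x * (x n ^ e * qs e x l)) \<partial>Leb (Suc n))"
      by (simp add: q sum_distrib_left)
    also have "\<dots> = (\<Sum>e\<le>d. P e x0 l)"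
      using int P(2)[OF _ l] by (subst Bochner_Integration.integral_sum) auto
    finally show "(\<integral>x. indicator (polysum (Suc n) r A l) x * q x l \<partial>Leb (Suc n)) = (\<Sum>e\<le>d. P e x0 l)" .
  qed
qed

section \<open>Polarization\<close>

text \<open>Expand the product over \<open>V\<close> of 1 minus the indicator of lying outside
  \<open>U\<close>. A factor vanishes for every element of \<open>V - U\<close>, so the product is 1
  exactly for \<open>U = V\<close>.\<close>

lemma alternating_sum_supersets:
  assumes "finite V" "U \<subseteq> V"
  shows "(\<Sum>S\<in>Pow V. (-1) ^ (card V - card S) * (if U \<subseteq> S then 1 else 0)) = (if U = V then 1 else 0 :: real)"
proof -
  have fin: "finite S" if "S \<subseteq> V" for S using assms(1) that by (rule finite_subset[rotated])
  have "(\<Sum>S\<in>Pow V. (-1) ^ (card V - card S) * (if U \<subseteq> S then 1 else 0)) =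
    (\<Sum>S\<in>Pow V. (-1) ^ (card V - card S) * (\<Prod>x\<in>S. 1) * (\<Prod>x\<in>V - S. if x \<in> U then 0 else 1 :: real))"
  proof (rule sum.cong[OF refl])
    fix S assume "S \<in> Pow V"
    have "(\<Prod>x\<in>V - S. if x \<in> U then 0 else 1 :: real) = (if U \<subseteq> S then 1 else 0)"
      using assms by (auto intro!: prod.neutral simp: prod_zero_iff)
    then show "(-1) ^ (card V - card S) * (if U \<subseteq> S then 1 else 0) =
      (-1) ^ (card V - card S) * (\<Prod>x\<in>S. 1) * (\<Prod>x\<in>V - S. if x \<in> U then 0 else 1 :: real)" by simp
  qed
  also have "\<dots> = (\<Prod>x\<in>V. 1 - (if x \<in> U then 0 else 1))"
    by (rule prod_diff_conv_sum'[symmetric]) (rule assms(1))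
  also have "\<dots> = (if U = V then 1 else 0)"
    using assms by (auto intro!: prod.neutral simp: prod_zero_iff)
  finally show ?thesis .
qed

abbreviation inj_maps :: "nat \<Rightarrow> (nat \<Rightarrow> nat) set" where
  "inj_maps n \<equiv> {h \<in> {..<n} \<rightarrow>\<^sub>E {..<n}. inj_on h {..<n}}"

lemma card_inj_maps: "card (inj_maps n) = fact n"
  using card_inj_on_subset_funcset[of "{..<n}" "{..<n}" "{..<n}"] by (simp add: fact_prod_rev)

lemma inj_maps_image:
  fixes h :: "nat \<Rightarrow> nat"
  assumes "h \<in> {..<n} \<rightarrow>\<^sub>E {..<n}"
  shows "h ` {..<n} = {..<n} \<longleftrightarrow> inj_on h {..<n}"
proof
  assume "h ` {..<n} = {..<n}"
  then show "inj_on h {..<n}" by (intro eq_card_imp_inj_on) auto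
next
  assume "inj_on h {..<n}"
  then show "h ` {..<n} = {..<n}" using assms by (intro endo_inj_surj) auto
qed

text \<open>The product of counts is the number of maps \<open>h\<close> into \<open>S\<close> with
  \<open>f (h b) = g b\<close> for all \<open>b\<close>. Inclusion-exclusion over \<open>S\<close>
  keeps the maps with image \<open>{..<n}\<close>, which are the permutations.\<close>

lemma alternating_sum_counts:
  fixes f g :: "nat \<Rightarrow> nat"
  shows "(\<Sum>S\<in>Pow {..<n}. (-1) ^ (n - card S) * (\<Prod>b<n. real (card {a\<in>S. f a = g b}))) =
    (\<Sum>h\<in>inj_maps n. \<Prod>b<n. if f (h b) = g b then 1 else 0)"
proof -
  let ?F = "{..<n} \<rightarrow>\<^sub>E {..<n}"
  let ?T = "\<lambda>h. \<Prod>b<n. if f (h b) = g b then 1 else 0 :: real"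
  have finF: "finite ?F" by (intro finite_PiE) auto
  have "(\<Prod>b<n. real (card {a\<in>S. f a = g b})) = (\<Sum>h\<in>?F. (if h ` {..<n} \<subseteq> S then 1 else 0) * ?T h)"
    if S: "S \<in> Pow {..<n}" for S
  proof -
    have finS: "finite S" using S by (auto intro: finite_subset)
    have "(\<Prod>b<n. real (card {a\<in>S. f a = g b})) = (\<Prod>b<n. \<Sum>a\<in>S. if f a = g b then 1 else 0)"
      using finS by (intro prod.cong) (auto simp: sum.If_cases Int_def)
    also have "\<dots> = (\<Sum>h\<in>{..<n} \<rightarrow>\<^sub>E S. ?T h)"
      by (rule prod_sum_PiE) (use finS in auto)
    also have "\<dots> = (\<Sum>h\<in>?F. (if h ` {..<n} \<subseteq> S then 1 else 0) * ?T h)"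
      using S finF by (intro sum.mono_neutral_cong_left) (auto simp: PiE_iff image_subset_iff)
    finally show ?thesis .
  qed
  then have "(\<Sum>S\<in>Pow {..<n}. (-1) ^ (n - card S) * (\<Prod>b<n. real (card {a\<in>S. f a = g b}))) =
    (\<Sum>S\<in>Pow {..<n}. \<Sum>h\<in>?F. ?T h * ((-1) ^ (n - card S) * (if h ` {..<n} \<subseteq> S then 1 else 0)))"
    by (simp add: sum_distrib_left mult_ac)
  also have "\<dots> = (\<Sum>h\<in>?F. ?T h * (\<Sum>S\<in>Pow {..<n}. (-1) ^ (n - card S) * (if h ` {..<n} \<subseteq> S then 1 else 0)))"
    by (subst sum.swap) (simp add: sum_distrib_left)
  also have "\<dots> = (\<Sum>h\<in>?F. ?T h * (if inj_on h {..<n} then 1 else 0))"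
  proof (intro sum.cong refl arg_cong2[where f="(*)"])
    fix h assume h: "h \<in> ?F"
    then have "h ` {..<n} \<subseteq> {..<n}" by auto
    then show "(\<Sum>S\<in>Pow {..<n}. (-1) ^ (n - card S) * (if h ` {..<n} \<subseteq> S then 1 else 0)) =
      (if inj_on h {..<n} then 1 else 0 :: real)"
      using alternating_sum_supersets[of "{..<n}" "h ` {..<n}"] inj_maps_image[OF h] by simp
  qed
  also have "\<dots> = (\<Sum>h\<in>inj_maps n. ?T h)"
    using finF by (intro sum.mono_neutral_cong_right) auto
  finally show ?thesis .
qed

text \<open>For a permutation \<open>h\<close> exactly one \<open>f\<close> satisfies
  \<open>f (h b) = g b\<close> for all \<open>b\<close>, namely \<open>g\<close> composed with the
  inverse of \<open>h\<close>, and it reproduces the monomial. There are \<open>fact n\<close>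
  permutations.\<close>

lemma polarization_monomial:
  fixes g :: "nat \<Rightarrow> nat" and l :: "nat \<Rightarrow> real"
  assumes g: "\<And>b. b < n \<Longrightarrow> g b < r"
  shows "(\<Sum>f\<in>{..<n} \<rightarrow>\<^sub>E {..<r}. (\<Sum>S\<in>Pow {..<n}. (-1) ^ (n - card S) * (\<Prod>b<n. real (card {a\<in>S. f a = g b}))) *
      (\<Prod>a<n. l (f a))) = fact n * (\<Prod>b<n. l (g b))"
proof -
  let ?R = "{..<n} \<rightarrow>\<^sub>E {..<r}"
  have finR: "finite ?R" by (intro finite_PiE) auto
  have single: "(\<Sum>f\<in>?R. (\<Prod>b<n. if f (h b) = g b then 1 else 0) * (\<Prod>a<n. l (f a))) = (\<Prod>b<n. l (g b))"
    if h: "h \<in> inj_maps n" for h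
  proof -
    have bij: "bij_betw h {..<n} {..<n}" using h inj_maps_image[of h n] by (auto simp: bij_betw_def)
    define f0 where "f0 = (\<lambda>a\<in>{..<n}. g (inv_into {..<n} h a))"
    have inv: "inv_into {..<n} h a < n" "h (inv_into {..<n} h a) = a" if "a < n" for a
      using bij_betw_inv_into[OF bij] bij_betw_inv_into_right[OF bij] that by (auto dest: bij_betwE)
    have hb: "h b < n" "inv_into {..<n} h (h b) = b" if "b < n" for b
      using bij_betwE[OF bij] bij_betw_inv_into_left[OF bij] that by auto
    have f0: "f0 \<in> ?R" using g inv by (auto simp: f0_def)
    have iff: "(\<forall>b<n. f (h b) = g b) \<longleftrightarrow> f = f0" if f: "f \<in> ?R" for f
    proof
      assume *: "\<forall>b<n. f (h b) = g b"
      have "f a = f0 a" for a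
      proof (cases "a < n")
        case True
        with *[rule_format, OF inv(1)[OF True]] inv(2)[OF True] show ?thesis by (simp add: f0_def)
      next
        case False
        with f show ?thesis by (auto simp: f0_def PiE_iff extensional_def)
      qed
      then show "f = f0" by blast
    next
      assume "f = f0"
      then show "\<forall>b<n. f (h b) = g b" using hb by (simp add: f0_def)
    qed
    have "(\<Sum>f\<in>?R. (\<Prod>b<n. if f (h b) = g b then 1 else 0) * (\<Prod>a<n. l (f a))) =
      (\<Sum>f\<in>?R. if f = f0 then \<Prod>a<n. l (f0 a) else 0)"
    proof (rule sum.cong[OF refl])
      fix f assume f: "f \<in> ?R"
      have "(\<Prod>b<n. if f (h b) = g b then 1 else 0 :: real) = (if f = f0 then 1 else 0)"
        unfolding iff[OF f, symmetric] by (auto intro!: prod.neutral simp: prod_zero_iff)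
      then show "(\<Prod>b<n. if f (h b) = g b then 1 else 0) * (\<Prod>a<n. l (f a)) =
        (if f = f0 then \<Prod>a<n. l (f0 a) else 0)" by simp
    qed
    also have "\<dots> = (\<Prod>a<n. l (f0 a))" using f0 finR by simp
    also have "\<dots> = (\<Prod>b<n. l (f0 (h b)))"
      by (rule prod.reindex_bij_betw[OF bij, symmetric])
    also have "\<dots> = (\<Prod>b<n. l (g b))" using hb by (intro prod.cong) (auto simp: f0_def)
    finally show ?thesis .
  qed
  have "(\<Sum>f\<in>?R. (\<Sum>S\<in>Pow {..<n}. (-1) ^ (n - card S) * (\<Prod>b<n. real (card {a\<in>S. f a = g b}))) *
      (\<Prod>a<n. l (f a))) =
    (\<Sum>f\<in>?R. \<Sum>h\<in>inj_maps n. (\<Prod>b<n. if f (h b) = g b then 1 else 0) * (\<Prod>a<n. l (f a)))"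
    by (simp only: alternating_sum_counts sum_distrib_right)
  also have "\<dots> = (\<Sum>h\<in>inj_maps n. \<Sum>f\<in>?R. (\<Prod>b<n. if f (h b) = g b then 1 else 0) * (\<Prod>a<n. l (f a)))"
    by (rule sum.swap)
  also have "\<dots> = (\<Sum>h\<in>inj_maps n. \<Prod>b<n. l (g b))" using single by (rule sum.cong[OF refl])
  also have "\<dots> = fact n * (\<Prod>b<n. l (g b))" by (simp only: sum_constant card_inj_maps of_nat_fact)
  finally show ?thesis .
qed

text \<open>Monomials are listed with repetitions and in no normal form, which suffices because the
  polarization identity is linear in the polynomial.\<close>

lemma hpoly_monomial_list:
  assumes "hpoly 0 r d p"
  shows "\<exists>ms. (\<forall>(c, js)\<in>set ms. length js = d \<and> set js \<subseteq> {..<r}) \<and>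
    (\<forall>x l. p x l = (\<Sum>(c, js)\<leftarrow>ms. c * prod_list (map l js)))"
  using assms
proof induction
  case (zero d)
  show ?case by (rule exI[of _ "[]"]) simp
next
  case (const c)
  show ?case by (rule exI[of _ "[(c, [])]"]) simp
next
  case (lvar d q j)
  then obtain ms where ms: "\<forall>(c, js)\<in>set ms. length js = d \<and> set js \<subseteq> {..<r}"
    "\<forall>x l. q x l = (\<Sum>(c, js)\<leftarrow>ms. c * prod_list (map l js))" by blast
  have "l j * (\<Sum>(c, js)\<leftarrow>ms. c * prod_list (map l js)) =
    (\<Sum>(c, js)\<leftarrow>map (\<lambda>(c, js). (c, j # js)) ms. c * prod_list (map l js))" for l :: "nat \<Rightarrow> real"
    by (induction ms) (auto simp: algebra_simps)
  then show ?case using ms lvar.hyps(2)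
    by (intro exI[of _ "map (\<lambda>(c, js). (c, j # js)) ms"]) fastforce
next
  case (add d q q')
  then obtain ms ms' where ms: "\<forall>(c, js)\<in>set ms. length js = d \<and> set js \<subseteq> {..<r}"
    "\<forall>x l. q x l = (\<Sum>(c, js)\<leftarrow>ms. c * prod_list (map l js))"
    "\<forall>(c, js)\<in>set ms'. length js = d \<and> set js \<subseteq> {..<r}"
    "\<forall>x l. q' x l = (\<Sum>(c, js)\<leftarrow>ms'. c * prod_list (map l js))" by blast
  then show ?case by (intro exI[of _ "ms @ ms'"]) auto
qed simp

lemma hpoly_monomials:
  assumes "hpoly 0 r d p"
  obtains N :: nat and g :: "nat \<Rightarrow> nat \<Rightarrow> nat" and c :: "nat \<Rightarrow> real"
  where "\<And>i b. i < N \<Longrightarrow> b < d \<Longrightarrow> g i b < r" "\<And>x l. p x l = (\<Sum>i<N. c i * (\<Prod>b<d. l (g i b)))"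
proof -
  obtain ms where ms: "\<forall>(c, js)\<in>set ms. length js = d \<and> set js \<subseteq> {..<r}"
    "\<forall>x l. p x l = (\<Sum>(c, js)\<leftarrow>ms. c * prod_list (map l js))"
    using hpoly_monomial_list[OF assms] by blast
  have len: "length (snd (ms ! i)) = d" "set (snd (ms ! i)) \<subseteq> {..<r}" if "i < length ms" for i
    using ms(1) nth_mem[OF that] by (auto simp: case_prod_unfold)
  show ?thesis
  proof (rule that[of "length ms" "\<lambda>i b. snd (ms ! i) ! b" "\<lambda>i. fst (ms ! i)"])
    fix i b assume "i < length ms" "b < d"
    then have "snd (ms ! i) ! b \<in> set (snd (ms ! i))" using len(1)[of i] by (intro nth_mem) simp
    then show "snd (ms ! i) ! b < r" using len(2)[OF \<open>i < length ms\<close>] by blast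
  next
    fix x l
    have "p x l = (\<Sum>i<length ms. fst (ms ! i) * prod_list (map l (snd (ms ! i))))"
      using ms(2) by (simp add: sum.list_conv_set_nth case_prod_unfold atLeast0LessThan)
    also have "\<dots> = (\<Sum>i<length ms. fst (ms ! i) * (\<Prod>b<d. l (snd (ms ! i) ! b)))"
      using len(1) by (intro sum.cong refl) (auto simp: prod.list_conv_set_nth atLeast0LessThan)
    finally show "p x l = (\<Sum>i<length ms. fst (ms ! i) * (\<Prod>b<d. l (snd (ms ! i) ! b)))" .
  qed
qed

text \<open>The coefficients are combinations of values of \<open>p\<close> at finitely many integer
  points. If \<open>p\<close> is a volume polynomial these values are volumes again, and volumes can
  be followed through a limit of bodies.\<close>

lemma polarization:
  assumes "hpoly 0 r n p"
  shows "p x l = (\<Sum>f\<in>{..<n} \<rightarrow>\<^sub>E {..<r}.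
    (1 / fact n * (\<Sum>S\<in>Pow {..<n}. (-1) ^ (n - card S) * p x (\<lambda>j. real (card {a\<in>S. f a = j})))) *
    (\<Prod>a<n. l (f a)))"
proof -
  obtain N :: nat and c :: "nat \<Rightarrow> real" and g :: "nat \<Rightarrow> nat \<Rightarrow> nat"
    where g: "\<And>i b. i < N \<Longrightarrow> b < n \<Longrightarrow> g i b < r"
      and p: "\<And>x l. p x l = (\<Sum>i<N. c i * (\<Prod>b<n. l (g i b)))"
    by (rule hpoly_monomials[OF assms], rule that; simp)
  let ?C = "\<lambda>f S i. \<Prod>b<n. real (card {a\<in>S. f a = g i b})"
  have "(\<Sum>S\<in>Pow {..<n}. (-1) ^ (n - card S) * (\<Sum>i<N. c i * ?C f S i)) =
    (\<Sum>i<N. c i * (\<Sum>S\<in>Pow {..<n}. (-1) ^ (n - card S) * ?C f S i))" for f :: "nat \<Rightarrow> nat"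
    unfolding sum_distrib_left by (subst sum.swap) (simp add: mult_ac)
  then have "(\<Sum>f\<in>{..<n} \<rightarrow>\<^sub>E {..<r}.
    (1 / fact n * (\<Sum>S\<in>Pow {..<n}. (-1) ^ (n - card S) * (\<Sum>i<N. c i * ?C f S i))) * (\<Prod>a<n. l (f a))) =
    (\<Sum>f\<in>{..<n} \<rightarrow>\<^sub>E {..<r}. \<Sum>i<N. 1 / fact n * c i *
      ((\<Sum>S\<in>Pow {..<n}. (-1) ^ (n - card S) * ?C f S i) * (\<Prod>a<n. l (f a))))"
    by (simp add: sum_distrib_left sum_distrib_right mult_ac)
  also have "\<dots> = (\<Sum>i<N. 1 / fact n * c i * (\<Sum>f\<in>{..<n} \<rightarrow>\<^sub>E {..<r}.
      (\<Sum>S\<in>Pow {..<n}. (-1) ^ (n - card S) * ?C f S i) * (\<Prod>a<n. l (f a))))"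
    by (subst sum.swap) (simp only: sum_distrib_left)
  also have "\<dots> = (\<Sum>i<N. 1 / fact n * c i * (fact n * (\<Prod>b<n. l (g i b))))"
    by (intro sum.cong refl arg_cong2[where f="(*)"] polarization_monomial g) auto
  also have "\<dots> = p x l" by (simp add: p mult_ac)
  finally show ?thesis by (simp only: p)
qed

section \<open>Approximation by polytopes\<close>

text \<open>The candidate for the mixed volume of \<open>n\<close> bodies;
  \<open>indicator S\<close> keeps the summands with index in \<open>S\<close>.\<close>

definition polar :: "nat \<Rightarrow> (nat \<Rightarrow> real) set list \<Rightarrow> real" where
  "polar n Ls = 1 / fact n *
    (\<Sum>S\<in>Pow {..<n}. (-1) ^ (n - card S) * vol n (mink_comb n Ls (indicator S)))"

text \<open>By convexity, N copies of a polytope add up to its N-fold dilate: one inclusion uses the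
  same weights in each copy, the other averages the weights of the copies.\<close>

lemma polysum_count:
  assumes S: "S \<subseteq> {..<n}" and f: "\<And>a. a < n \<Longrightarrow> f a < r"
    and fin: "\<And>j. j < r \<Longrightarrow> finite (A j) \<and> A j \<noteq> {}"
  shows "polysum n r A (\<lambda>j. real (card {a\<in>S. f a = j})) = polysum n n (\<lambda>a. A (f a)) (indicator S)"
proof
  have finS: "finite S" using S by (rule finite_subset) simp
  have ind: "(\<Sum>a<n. indicator S a * h a) = (\<Sum>a\<in>S. h a :: real)" for h
    using S by (intro sum.mono_neutral_cong_right) (auto simp: indicator_def)
  have group: "(\<Sum>a\<in>S. h a) = (\<Sum>j<r. \<Sum>a\<in>{a\<in>S. f a = j}. h a)" for h :: "nat \<Rightarrow> real"
    by (rule sum.group[symmetric]) (use S f finS in auto)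
  show "polysum n r A (\<lambda>j. real (card {a\<in>S. f a = j})) \<subseteq> polysum n n (\<lambda>a. A (f a)) (indicator S)"
  proof
    fix x assume x: "x \<in> polysum n r A (\<lambda>j. real (card {a\<in>S. f a = j}))"
    then obtain c where c: "\<And>j a. j < r \<Longrightarrow> a \<in> A j \<Longrightarrow> 0 \<le> c j a" "\<And>j. j < r \<Longrightarrow> sum (c j) (A j) = 1"
      and xi: "\<And>i. i < n \<Longrightarrow> x i = (\<Sum>j<r. real (card {a\<in>S. f a = j}) * (\<Sum>v\<in>A j. c j v * v i))"
      by (rule polysumE) blast
    show "x \<in> polysum n n (\<lambda>a. A (f a)) (indicator S)"
    proof (rule polysumI[where c="\<lambda>a. c (f a)"])
      show "x \<in> rn n" using x polysum_subset_rn by blast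
      fix i assume i: "i < n"
      show "x i = (\<Sum>a<n. indicator S a * (\<Sum>v\<in>A (f a). c (f a) v * v i))"
        unfolding ind group xi[OF i] by (intro sum.cong refl) simp
    qed (use c f in auto)
  qed
  show "polysum n n (\<lambda>a. A (f a)) (indicator S) \<subseteq> polysum n r A (\<lambda>j. real (card {a\<in>S. f a = j}))"
  proof
    fix x assume x: "x \<in> polysum n n (\<lambda>a. A (f a)) (indicator S)"
    then obtain c where c: "\<And>a v. a < n \<Longrightarrow> v \<in> A (f a) \<Longrightarrow> 0 \<le> c a v" "\<And>a. a < n \<Longrightarrow> sum (c a) (A (f a)) = 1"
      and xi: "\<And>i. i < n \<Longrightarrow> x i = (\<Sum>a<n. indicator S a * (\<Sum>v\<in>A (f a). c a v * v i))"
      by (rule polysumE) blast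
    let ?N = "\<lambda>j. real (card {a\<in>S. f a = j})"
    have cancel: "N * (s / N * u) = s * u" if "N \<noteq> 0" for N s u :: real using that by simp
    \<comment> \<open>Without a copy of \<open>j\<close> there is nothing to average, and uniform
      weights keep the sum equal to 1.\<close>
    define d where "d j v = (if {a\<in>S. f a = j} = {} then 1 / real (card (A j)) else (\<Sum>a\<in>{a\<in>S. f a = j}. c a v) / ?N j)" for j v
    have key: "?N j * (\<Sum>v\<in>A j. d j v * g v) = (\<Sum>a\<in>{a\<in>S. f a = j}. \<Sum>v\<in>A j. c a v * g v)" for j and g :: "(nat \<Rightarrow> real) \<Rightarrow> real"
    proof (cases "{a\<in>S. f a = j} = {}")
      case False
      then have N: "?N j \<noteq> 0" using finS by simp
      have d: "d j v = (\<Sum>a\<in>{a\<in>S. f a = j}. c a v) / ?N j" for v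
        unfolding d_def if_not_P[OF False] ..
      have "?N j * (\<Sum>v\<in>A j. d j v * g v) = (\<Sum>v\<in>A j. (\<Sum>a\<in>{a\<in>S. f a = j}. c a v) * g v)"
        unfolding sum_distrib_left[of "?N j"] d by (intro sum.cong refl cancel N)
      also have "\<dots> = (\<Sum>a\<in>{a\<in>S. f a = j}. \<Sum>v\<in>A j. c a v * g v)"
        unfolding sum_distrib_right by (rule sum.swap)
      finally show ?thesis .
    next
      case True
      show ?thesis unfolding True by simp
    qed
    show "x \<in> polysum n r A ?N"
    proof (rule polysumI[where c=d])
      show "x \<in> rn n" using x polysum_subset_rn by blast
    next
      fix j v assume "j < r" "v \<in> A j"
      then show "0 \<le> d j v" using c(1) S by (auto simp: d_def intro!: divide_nonneg_nonneg sum_nonneg)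
    next
      fix j assume j: "j < r"
      show "sum (d j) (A j) = 1"
      proof (cases "{a\<in>S. f a = j} = {}")
        case True
        then show ?thesis using fin[OF j] by (simp add: d_def)
      next
        case False
        have "?N j * sum (d j) (A j) = (\<Sum>a\<in>{a\<in>S. f a = j}. sum (c a) (A j))"
          using key[of j "\<lambda>_. 1"] by simp
        also have "\<dots> = (\<Sum>a\<in>{a\<in>S. f a = j}. 1)"
          by (rule sum.cong[OF refl]) (use c(2) S in auto)
        finally have "?N j * sum (d j) (A j) = ?N j" by simp
        moreover have "?N j \<noteq> 0" using finS False by simp
        ultimately show ?thesis by simp
      qed
    next
      fix i assume i: "i < n"
      show "x i = (\<Sum>j<r. ?N j * (\<Sum>v\<in>A j. d j v * v i))"
        unfolding key xi[OF i] ind group by (intro sum.cong refl) auto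
    qed
  qed
qed

text \<open>The volume polynomial comes from integrating the constant 1. Its values at the counting
  vectors of \<open>polarization\<close> become, by \<open>polysum_count\<close>, the volumes that
  make up \<open>polar\<close>.\<close>

lemma vol_polysum:
  assumes fin: "\<And>j. j < r \<Longrightarrow> finite (A j) \<and> A j \<noteq> {}" and l: "\<And>j. j < r \<Longrightarrow> 0 \<le> l j"
  shows "vol n (polysum n r A l) =
    (\<Sum>f\<in>{..<n} \<rightarrow>\<^sub>E {..<r}. polar n (map (\<lambda>a. pt_hull n (A (f a))) [0..<n]) * (\<Prod>a<n. l (f a)))"
proof -
  have "\<exists>p. hpoly 0 r (0 + n) p \<and>
    (\<forall>x l. (\<forall>j<r. 0 \<le> l j) \<longrightarrow> (\<integral>x. indicator (polysum n r A l) x * 1 \<partial>Leb n) = p x l)"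
    by (rule integral_polysum_hpoly[OF hpoly.const]) (use fin in auto)
  then obtain p where p0: "hpoly 0 r (0 + n) p \<and>
    (\<forall>x l. (\<forall>j<r. 0 \<le> l j) \<longrightarrow> (\<integral>x. indicator (polysum n r A l) x * 1 \<partial>Leb n) = p x l)"
    by (elim exE)
  then have p: "hpoly 0 r n p" by simp
  have vol: "vol n (polysum n r A l) = p x l" if "\<forall>j<r. 0 \<le> l j" for x l
  proof -
    have "(\<integral>x. indicator (polysum n r A l) x * 1 \<partial>Leb n) = p x l" using p0 that by blast
    moreover have "polysum n r A l \<in> sets (Leb n)" using fin by (intro polysum_sets) auto
    ultimately show ?thesis by (simp add: vol_def sets.Int_space_eq2)
  qed
  let ?x = "\<lambda>_. 0"
  have "vol n (polysum n r A l) = (\<Sum>f\<in>{..<n} \<rightarrow>\<^sub>E {..<r}.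
    (1 / fact n * (\<Sum>S\<in>Pow {..<n}. (-1) ^ (n - card S) * p ?x (\<lambda>j. real (card {a\<in>S. f a = j})))) *
    (\<Prod>a<n. l (f a)))"
    using vol[of l ?x] l polarization[OF p, of ?x l] by simp
  also have "\<dots> = (\<Sum>f\<in>{..<n} \<rightarrow>\<^sub>E {..<r}. polar n (map (\<lambda>a. pt_hull n (A (f a))) [0..<n]) * (\<Prod>a<n. l (f a)))"
    unfolding polar_def
  proof (intro sum.cong refl arg_cong2[where f="(*)"])
    fix f S assume f: "f \<in> {..<n} \<rightarrow>\<^sub>E {..<r}" and S: "S \<in> Pow {..<n}"
    have "p ?x (\<lambda>j. real (card {a\<in>S. f a = j})) = vol n (polysum n r A (\<lambda>j. real (card {a\<in>S. f a = j})))"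
      by (rule vol[symmetric]) simp
    also have "\<dots> = vol n (mink_comb n (map (\<lambda>a. pt_hull n (A (f a))) [0..<n]) (indicator S))"
      using S f fin by (subst polysum_count) (auto simp: polysum_eq_mink_comb)
    finally show "p ?x (\<lambda>j. real (card {a\<in>S. f a = j})) =
      vol n (mink_comb n (map (\<lambda>a. pt_hull n (A (f a))) [0..<n]) (indicator S))" .
  qed
  finally show ?thesis .
qed

section \<open>Convex combinations, neighbourhoods and circumscribed polytopes\<close>

definition convex_in :: "nat \<Rightarrow> (nat \<Rightarrow> real) set \<Rightarrow> bool" where
  "convex_in n K \<longleftrightarrow> K \<subseteq> rn n \<and>
    (\<forall>x\<in>K. \<forall>y\<in>K. \<forall>t. 0 \<le> t \<and> t \<le> 1 \<longrightarrow> (\<lambda>i\<in>{..<n}. (1 - t) * x i + t * y i) \<in> K)"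

lemma convex_in_combination:
  assumes K: "convex_in n K" and I: "finite I"
    and c: "\<And>a. a \<in> I \<Longrightarrow> 0 \<le> c a" "sum c I = 1" and y: "\<And>a. a \<in> I \<Longrightarrow> y a \<in> K"
  shows "(\<lambda>i\<in>{..<n}. \<Sum>a\<in>I. c a * y a i) \<in> K"
  using I c y
proof (induction I arbitrary: c rule: finite_induct)
  case (insert b I)
  have sum: "c b + sum c I = 1" using insert by simp
  show ?case
  proof (cases "sum c I = 0")
    case True
    then have "c a = 0" if "a \<in> I" for a using insert that by (simp add: sum_nonneg_eq_0_iff)
    then have "(\<lambda>i\<in>{..<n}. \<Sum>a\<in>insert b I. c a * y a i) = restrict (y b) {..<n}"
      using insert True sum by (intro restrict_ext) simp
    also have "\<dots> = y b" using insert.prems(3)[of b] K by (intro restrict_rn) (auto simp: convex_in_def)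
    finally show ?thesis using insert.prems by simp
  next
    case False
    have pos: "sum c I \<ge> 0" using insert by (intro sum_nonneg) auto
    let ?z = "\<lambda>i\<in>{..<n}. \<Sum>a\<in>I. (c a / sum c I) * y a i"
    have "?z \<in> K"
      using insert pos False by (intro insert.IH) (auto simp: sum_divide_distrib[symmetric])
    moreover have "y b \<in> K" "0 \<le> c b" "c b \<le> 1" using insert.prems pos sum by auto
    ultimately have "(\<lambda>i\<in>{..<n}. (1 - c b) * ?z i + c b * y b i) \<in> K"
      using K unfolding convex_in_def by blast
    moreover have "(\<lambda>i\<in>{..<n}. (1 - c b) * ?z i + c b * y b i) = (\<lambda>i\<in>{..<n}. \<Sum>a\<in>insert b I. c a * y a i)"
    proof (rule restrict_ext)
      fix i assume "i \<in> {..<n}"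
      then have "(1 - c b) * ?z i = (\<Sum>a\<in>I. c a * y a i)"
        using False sum by (simp add: sum_distrib_left eq_diff_eq[symmetric])
      then show "(1 - c b) * ?z i + c b * y b i = (\<Sum>a\<in>insert b I. c a * y a i)" using insert by simp
    qed
    ultimately show ?thesis by (simp only:)
  qed
qed simp

lemma pt_hull_eq_polysum: "pt_hull n A = polysum n 1 (\<lambda>_. A) (\<lambda>_. 1)"
proof
  show "pt_hull n A \<subseteq> polysum n 1 (\<lambda>_. A) (\<lambda>_. 1)"
  proof
    fix x assume "x \<in> pt_hull n A"
    then obtain c where "x = (\<lambda>i\<in>{..<n}. \<Sum>a\<in>A. c a * a i)" "\<forall>a\<in>A. 0 \<le> c a" "sum c A = 1"
      by (auto simp: pt_hull_def)
    then show "x \<in> polysum n 1 (\<lambda>_. A) (\<lambda>_. 1)"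
      unfolding polysum_def by (intro CollectI exI[of _ "\<lambda>_. c"]) simp
  qed
  show "polysum n 1 (\<lambda>_. A) (\<lambda>_. 1) \<subseteq> pt_hull n A"
    by (auto simp: polysum_def pt_hull_def)
qed

lemma convex_in_pt_hull: "convex_in n (pt_hull n A)"
  unfolding convex_in_def pt_hull_eq_polysum
  by (intro conjI polysum_subset_rn ballI allI impI polysum_convex) auto

lemma point_in_pt_hull:
  assumes "finite A" "a \<in> A" "a \<in> rn n"
  shows "a \<in> pt_hull n A"
proof -
  have "(\<Sum>b\<in>A. (if b = a then 1 else 0) * b i) = a i" for i
    using assms by (simp add: if_distrib[of "\<lambda>u. u * _"] cong: if_cong)
  then have "a = (\<lambda>i\<in>{..<n}. \<Sum>b\<in>A. (if b = a then 1 else 0) * b i)"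
    using restrict_rn[OF assms(3), of a] by simp
  then show ?thesis using assms unfolding pt_hull_def
    by (intro CollectI exI[of _ "\<lambda>b. if b = a then 1 else 0"] conjI) simp_all
qed

text \<open>The neighbourhood is taken in the maximum norm because it is then the Minkowski sum with
  a cube, and deviations can be estimated coordinate by coordinate.\<close>

definition thicken :: "nat \<Rightarrow> real \<Rightarrow> (nat \<Rightarrow> real) set \<Rightarrow> (nat \<Rightarrow> real) set" where
  "thicken n \<epsilon> K = {x\<in>rn n. \<exists>y\<in>K. \<forall>i<n. \<bar>x i - y i\<bar> \<le> \<epsilon>}"

lemma convex_in_thicken:
  assumes "convex_in n K"
  shows "convex_in n (thicken n \<epsilon> K)"
  unfolding convex_in_def
proof (intro conjI ballI allI impI)
  show "thicken n \<epsilon> K \<subseteq> rn n" by (auto simp: thicken_def)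
  fix x x' and t :: real
  assume "x \<in> thicken n \<epsilon> K" "x' \<in> thicken n \<epsilon> K" and t: "0 \<le> t \<and> t \<le> 1"
  then obtain y y' where y: "y \<in> K" "\<And>i. i < n \<Longrightarrow> \<bar>x i - y i\<bar> \<le> \<epsilon>" "y' \<in> K" "\<And>i. i < n \<Longrightarrow> \<bar>x' i - y' i\<bar> \<le> \<epsilon>"
    by (auto simp: thicken_def)
  let ?y = "\<lambda>i\<in>{..<n}. (1 - t) * y i + t * y' i"
  have "?y \<in> K" using assms y t by (auto simp: convex_in_def)
  moreover have "\<bar>((1 - t) * x i + t * x' i) - ((1 - t) * y i + t * y' i)\<bar> \<le> \<epsilon>" if "i < n" for i
  proof -
    have "\<bar>((1 - t) * x i + t * x' i) - ((1 - t) * y i + t * y' i)\<bar> = \<bar>(1 - t) * (x i - y i) + t * (x' i - y' i)\<bar>"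
      by (simp add: algebra_simps)
    also have "\<dots> \<le> (1 - t) * \<bar>x i - y i\<bar> + t * \<bar>x' i - y' i\<bar>"
      using t by (intro order.trans[OF abs_triangle_ineq]) (simp add: abs_mult)
    also have "\<dots> \<le> (1 - t) * \<epsilon> + t * \<epsilon>"
      using t y that by (intro add_mono mult_left_mono) auto
    finally show ?thesis by (simp add: algebra_simps)
  qed
  ultimately show "(\<lambda>i\<in>{..<n}. (1 - t) * x i + t * x' i) \<in> thicken n \<epsilon> K"
    unfolding thicken_def by (intro CollectI conjI restrict_in_rn bexI[of _ ?y]) auto
qed

lemma compact_cube:
  fixes n :: nat
  shows "compact (PiE {..<n} (\<lambda>i. {a i..b i :: real}))"
proof -
  have "PiE {..<n} (\<lambda>i. {a i..b i}) = PiE UNIV (\<lambda>i. if i < n then {a i..b i} else {undefined})"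
  proof (intro equalityI subsetI)
    fix x assume x: "x \<in> PiE UNIV (\<lambda>i. if i < n then {a i..b i} else {undefined})"
    show "x \<in> PiE {..<n} (\<lambda>i. {a i..b i})"
    proof (rule PiE_I)
      fix i assume "i \<in> {..<n}"
      then show "x i \<in> {a i..b i}" using PiE_mem[OF x, of i] by simp
    next
      fix i assume "i \<notin> {..<n}"
      then show "x i = undefined" using PiE_mem[OF x, of i] by simp
    qed
  qed (auto simp: PiE_iff extensional_def)
  then show ?thesis by (simp add: compact_PiE_UNIV)
qed

lemma compact_thicken:
  assumes "compact K"
  shows "compact (thicken n \<epsilon> K)"
proof -
  let ?Q = "PiE {..<n} (\<lambda>i. {-\<epsilon>..\<epsilon>})"
  have "thicken n \<epsilon> K = mink_comb n [K, ?Q] (\<lambda>_. 1)"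
  proof
    show "thicken n \<epsilon> K \<subseteq> mink_comb n [K, ?Q] (\<lambda>_. 1)"
    proof
      fix x assume "x \<in> thicken n \<epsilon> K"
      then obtain y where x: "x \<in> rn n" and y: "y \<in> K" "\<forall>i<n. \<bar>x i - y i\<bar> \<le> \<epsilon>" by (auto simp: thicken_def)
      let ?z = "\<lambda>i\<in>{..<n}. x i - y i"
      have "?z \<in> ?Q" using y(2) by (auto simp: abs_le_iff)
      moreover have "x = (\<lambda>i\<in>{..<n}. \<Sum>j<(2::nat). 1 * (if j = 0 then y else ?z) i)"
        using restrict_rn[OF x, of "\<lambda>i. y i + ?z i"] by (simp add: numeral_2_eq_2 restrict_def fun_eq_iff)
      ultimately show "x \<in> mink_comb n [K, ?Q] (\<lambda>_. 1)"
        using y(1) unfolding mink_comb_def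
        by (intro CollectI exI[of _ "\<lambda>j. if j = 0 then y else ?z"]) (auto simp: less_2_cases_iff numeral_2_eq_2 less_Suc_eq)
    qed
    show "mink_comb n [K, ?Q] (\<lambda>_. 1) \<subseteq> thicken n \<epsilon> K"
    proof
      fix x assume "x \<in> mink_comb n [K, ?Q] (\<lambda>_. 1)"
      then obtain z where x: "x = (\<lambda>i\<in>{..<n}. \<Sum>j<(2::nat). 1 * z j i)" and z: "\<forall>j<2. z j \<in> [K, ?Q] ! j"
        by (auto simp: mink_comb_def numeral_2_eq_2)
      have z0: "z 0 \<in> K" and z1: "z 1 \<in> ?Q" using z[rule_format, of 0] z[rule_format, of 1] by auto
      have "\<bar>z 1 i\<bar> \<le> \<epsilon>" if "i < n" for i using PiE_mem[OF z1, of i] that by auto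
      then show "x \<in> thicken n \<epsilon> K"
        unfolding thicken_def using z0
        by (intro CollectI conjI bexI[of _ "z 0"]) (auto simp: x numeral_2_eq_2 intro: restrict_in_rn)
    qed
  qed
  then show ?thesis using assms compact_cube[of n "\<lambda>_. -\<epsilon>" "\<lambda>_. \<epsilon>"] by (auto intro: compact_mink_comb)
qed

text \<open>Every point of \<open>K\<close> lies in a small cube around one of finitely many points, and that cube in the
  cross-polytope of radius \<open>\<epsilon>\<close> around it.\<close>

lemma polytope_approximation:
  assumes n: "0 < n" and K: "compact K" "K \<noteq> {}" "convex_in n K" and \<epsilon>: "0 < \<epsilon>"
  shows "\<exists>A. finite A \<and> A \<noteq> {} \<and> K \<subseteq> pt_hull n A \<and> pt_hull n A \<subseteq> thicken n \<epsilon> K"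
proof -
  \<comment> \<open>With this radius, \<open>n\<close> coordinate deviations below \<delta> add up
    to less than \<epsilon>, which puts the cube inside the cross-polytope.\<close>
  define \<delta> where "\<delta> = \<epsilon> / n"
  have \<delta>: "0 < \<delta>" "n * \<delta> = \<epsilon>" using n \<epsilon> by (auto simp: \<delta>_def)
  have rn: "x \<in> rn n" if "x \<in> K" for x using that K by (auto simp: convex_in_def)
  let ?U = "\<lambda>y. \<Inter>i\<in>{..<n}. {x :: nat \<Rightarrow> real. \<bar>x i - y i\<bar> < \<delta>}"
  have op: "open (?U y)" for y
    by (intro open_INT ballI open_Collect_less continuous_intros continuous_on_product_coordinates) auto
  have cover: "K \<subseteq> (\<Union>y\<in>K. ?U y)" using \<delta> by auto
  obtain F where F: "F \<subseteq> K" "finite F" "K \<subseteq> (\<Union>y\<in>F. ?U y)"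
    by (rule compactE_image[OF K(1) op cover])
  define A where "A = (\<lambda>((y :: nat \<Rightarrow> real, i), s). y(i := y i + s * \<epsilon>)) ` ((F \<times> {..<n}) \<times> {-1, 1})"
  have finA: "finite A" using F(2) by (auto simp: A_def)
  have AI: "y(i := y i + s * \<epsilon>) \<in> A" if "y \<in> F" "i < n" "s \<in> {-1, 1}" for y i s
    unfolding A_def using that by (intro image_eqI[of _ _ "((y, i), s)"]) auto
  have upd_rn: "y(i := v) \<in> rn n" if "y \<in> rn n" "i < n" for y i v
    using that by (auto simp: rn_def PiE_iff extensional_def)
  have "A \<noteq> {}" using F(3) K(2) n by (auto simp: A_def)
  moreover have "pt_hull n A \<subseteq> thicken n \<epsilon> K"
  proof
    fix x assume "x \<in> pt_hull n A"
    then obtain c where c: "x = (\<lambda>i\<in>{..<n}. \<Sum>a\<in>A. c a * a i)" "\<And>a. a \<in> A \<Longrightarrow> 0 \<le> c a" "sum c A = 1"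
      by (auto simp: pt_hull_def)
    have "a \<in> thicken n \<epsilon> K" if "a \<in> A" for a
    proof -
      obtain q where q: "q \<in> (F \<times> {..<n}) \<times> {-1, 1 :: real}"
        "a = (\<lambda>((y, i), s). y(i := y i + s * \<epsilon>)) q"
        using \<open>a \<in> A\<close> unfolding A_def by (rule imageE) (rule that)
      obtain y i s where "q = ((y, i), s)" by (cases q) auto
      with q have a: "y \<in> F" "i < n" "s \<in> {-1, 1}" "a = y(i := y i + s * \<epsilon>)" by auto
      moreover have "y \<in> K" using a(1) F(1) by auto
      moreover from this have "a \<in> rn n" using a upd_rn rn by blast
      ultimately show ?thesis unfolding thicken_def using \<epsilon> by (auto intro!: bexI[of _ y])
    qed
    then show "x \<in> thicken n \<epsilon> K"
      unfolding c(1) by (intro convex_in_combination[OF convex_in_thicken[OF K(3)] finA c(2,3)])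
  qed
  moreover have "K \<subseteq> pt_hull n A"
  proof
    fix x assume x: "x \<in> K"
    then obtain y where y: "y \<in> F" "\<And>i. i < n \<Longrightarrow> \<bar>x i - y i\<bar> < \<delta>" using F(3) by blast
    have yrn: "y \<in> rn n" using y(1) F(1) rn by blast
    \<comment> \<open>\<open>x\<close> is the average of the points \<open>z i\<close>, each of
      which puts \<open>n\<close> times one coordinate deviation on a single axis.\<close>
    define z where "z i = y(i := y i + n * (x i - y i))" for i
    have "z i \<in> pt_hull n A" if i: "i < n" for i
    proof -
      \<comment> \<open>Solves \<open>(2 * t - 1) * \<epsilon> = n * (x i - y i)\<close>, so
        \<open>z i\<close> divides the axis of the cross-polytope in ratio \<open>t\<close>.\<close>
      define t where "t = (1 + (x i - y i) / \<delta>) / 2"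
      have "\<bar>(x i - y i) / \<delta>\<bar> \<le> 1" using y(2)[OF i] \<delta> by (simp add: abs_divide)
      then have "-1 \<le> (x i - y i) / \<delta>" "(x i - y i) / \<delta> \<le> 1" by linarith+
      then have t: "0 \<le> t" "t \<le> 1" by (simp_all add: t_def)
      have "y(i := y i + s * \<epsilon>) \<in> pt_hull n A" if "s \<in> {-1, 1}" for s
        using AI[OF y(1) i that] finA upd_rn[OF yrn i] by (intro point_in_pt_hull)
      then have "y(i := y i + (-1) * \<epsilon>) \<in> pt_hull n A" "y(i := y i + 1 * \<epsilon>) \<in> pt_hull n A" by blast+
      then have "(\<lambda>k\<in>{..<n}. (1 - t) * (y(i := y i + (-1) * \<epsilon>)) k + t * (y(i := y i + 1 * \<epsilon>)) k) \<in> pt_hull n A"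
        using convex_in_pt_hull[of n A] t unfolding convex_in_def by blast
      moreover have "(\<lambda>k\<in>{..<n}. (1 - t) * (y(i := y i + (-1) * \<epsilon>)) k + t * (y(i := y i + 1 * \<epsilon>)) k) = z i"
      proof (rule restrict_rn)
        show "z i \<in> rn n" unfolding z_def using yrn i by (rule upd_rn)
        fix k assume "k < n"
        have half: "2 * ((1 + u) / 2) - 1 = u" for u :: real by (simp add: field_simps)
        have "(1 - t) * (y i - \<epsilon>) + t * (y i + \<epsilon>) = y i + (2 * t - 1) * \<epsilon>" by (simp add: algebra_simps)
        also have "2 * t - 1 = (x i - y i) / \<delta>" unfolding t_def by (rule half)
        also have "(x i - y i) / \<delta> * \<epsilon> = n * (x i - y i)" using \<delta>(1) by (simp add: \<delta>(2)[symmetric])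
        finally show "(1 - t) * (y(i := y i + (-1) * \<epsilon>)) k + t * (y(i := y i + 1 * \<epsilon>)) k = z i k"
          by (simp add: z_def algebra_simps)
      qed
      ultimately show ?thesis by simp
    qed
    then have "(\<lambda>k\<in>{..<n}. \<Sum>i<n. 1 / n * z i k) \<in> pt_hull n A"
      using n by (intro convex_in_combination[OF convex_in_pt_hull]) auto
    moreover have "(\<lambda>k\<in>{..<n}. \<Sum>i<n. 1 / n * z i k) = x"
    proof (rule restrict_rn[OF rn[OF x]])
      fix k assume k: "k < n"
      have "z i k = y k + (if i = k then n * (x k - y k) else 0)" for i by (simp add: z_def)
      then have "(\<Sum>i<n. z i k) = n * y k + n * (x k - y k)" using k by (simp add: sum.distrib)
      then show "(\<Sum>i<n. 1 / n * z i k) = x k"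
        using n unfolding sum_distrib_left[symmetric] by (simp add: field_simps)
    qed
    ultimately show "x \<in> pt_hull n A" by simp
  qed
  ultimately show ?thesis using finA by blast
qed

section \<open>Existence of mixed volumes\<close>

text \<open>Continuity of the measure from above: closedness of \<open>K\<close> makes it the
  intersection of its neighbourhoods, and compactness makes their volumes finite.\<close>

lemma thicken_limit:
  assumes K: "compact K" "K \<subseteq> rn n" and C: "0 \<le> C"
  shows "(\<lambda>m. vol n (thicken n (C / real (Suc m)) K)) \<longlonglongrightarrow> vol n K"
proof -
  let ?T = "\<lambda>m. thicken n (C / real (Suc m)) K"
  have cT: "compact (?T m)" for m using K(1) by (rule compact_thicken)
  have T_rn: "?T m \<subseteq> rn n" for m by (auto simp: thicken_def)
  have sets: "range ?T \<subseteq> sets (Leb n)" using cT T_rn compact_imp_closed closed_measurable by blast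
  have dec: "decseq ?T"
  proof (rule decseq_SucI)
    fix m
    have "C / real (Suc (Suc m)) \<le> C / real (Suc m)" using C by (intro divide_left_mono) auto
    then show "?T (Suc m) \<subseteq> ?T m" unfolding thicken_def by (auto intro: order.trans)
  qed
  have "(\<Inter>m. ?T m) = K"
  proof
    show "K \<subseteq> (\<Inter>m. ?T m)" using K C by (auto simp: thicken_def intro!: bexI)
    show "(\<Inter>m. ?T m) \<subseteq> K"
    proof
      fix x assume x: "x \<in> (\<Inter>m. ?T m)"
      then have xrn: "x \<in> rn n" using T_rn by blast
      have "\<forall>m. \<exists>y. y \<in> K \<and> (\<forall>i<n. \<bar>x i - y i\<bar> \<le> C / real (Suc m))"
        using x by (auto simp: thicken_def)
      from choice[OF this] obtain y where y: "\<And>m. y m \<in> K"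
        "\<And>m i. i < n \<Longrightarrow> \<bar>x i - y m i\<bar> \<le> C / real (Suc m)" by auto
      have "(\<lambda>m. y m i) \<longlonglongrightarrow> x i" for i
      proof (cases "i < n")
        case True
        have "(\<lambda>m. x i - y m i) \<longlonglongrightarrow> 0"
        proof (rule Lim_null_comparison[where g="\<lambda>m. C / real (Suc m)"])
          show "(\<lambda>m. C / real (Suc m)) \<longlonglongrightarrow> 0"
            using LIMSEQ_Suc[OF lim_const_over_n[of C]] by simp
        qed (use y(2)[OF True] in auto)
        then have "(\<lambda>m. x i - (x i - y m i)) \<longlonglongrightarrow> x i - 0" by (intro tendsto_intros)
        then show ?thesis by simp
      next
        case False
        then have "y m i = x i" for m
          using xrn y(1)[of m] K(2) by (auto simp: rn_def PiE_iff extensional_def subset_iff)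
        then show ?thesis by simp
      qed
      then have "y \<longlonglongrightarrow> x"
        using limitin_componentwise[of "\<lambda>_. euclidean" "UNIV :: nat set" y x sequentially]
        by (simp add: euclidean_product_topology)
      then show "x \<in> K"
        using y(1) by (intro Lim_in_closed_set[OF compact_imp_closed[OF K(1)]]) auto
    qed
  qed
  moreover have "(\<lambda>m. measure (Leb n) (?T m)) \<longlonglongrightarrow> measure (Leb n) (\<Inter>m. ?T m)"
    by (intro Lim_measure_decseq sets dec less_imp_neq[OF compact_finite_measure[OF cT T_rn]])
  ultimately show ?thesis by (simp add: vol_def)
qed

lemma mink_comb_mono:
  assumes "\<And>j. j < r \<Longrightarrow> K j \<subseteq> L j"
  shows "mink_comb n (map K [0..<r]) l \<subseteq> mink_comb n (map L [0..<r]) l"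
  unfolding mink_comb_def using assms by auto

lemma mink_comb_thicken:
  assumes l: "\<And>j. j < r \<Longrightarrow> 0 \<le> l j"
  shows "mink_comb n (map (\<lambda>j. thicken n \<epsilon> (K j)) [0..<r]) l \<subseteq>
    thicken n ((\<Sum>j<r. l j) * \<epsilon>) (mink_comb n (map K [0..<r]) l)"
proof
  fix x assume "x \<in> mink_comb n (map (\<lambda>j. thicken n \<epsilon> (K j)) [0..<r]) l"
  then obtain z where x: "x = (\<lambda>i\<in>{..<n}. \<Sum>j<r. l j * z j i)" and z: "\<And>j. j < r \<Longrightarrow> z j \<in> thicken n \<epsilon> (K j)"
    by (auto simp: mink_comb_def)
  have "\<forall>j. \<exists>y. j < r \<longrightarrow> y \<in> K j \<and> (\<forall>i<n. \<bar>z j i - y i\<bar> \<le> \<epsilon>)"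
    using z by (auto simp: thicken_def)
  from choice[OF this] obtain y where y: "\<And>j. j < r \<Longrightarrow> y j \<in> K j"
    "\<And>j i. j < r \<Longrightarrow> i < n \<Longrightarrow> \<bar>z j i - y j i\<bar> \<le> \<epsilon>" by auto
  let ?y = "\<lambda>i\<in>{..<n}. \<Sum>j<r. l j * y j i"
  have "?y \<in> mink_comb n (map K [0..<r]) l" using y(1) by (auto simp: mink_comb_def)
  moreover have "\<bar>x i - ?y i\<bar> \<le> (\<Sum>j<r. l j) * \<epsilon>" if i: "i < n" for i
  proof -
    have "\<bar>x i - ?y i\<bar> = \<bar>\<Sum>j<r. l j * (z j i - y j i)\<bar>"
      using i by (simp add: x sum_subtractf right_diff_distrib)
    also have "\<dots> \<le> (\<Sum>j<r. l j * \<bar>z j i - y j i\<bar>)"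
      by (rule order.trans[OF sum_abs]) (use l in \<open>auto intro!: sum_mono simp: abs_mult\<close>)
    also have "\<dots> \<le> (\<Sum>j<r. l j * \<epsilon>)"
      using l y(2) i by (intro sum_mono mult_left_mono) auto
    finally show ?thesis by (simp add: sum_distrib_right)
  qed
  ultimately show "x \<in> thicken n ((\<Sum>j<r. l j) * \<epsilon>) (mink_comb n (map K [0..<r]) l)"
    unfolding thicken_def x by (intro CollectI conjI restrict_in_rn bexI[of _ ?y]) (auto simp: x)
qed

lemma vol_mono:
  assumes "K \<subseteq> L" "compact K" "compact L" "L \<subseteq> rn n"
  shows "vol n K \<le> vol n L"
  unfolding vol_def using assms
  by (intro measure_mono_fmeasurable fmeasurableI closed_measurable compact_imp_closed compact_finite_measure) auto

text \<open>As the approximation is from outside, monotonicity gives the lower bound; the upper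
  bound is the volume of a neighbourhood of the limit whose radius tends to 0.\<close>

lemma vol_mink_comb_limit:
  assumes K: "\<And>j. j < r \<Longrightarrow> compact (K j)" and P: "\<And>m j. j < r \<Longrightarrow> compact (P m j)"
    and KP: "\<And>m j. j < r \<Longrightarrow> K j \<subseteq> P m j" "\<And>m j. j < r \<Longrightarrow> P m j \<subseteq> thicken n (1 / real (Suc m)) (K j)"
    and l: "\<And>j. j < r \<Longrightarrow> 0 \<le> l j"
  shows "(\<lambda>m. vol n (mink_comb n (map (P m) [0..<r]) l)) \<longlonglongrightarrow> vol n (mink_comb n (map K [0..<r]) l)"
proof (rule tendsto_sandwich)
  let ?M = "mink_comb n (map K [0..<r]) l" and ?C = "\<Sum>j<r. l j"
  have cM: "compact ?M" using K by (intro compact_mink_comb) auto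
  have cP: "compact (mink_comb n (map (P m) [0..<r]) l)" for m using P by (intro compact_mink_comb) auto
  have sub: "mink_comb n (map (P m) [0..<r]) l \<subseteq> thicken n (?C / real (Suc m)) ?M" for m
    using order.trans[OF mink_comb_mono[OF KP(2)] mink_comb_thicken[OF l]] by simp
  show "\<forall>\<^sub>F m in sequentially. vol n ?M \<le> vol n (mink_comb n (map (P m) [0..<r]) l)"
    using KP(1) by (intro always_eventually allI vol_mono mink_comb_mono mink_comb_subset_rn cM cP) auto
  show "\<forall>\<^sub>F m in sequentially. vol n (mink_comb n (map (P m) [0..<r]) l) \<le> vol n (thicken n (?C / real (Suc m)) ?M)"
    by (intro always_eventually allI vol_mono sub cP compact_thicken cM) (auto simp: thicken_def)
  show "(\<lambda>m. vol n (thicken n (?C / real (Suc m)) ?M)) \<longlonglongrightarrow> vol n ?M"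
    using l by (intro thicken_limit cM mink_comb_subset_rn sum_nonneg) auto
qed simp

lemma convex_body_iff: "convex_body n K \<longleftrightarrow> K \<noteq> {} \<and> compact K \<and> convex_in n K"
  by (auto simp: convex_body_def convex_in_def)

text \<open>Both sides are finite combinations of volumes of Minkowski combinations, each of which
  is the limit along circumscribed polytopes. For the polytopes the identity is
  \<open>vol_polysum\<close>.\<close>

lemma vol_mink_comb_polar:
  assumes n: "0 < n" and K: "\<And>j. j < r \<Longrightarrow> convex_body n (K j)" and l: "\<And>j. j < r \<Longrightarrow> 0 \<le> l j"
  shows "vol n (mink_comb n (map K [0..<r]) l) =
    (\<Sum>f\<in>{..<n} \<rightarrow>\<^sub>E {..<r}. polar n (map (\<lambda>a. K (f a)) [0..<n]) * (\<Prod>a<n. l (f a)))"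
proof -
  define A where "A m j = (SOME A. finite A \<and> A \<noteq> {} \<and> K j \<subseteq> pt_hull n A \<and>
    pt_hull n A \<subseteq> thicken n (1 / real (Suc m)) (K j))" for m j
  have ex: "\<exists>A. finite A \<and> A \<noteq> {} \<and> K j \<subseteq> pt_hull n A \<and> pt_hull n A \<subseteq> thicken n (1 / real (Suc m)) (K j)" if "j < r" for m j
    using K[OF that] by (intro polytope_approximation n) (auto simp: convex_body_iff)
  have A: "finite (A m j) \<and> A m j \<noteq> {} \<and> K j \<subseteq> pt_hull n (A m j) \<and>
      pt_hull n (A m j) \<subseteq> thicken n (1 / real (Suc m)) (K j)" if "j < r" for m j
    unfolding A_def by (rule someI_ex) (rule ex[OF that])
  define P where "P m j = pt_hull n (A m j)" for m j
  have cK: "compact (K j)" if "j < r" for j using K[OF that] by (simp add: convex_body_iff)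
  have cP: "compact (P m j)" if "j < r" for m j using A[OF that] by (simp add: P_def compact_pt_hull)
  have KP: "K j \<subseteq> P m j" "P m j \<subseteq> thicken n (1 / real (Suc m)) (K j)" if "j < r" for m j
    using A[OF that] by (auto simp: P_def)
  have eq: "vol n (mink_comb n (map (P m) [0..<r]) l) =
    (\<Sum>f\<in>{..<n} \<rightarrow>\<^sub>E {..<r}. polar n (map (\<lambda>a. P m (f a)) [0..<n]) * (\<Prod>a<n. l (f a)))" for m
    using vol_polysum[of r "A m" l n] A l by (simp add: polysum_eq_mink_comb P_def[abs_def])
  have lim1: "(\<lambda>m. vol n (mink_comb n (map (P m) [0..<r]) l)) \<longlonglongrightarrow> vol n (mink_comb n (map K [0..<r]) l)"
    by (rule vol_mink_comb_limit[OF cK cP KP l])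
  have lim2: "(\<lambda>m. vol n (mink_comb n (map (P m) [0..<r]) l)) \<longlonglongrightarrow>
    (\<Sum>f\<in>{..<n} \<rightarrow>\<^sub>E {..<r}. polar n (map (\<lambda>a. K (f a)) [0..<n]) * (\<Prod>a<n. l (f a)))"
    unfolding eq polar_def
  proof (intro tendsto_sum tendsto_mult tendsto_const)
    fix f and S :: "nat set" assume f: "f \<in> {..<n} \<rightarrow>\<^sub>E {..<r}"
    have fa: "f a < r" if "a < n" for a using f that by auto
    \<comment> \<open>This is the limit lemma for \<open>n\<close> bodies with coefficients 0 and 1,
      the reason why it admits \<open>l j = 0\<close>.\<close>
    show "(\<lambda>m. vol n (mink_comb n (map (\<lambda>a. P m (f a)) [0..<n]) (indicator S))) \<longlonglongrightarrow>
      vol n (mink_comb n (map (\<lambda>a. K (f a)) [0..<n]) (indicator S))"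
      by (rule vol_mink_comb_limit) (use cK cP KP fa in auto)
  qed
  show ?thesis using LIMSEQ_unique[OF lim1 lim2] .
qed

lemma mink_comb_permute:
  assumes p: "p permutes {..<length Ms}"
  shows "mink_comb n (permute_list p Ms) (\<lambda>j. l (p j)) = mink_comb n Ms l"
proof
  let ?r = "length Ms"
  have bij: "bij_betw p {..<?r} {..<?r}" using p by (rule permutes_imp_bij)
  have pj: "p j < ?r" "inv_into UNIV p j < ?r" if "j < ?r" for j
    using that permutes_in_image[OF p, of j] permutes_in_image[OF permutes_inv[OF p], of j] by auto
  have nth: "permute_list p Ms ! j = Ms ! p j" if "j < ?r" for j using that by (rule permute_list_nth[OF p])
  show "mink_comb n (permute_list p Ms) (\<lambda>j. l (p j)) \<subseteq> mink_comb n Ms l"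
  proof
    fix y assume "y \<in> mink_comb n (permute_list p Ms) (\<lambda>j. l (p j))"
    then obtain x where y: "y = (\<lambda>i\<in>{..<n}. \<Sum>j<?r. l (p j) * x j i)" and x: "\<And>j. j < ?r \<Longrightarrow> x j \<in> Ms ! p j"
      by (auto simp: mink_comb_def nth)
    have "(\<Sum>j<?r. l (p j) * x (inv_into UNIV p (p j)) i) = (\<Sum>j<?r. l j * x (inv_into UNIV p j) i)" for i
      by (rule sum.reindex_bij_betw[OF bij])
    then have "(\<Sum>j<?r. l (p j) * x j i) = (\<Sum>j<?r. l j * x (inv_into UNIV p j) i)" for i
      by (simp add: permutes_inverses[OF p])
    moreover have "x (inv_into UNIV p j) \<in> Ms ! j" if "j < ?r" for j
      using x[OF pj(2)[OF that]] by (simp add: permutes_inverses[OF p])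
    ultimately show "y \<in> mink_comb n Ms l"
      unfolding mink_comb_def y by (intro CollectI exI[of _ "\<lambda>j. x (inv_into UNIV p j)"]) simp
  qed
  show "mink_comb n Ms l \<subseteq> mink_comb n (permute_list p Ms) (\<lambda>j. l (p j))"
  proof
    fix y assume "y \<in> mink_comb n Ms l"
    then obtain x where y: "y = (\<lambda>i\<in>{..<n}. \<Sum>j<?r. l j * x j i)" and x: "\<And>j. j < ?r \<Longrightarrow> x j \<in> Ms ! j"
      by (auto simp: mink_comb_def)
    have "(\<Sum>j<?r. l (p j) * x (p j) i) = (\<Sum>j<?r. l j * x j i)" for i
      by (rule sum.reindex_bij_betw[OF bij])
    then show "y \<in> mink_comb n (permute_list p Ms) (\<lambda>j. l (p j))"
      unfolding mink_comb_def y using x pj by (intro CollectI exI[of _ "\<lambda>j. x (p j)"]) (simp add: nth)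
  qed
qed

text \<open>A permutation of the list permutes the index sets \<open>S\<close> and preserves their
  cardinalities, so the sum is only rearranged.\<close>

lemma polar_permute:
  assumes "mset Ls = mset Ms" "length Ls = n"
  shows "polar n Ls = polar n Ms"
proof -
  obtain p where p: "p permutes {..<length Ms}" "permute_list p Ms = Ls"
    using mset_eq_permutation[OF assms(1)] by blast
  have len: "length Ms = n" using assms mset_eq_length by metis
  have bij: "bij_betw ((`) p) (Pow {..<n}) (Pow {..<n})"
    using permutes_imp_bij[OF p(1)] len by (intro bij_betw_Pow) simp
  have inj: "inj p" using p(1) by (rule permutes_inj)
  have "(\<Sum>S\<in>Pow {..<n}. (-1) ^ (n - card S) * vol n (mink_comb n Ms (indicator S))) =
    (\<Sum>S\<in>Pow {..<n}. (-1) ^ (n - card (p ` S)) * vol n (mink_comb n Ms (indicator (p ` S))))"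
    by (rule sum.reindex_bij_betw[OF bij, symmetric])
  also have "\<dots> = (\<Sum>S\<in>Pow {..<n}. (-1) ^ (n - card S) * vol n (mink_comb n Ls (indicator S)))"
  proof (intro sum.cong refl)
    fix S
    have "indicator (p ` S) (p j) = (indicator S j :: real)" for j
      using inj by (auto simp: indicator_def dest: injD)
    then have "mink_comb n Ls (indicator S) = mink_comb n Ms (indicator (p ` S))"
      using mink_comb_permute[OF p(1), of n "indicator (p ` S)"] p(2) by simp
    then show "(-1) ^ (n - card (p ` S)) * vol n (mink_comb n Ms (indicator (p ` S))) =
      (-1) ^ (n - card S) * vol n (mink_comb n Ls (indicator S))"
      using card_image[OF inj_on_subset[OF inj subset_UNIV]] by simp
  qed
  finally show ?thesis by (simp add: polar_def)
qed

lemma mixed_volume_exists: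
  assumes n: "0 < n"
  shows "\<exists>V. is_mixed_volume n V"
proof
  \<comment> \<open>Symmetry is demanded for lists of every length, whereas
    \<open>polar_permute\<close> covers length \<open>n\<close>, the only length that the expansion
    reads; the constant 0 is symmetric on the rest.\<close>
  let ?V = "\<lambda>Ls. if length Ls = n then polar n Ls else 0"
  show "is_mixed_volume n ?V"
    unfolding is_mixed_volume_def
  proof (intro conjI allI impI)
    fix Ls Ms :: "(nat \<Rightarrow> real) set list"
    assume "mset Ls = mset Ms"
    then show "?V Ls = ?V Ms" using polar_permute[of Ls Ms n] mset_eq_length[of Ls Ms] by simp
  next
    fix Ls :: "(nat \<Rightarrow> real) set list" and l :: "nat \<Rightarrow> real"
    assume *: "Ls \<noteq> [] \<and> (\<forall>L\<in>set Ls. convex_body n L) \<and> (\<forall>j<length Ls. l j > 0)"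
    have "vol n (mink_comb n (map ((!) Ls) [0..<length Ls]) l) =
      (\<Sum>f\<in>{..<n} \<rightarrow>\<^sub>E {..<length Ls}. polar n (map (\<lambda>a. Ls ! f a) [0..<n]) * (\<Prod>a<n. l (f a)))"
      using * by (intro vol_mink_comb_polar n) (auto intro: less_imp_le)
    then show "vol n (mink_comb n Ls l) =
      (\<Sum>f\<in>{..<n} \<rightarrow>\<^sub>E {..<length Ls}. ?V (map (\<lambda>a. Ls ! f a) [0..<n]) * (\<Prod>a<n. l (f a)))"
      by (simp add: map_nth)
  qed
qed

section \<open>Mixed volumes of boxes\<close>

text \<open>With a corner at the origin, boxes combine under positive coefficients by combining
  their sides linearly; sides of length 0 give lower-dimensional bodies.\<close>

definition box_at0 :: "nat \<Rightarrow> (nat \<Rightarrow> real) \<Rightarrow> (nat \<Rightarrow> real) set" where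
  "box_at0 n \<alpha> = PiE {..<n} (\<lambda>i. {0..\<alpha> i})"

lemma convex_body_box:
  assumes "\<And>i. i < n \<Longrightarrow> 0 \<le> \<alpha> i"
  shows "convex_body n (box_at0 n \<alpha>)"
  unfolding convex_body_def
proof (intro conjI ballI allI impI)
  have "(\<lambda>i\<in>{..<n}. 0) \<in> box_at0 n \<alpha>" using assms by (auto simp: box_at0_def)
  then show "box_at0 n \<alpha> \<noteq> {}" by auto
  show "box_at0 n \<alpha> \<subseteq> rn n" unfolding box_at0_def rn_def by (intro PiE_mono) auto
  show "compact (box_at0 n \<alpha>)" unfolding box_at0_def by (rule compact_cube)
  fix x y and t :: real assume xy: "x \<in> box_at0 n \<alpha>" "y \<in> box_at0 n \<alpha>" and t: "0 \<le> t \<and> t \<le> 1"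
  have "0 \<le> (1 - t) * x i + t * y i \<and> (1 - t) * x i + t * y i \<le> \<alpha> i" if "i < n" for i
  proof -
    have b: "0 \<le> x i" "x i \<le> \<alpha> i" "0 \<le> y i" "y i \<le> \<alpha> i" using xy that by (auto simp: box_at0_def PiE_iff)
    have "(1 - t) * x i + t * y i \<le> (1 - t) * \<alpha> i + t * \<alpha> i" using b t by (intro add_mono mult_left_mono) auto
    also have "\<dots> = \<alpha> i" by (simp add: algebra_simps)
    finally show ?thesis using b t by simp
  qed
  then show "(\<lambda>i\<in>{..<n}. (1 - t) * x i + t * y i) \<in> box_at0 n \<alpha>" by (auto simp: box_at0_def)
qed

lemma vol_box:
  assumes "\<And>i. i < n \<Longrightarrow> 0 \<le> \<alpha> i"
  shows "vol n (box_at0 n \<alpha>) = (\<Prod>i<n. \<alpha> i)"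
proof -
  have "(\<Prod>i<n. ennreal (\<alpha> i)) = ennreal (\<Prod>i<n. \<alpha> i)" using assms by (intro prod_ennreal) auto
  moreover have "0 \<le> (\<Prod>i<n. \<alpha> i)" using assms by (intro prod_nonneg) auto
  ultimately show ?thesis
    using emeasure_box[of n "\<lambda>_. 0" \<alpha>] by (simp add: vol_def box_at0_def measure_def)
qed

lemma mink_comb_two_boxes:
  assumes \<alpha>: "\<And>i. i < n \<Longrightarrow> 0 \<le> \<alpha> i" and \<beta>: "\<And>i. i < n \<Longrightarrow> 0 \<le> \<beta> i" and l: "0 < l 0" "0 < l 1"
  shows "mink_comb n [box_at0 n \<alpha>, box_at0 n \<beta>] l = box_at0 n (\<lambda>i. l 0 * \<alpha> i + l 1 * \<beta> i)"
proof
  show "mink_comb n [box_at0 n \<alpha>, box_at0 n \<beta>] l \<subseteq> box_at0 n (\<lambda>i. l 0 * \<alpha> i + l 1 * \<beta> i)"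
  proof
    fix y assume "y \<in> mink_comb n [box_at0 n \<alpha>, box_at0 n \<beta>] l"
    then obtain x where y: "y = (\<lambda>i\<in>{..<n}. l 0 * x 0 i + l 1 * x 1 i)"
      and x: "\<forall>j<(2::nat). x j \<in> [box_at0 n \<alpha>, box_at0 n \<beta>] ! j"
      by (auto simp: mink_comb_def numeral_2_eq_2)
    have x0: "x 0 \<in> box_at0 n \<alpha>" and x1: "x 1 \<in> box_at0 n \<beta>" using x[rule_format, of 0] x[rule_format, of 1] by auto
    then have "0 \<le> x 0 i" "x 0 i \<le> \<alpha> i" "0 \<le> x 1 i" "x 1 i \<le> \<beta> i" if "i < n" for i
      using that by (auto simp: box_at0_def PiE_iff)
    then show "y \<in> box_at0 n (\<lambda>i. l 0 * \<alpha> i + l 1 * \<beta> i)"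
      using l unfolding y box_at0_def by (auto intro!: add_mono)
  qed
  show "box_at0 n (\<lambda>i. l 0 * \<alpha> i + l 1 * \<beta> i) \<subseteq> mink_comb n [box_at0 n \<alpha>, box_at0 n \<beta>] l"
  proof
    fix y assume y: "y \<in> box_at0 n (\<lambda>i. l 0 * \<alpha> i + l 1 * \<beta> i)"
    \<comment> \<open>The relative position of \<open>y i\<close> on its side; the same relative
      position in both boxes splits \<open>y\<close>. On a side of length 0 also \<open>y i\<close>
      is 0, and the default 0 fits.\<close>
    define t where "t i = (if l 0 * \<alpha> i + l 1 * \<beta> i = 0 then 0 else y i / (l 0 * \<alpha> i + l 1 * \<beta> i))" for i
    have yi: "0 \<le> y i" "y i \<le> l 0 * \<alpha> i + l 1 * \<beta> i" if "i < n" for i using y that by (auto simp: box_at0_def PiE_iff)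
    have t: "0 \<le> t i" "t i \<le> 1" "t i * (l 0 * \<alpha> i + l 1 * \<beta> i) = y i" if i: "i < n" for i
      using yi[OF i] by (auto simp: t_def divide_le_eq)
    let ?x = "\<lambda>j :: nat. if j = 0 then (\<lambda>i\<in>{..<n}. t i * \<alpha> i) else (\<lambda>i\<in>{..<n}. t i * \<beta> i)"
    have scale: "0 \<le> t i * u \<and> t i * u \<le> u" if "i < n" "0 \<le> u" for i u
      using t[OF that(1)] that(2) by (auto intro: mult_left_le_one_le)
    have "?x 0 \<in> box_at0 n \<alpha>" "?x 1 \<in> box_at0 n \<beta>" using scale \<alpha> \<beta> by (auto simp: box_at0_def)
    moreover have "y = (\<lambda>i\<in>{..<n}. l 0 * ?x 0 i + l 1 * ?x 1 i)"
    proof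
      fix i
      show "y i = (\<lambda>i\<in>{..<n}. l 0 * ?x 0 i + l 1 * ?x 1 i) i"
        using t(3)[of i] y by (cases "i < n") (auto simp: algebra_simps box_at0_def PiE_iff extensional_def)
    qed
    ultimately show "y \<in> mink_comb n [box_at0 n \<alpha>, box_at0 n \<beta>] l"
      unfolding mink_comb_def
      by (intro CollectI exI[of _ ?x] conjI) (auto simp: less_Suc_eq)
  qed
qed

lemma mset_two_valued:
  assumes "T \<subseteq> {..<n}"
  shows "mset (map (\<lambda>a. if a \<in> T then K else L) [0..<n]) = mset (replicate (card T) K @ replicate (n - card T) L)"
proof -
  have fin: "finite T" using assms by (rule finite_subset) simp
  have "{..<n} = T \<union> ({..<n} - T)" using assms by auto
  then have "mset_set {..<n} = mset_set T + mset_set ({..<n} - T)"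
    using fin mset_set_Union[of T "{..<n} - T"] by (simp add: Diff_disjoint)
  moreover have "{#if a \<in> T then K else L. a \<in># mset_set T#} = replicate_mset (card T) K"
    using fin image_mset_cong[of "mset_set T" "\<lambda>a. if a \<in> T then K else L" "\<lambda>_. K"]
    by (simp add: image_mset_const_eq)
  moreover have "{#if a \<in> T then K else L. a \<in># mset_set ({..<n} - T)#} = replicate_mset (n - card T) L"
    using fin assms image_mset_cong[of "mset_set ({..<n} - T)" "\<lambda>a. if a \<in> T then K else L" "\<lambda>_. L"]
    by (simp add: image_mset_const_eq card_Diff_subset)
  ultimately show ?thesis by (simp add: mset_map atLeast0LessThan)
qed

lemma is_mixed_volume_sym:
  assumes "is_mixed_volume n V" "mset Ls = mset Ms"
  shows "V Ls = V Ms"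
proof -
  have "\<forall>Ls Ms. mset Ls = mset Ms \<longrightarrow> V Ls = V Ms"
    using assms(1) unfolding is_mixed_volume_def by (rule conjunct1)
  from this[rule_format, OF assms(2)] show ?thesis .
qed

lemma mixed_volume_sym:
  assumes "mset Ls = mset Ms"
  shows "mixed_volume n Ls = mixed_volume n Ms"
proof -
  have "is_mixed_volume n V \<and> V Ls = v \<longleftrightarrow> is_mixed_volume n V \<and> V Ms = v" for V v
    using is_mixed_volume_sym[OF _ assms, of n V] by metis
  then show ?thesis by (simp only: mixed_volume_def)
qed

text \<open>A map into two indices is a subset \<open>T\<close>, the positions of the first body. By
  symmetry its term depends on \<open>card T\<close> only, and grouping by cardinality produces the
  binomial coefficients.\<close>

lemma mixed_volume_two_bodies:
  assumes V: "is_mixed_volume n V" and K: "convex_body n K" "convex_body n L" and s: "0 < s"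
  shows "vol n (mink_comb n [K, L] (\<lambda>j. if j = 0 then s else 1)) =
    (\<Sum>c\<le>n. (real (n choose c) * V (replicate c K @ replicate (n - c) L)) * s ^ c)"
proof -
  let ?l = "\<lambda>j :: nat. if j = 0 then s else 1"
  let ?W = "\<lambda>c. V (replicate c K @ replicate (n - c) L) * s ^ c"
  let ?f = "\<lambda>T. \<lambda>a\<in>{..<n}. if a \<in> T then 0 else 1 :: nat"
  have VE: "vol n (mink_comb n [K, L] ?l) =
    (\<Sum>f\<in>{..<n} \<rightarrow>\<^sub>E {..<2}. V (map (\<lambda>a. [K, L] ! f a) [0..<n]) * (\<Prod>a<n. ?l (f a)))"
  proof -
    have "\<forall>Ls lam. Ls \<noteq> [] \<and> (\<forall>L\<in>set Ls. convex_body n L) \<and> (\<forall>j<length Ls. lam j > 0) \<longrightarrow>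
        vol n (mink_comb n Ls lam) =
          (\<Sum>f\<in>{..<n} \<rightarrow>\<^sub>E {..<length Ls}. V (map (\<lambda>a. Ls ! f a) [0..<n]) * (\<Prod>a<n. lam (f a)))"
      using V unfolding is_mixed_volume_def by (rule conjunct2)
    from this[rule_format, of "[K, L]" ?l] show ?thesis using K s by (simp add: numeral_2_eq_2)
  qed
  have bij: "bij_betw ?f (Pow {..<n}) ({..<n} \<rightarrow>\<^sub>E {..<2})"
  proof (rule bij_betwI[where g="\<lambda>f. {a\<in>{..<n}. f a = 0}"])
    show "?f \<in> Pow {..<n} \<rightarrow> {..<n} \<rightarrow>\<^sub>E {..<2}" by auto
    show "(\<lambda>f. {a\<in>{..<n}. f a = 0}) \<in> ({..<n} \<rightarrow>\<^sub>E {..<2}) \<rightarrow> Pow {..<n}" by auto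
    fix T assume "T \<in> Pow {..<n}"
    then show "{a\<in>{..<n}. ?f T a = 0} = T" by auto
  next
    fix f :: "nat \<Rightarrow> nat" assume f: "f \<in> {..<n} \<rightarrow>\<^sub>E {..<2}"
    show "?f {a\<in>{..<n}. f a = 0} = f"
    proof
      fix a
      show "?f {a\<in>{..<n}. f a = 0} a = f a"
        using PiE_mem[OF f, of a] PiE_arb[OF f, of a] by (cases "a < n") auto
    qed
  qed
  have card_le: "card T \<le> n" if "T \<subseteq> {..<n}" for T
    using card_mono[OF _ that] by simp
  have "vol n (mink_comb n [K, L] ?l) =
    (\<Sum>T\<in>Pow {..<n}. V (map (\<lambda>a. [K, L] ! ?f T a) [0..<n]) * (\<Prod>a<n. ?l (?f T a)))"
    unfolding VE by (rule sum.reindex_bij_betw[OF bij, symmetric])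
  also have "\<dots> = (\<Sum>T\<in>Pow {..<n}. ?W (card T))"
  proof (intro sum.cong refl arg_cong2[where f="(*)"])
    fix T assume T: "T \<in> Pow {..<n}"
    have "map (\<lambda>a. [K, L] ! ?f T a) [0..<n] = map (\<lambda>a. if a \<in> T then K else L) [0..<n]"
      by (intro map_cong refl) simp
    moreover have "V (map (\<lambda>a. if a \<in> T then K else L) [0..<n]) = V (replicate (card T) K @ replicate (n - card T) L)"
      using T by (intro is_mixed_volume_sym[OF V] mset_two_valued) simp
    ultimately show "V (map (\<lambda>a. [K, L] ! ?f T a) [0..<n]) = V (replicate (card T) K @ replicate (n - card T) L)"
      by (simp only:)
    have "(\<Prod>a<n. ?l (?f T a)) = (\<Prod>a<n. if a \<in> T then s else 1)" by (intro prod.cong) auto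
    also have "\<dots> = s ^ card T" using T by (simp add: prod.If_cases Int_absorb1)
    finally show "(\<Prod>a<n. ?l (?f T a)) = s ^ card T" .
  qed
  also have "\<dots> = (\<Sum>c\<le>n. \<Sum>T\<in>{T\<in>Pow {..<n}. card T = c}. ?W (card T))"
    by (rule sum.group[symmetric]) (auto simp: card_le)
  also have "\<dots> = (\<Sum>c\<le>n. (real (n choose c) * V (replicate c K @ replicate (n - c) L)) * s ^ c)"
  proof (intro sum.cong refl)
    fix c
    have "card {T\<in>Pow {..<n}. card T = c} = n choose c"
      using n_subsets[of "{..<n}" c] by (simp add: Pow_def)
    then show "(\<Sum>T\<in>{T\<in>Pow {..<n}. card T = c}. ?W (card T)) =
      (real (n choose c) * V (replicate c K @ replicate (n - c) L)) * s ^ c" by simp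
  qed
  finally show ?thesis .
qed

text \<open>The defining expansion holds for positive \<open>s\<close> only; that is enough, since a
  nonzero polynomial has finitely many roots.\<close>

lemma coefficients_unique:
  fixes b d :: "nat \<Rightarrow> real"
  assumes "\<And>s. 0 < s \<Longrightarrow> (\<Sum>c\<le>n. b c * s ^ c) = (\<Sum>c\<le>n. d c * s ^ c)" and k: "k \<le> n"
  shows "b k = d k"
proof (rule ccontr)
  assume "b k \<noteq> d k"
  then have "\<exists>c\<le>n. b c - d c \<noteq> 0" using k by auto
  then have "finite {s. (\<Sum>c\<le>n. (b c - d c) * s ^ c) = 0}"
    by (simp only: polyfun_finite_roots)
  moreover have "{0<..} \<subseteq> {s. (\<Sum>c\<le>n. (b c - d c) * s ^ c) = 0}"
    using assms(1) by (auto simp: left_diff_distrib sum_subtractf)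
  ultimately have "finite ({0<..} :: real set)" by (rule finite_subset[rotated])
  then show False by (simp add: infinite_Ioi)
qed

text \<open>The description ranges over values, not over functions \<open>V\<close>, which are not
  unique: on lists of length other than \<open>n\<close> they are constrained by symmetry alone.
  Existence of some \<open>V\<close> turns agreement at \<open>Ls\<close> into a value.\<close>

lemma mixed_volume_eqI:
  assumes "0 < n" "\<And>V. is_mixed_volume n V \<Longrightarrow> V Ls = v"
  shows "mixed_volume n Ls = v"
  unfolding mixed_volume_def
  by (rule the_equality) (use mixed_volume_exists[OF assms(1)] assms(2) in auto)

text \<open>The volume of \<open>s\<close> times the first box plus the second is the product of the
  sides; its coefficient at \<open>s ^ c\<close> is \<open>n choose c\<close> times the mixed
  volume.\<close>

lemma mixed_volume_two_boxes:
  assumes n: "0 < n" and \<alpha>: "\<And>i. i < n \<Longrightarrow> 0 \<le> \<alpha> i" and \<beta>: "\<And>i. i < n \<Longrightarrow> 0 \<le> \<beta> i"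
    and coeffs: "\<And>s. 0 < s \<Longrightarrow> (\<Prod>i<n. s * \<alpha> i + \<beta> i) = (\<Sum>c\<le>n. d c * s ^ c)" and c: "c \<le> n"
  shows "mixed_volume n (replicate c (box_at0 n \<alpha>) @ replicate (n - c) (box_at0 n \<beta>)) = d c / real (n choose c)"
proof (rule mixed_volume_eqI[OF n])
  fix V assume V: "is_mixed_volume n V"
  let ?W = "\<lambda>c. V (replicate c (box_at0 n \<alpha>) @ replicate (n - c) (box_at0 n \<beta>))"
  have "real (n choose c) * ?W c = d c"
  proof (rule coefficients_unique[OF _ c])
    fix s :: real assume s: "0 < s"
    have "(\<Sum>c\<le>n. real (n choose c) * ?W c * s ^ c) = vol n (box_at0 n (\<lambda>i. s * \<alpha> i + \<beta> i))"
      using mixed_volume_two_bodies[OF V convex_body_box[OF \<alpha>] convex_body_box[OF \<beta>] s]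
        mink_comb_two_boxes[OF \<alpha> \<beta>, where l="\<lambda>j. if j = 0 then s else 1"] s by simp
    also have "\<dots> = (\<Prod>i<n. s * \<alpha> i + \<beta> i)" using \<alpha> \<beta> s by (intro vol_box) simp
    also have "\<dots> = (\<Sum>c\<le>n. d c * s ^ c)" using s by (rule coeffs)
    finally show "(\<Sum>c\<le>n. real (n choose c) * ?W c * s ^ c) = (\<Sum>c\<le>n. d c * s ^ c)" .
  qed
  moreover have "real (n choose c) \<noteq> 0" using c by simp
  ultimately show "?W c = d c / real (n choose c)" by (simp add: field_simps)
qed

text \<open>The binomial coefficients vanish beyond \<open>k\<close>; the padding matches the
  summation range of \<open>mixed_volume_two_boxes\<close>.\<close>

lemma binomial_expansion_padded:
  fixes s :: real
  assumes "k \<le> n"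
  shows "(s + 1) ^ k = (\<Sum>c\<le>n. real (k choose c) * s ^ c)"
proof -
  have "(s + 1) ^ k = (\<Sum>c\<le>k. real (k choose c) * s ^ c)" by (simp add: binomial_ring)
  also have "\<dots> = (\<Sum>c\<le>n. real (k choose c) * s ^ c)"
    using assms by (intro sum.mono_neutral_left) auto
  finally show ?thesis .
qed

lemma mixed_volume_box_repeated:
  assumes n: "0 < n" and \<alpha>: "\<And>i. i < n \<Longrightarrow> 0 \<le> \<alpha> i"
  shows "mixed_volume n (replicate n (box_at0 n \<alpha>)) = (\<Prod>i<n. \<alpha> i)"
proof -
  \<comment> \<open>With two equal boxes and c = 0, the constant term of \<open>(s + 1) ^ n\<close>
    times the volume is the volume itself.\<close>
  have "mixed_volume n (replicate 0 (box_at0 n \<alpha>) @ replicate (n - 0) (box_at0 n \<alpha>)) =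
    (real (n choose 0) * (\<Prod>i<n. \<alpha> i)) / real (n choose 0)"
  proof (rule mixed_volume_two_boxes[OF n \<alpha> \<alpha>])
    fix s :: real
    have "(\<Prod>i<n. s * \<alpha> i + \<alpha> i) = (\<Prod>i<n. (s + 1) * \<alpha> i)" by (simp add: algebra_simps)
    also have "\<dots> = (s + 1) ^ n * (\<Prod>i<n. \<alpha> i)" by (simp add: prod.distrib)
    also have "\<dots> = (\<Sum>c\<le>n. (real (n choose c) * (\<Prod>i<n. \<alpha> i)) * s ^ c)"
      unfolding binomial_expansion_padded[OF order.refl] sum_distrib_right by (simp add: mult_ac)
    finally show "(\<Prod>i<n. s * \<alpha> i + \<alpha> i) = (\<Sum>c\<le>n. (real (n choose c) * (\<Prod>i<n. \<alpha> i)) * s ^ c)" .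
  qed auto
  then show ?thesis by simp
qed

section \<open>The three cubes and the entries of their matrix\<close>

definition fedotov_side :: "nat \<Rightarrow> nat \<Rightarrow> nat \<Rightarrow> real" where
  "fedotov_side k j i = (if j = 0 then (if i < k then 1 else 0)
     else if j = 1 then (if i < k then 0 else 1) else 1)"

lemma prod_two_blocks:
  fixes u v :: real
  shows "(\<Prod>i<2 * k. if i < k then u else v) = u ^ k * v ^ k"
proof -
  have "{..<2 * k} \<inter> {i. i < k} = {..<k}" "{..<2 * k} \<inter> - {i. i < k} = {k..<2 * k}" by auto
  then show ?thesis by (simp add: prod.If_cases)
qed

text \<open>A mixed volume of one repeated body is its volume: 0 for the two cubes of dimension k in
  dimension 2k, and 1 for the full cube.\<close>

lemma mixed_volume_fedotov_diagonal:
  assumes k: "0 < k" and i: "i < 3"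
  defines "B \<equiv> \<lambda>i. box_at0 (2 * k) (fedotov_side k i)"
  shows "mixed_volume (2 * k) (replicate k (B i) @ replicate k (B i)) = (if i = 2 then 1 else 0)"
proof -
  have "i = 0 \<or> i = 1 \<or> i = 2" using i by auto
  then have "(\<Prod>a<2 * k. fedotov_side k i a) = (if i = 2 then 1 else 0)"
    using k prod_two_blocks[of k 1 0] prod_two_blocks[of k 0 1]
    by (elim disjE) (simp_all add: fedotov_side_def)
  moreover have "replicate k (B i) @ replicate k (B i) = replicate (2 * k) (B i)"
    by (simp add: replicate_add[symmetric] mult_2)
  ultimately show ?thesis
    using mixed_volume_box_repeated[of "2 * k" "fedotov_side k i"] k
    by (simp add: B_def fedotov_side_def)
qed

text \<open>The volume polynomial is \<open>s ^ k\<close> for the two flat cubes and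
  \<open>(s + 1) ^ k\<close> if the full cube takes part. Both have coefficient 1 at
  \<open>s ^ k\<close>, whence the common off-diagonal entry.\<close>

lemma mixed_volume_fedotov_upper:
  assumes k: "0 < k" and ij: "i < j" "j < 3"
  defines "B \<equiv> \<lambda>i. box_at0 (2 * k) (fedotov_side k i)"
  shows "mixed_volume (2 * k) (replicate k (B i) @ replicate k (B j)) = 1 / real (2 * k choose k)"
proof -
  have side: "0 \<le> fedotov_side k i a" for i a by (simp add: fedotov_side_def)
  define d where "d c = (if j = 1 then (if c = k then 1 else 0) else real (k choose c))" for c
  have "mixed_volume (2 * k) (replicate k (B i) @ replicate (2 * k - k) (B j)) = d k / real (2 * k choose k)"
    unfolding B_def
  proof (rule mixed_volume_two_boxes)
    fix s :: real assume s: "0 < s"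
    \<comment> \<open>The sides are constant on the two blocks of coordinates, which are represented
      by the indices 0 and \<open>k\<close>.\<close>
    have "(\<Prod>a<2 * k. s * fedotov_side k i a + fedotov_side k j a) =
      (\<Prod>a<2 * k. if a < k then s * fedotov_side k i 0 + fedotov_side k j 0
        else s * fedotov_side k i k + fedotov_side k j k)"
      using k by (intro prod.cong) (auto simp: fedotov_side_def)
    also have "\<dots> = (s * fedotov_side k i 0 + fedotov_side k j 0) ^ k *
      (s * fedotov_side k i k + fedotov_side k j k) ^ k" by (rule prod_two_blocks)
    also have "\<dots> = (if j = 1 then s ^ k else (s + 1) ^ k)"
    proof -
      have "i = 0 \<and> j = 1 \<or> i = 0 \<and> j = 2 \<or> i = 1 \<and> j = 2" using ij by auto
      then show ?thesis using k by (elim disjE) (simp_all add: fedotov_side_def)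
    qed
    also have "\<dots> = (\<Sum>c\<le>2 * k. d c * s ^ c)"
    proof (cases "j = 1")
      case True
      then have "(\<Sum>c\<le>2 * k. d c * s ^ c) = (\<Sum>c\<le>2 * k. if c = k then s ^ k else 0)"
        by (intro sum.cong) (auto simp: d_def)
      then show ?thesis using True by simp
    next
      case False
      then show ?thesis using binomial_expansion_padded[of k "2 * k" s] by (simp add: d_def)
    qed
    finally show "(\<Prod>a<2 * k. s * fedotov_side k i a + fedotov_side k j a) = (\<Sum>c\<le>2 * k. d c * s ^ c)" .
  qed (use k side in auto)
  moreover have "d k = 1" by (simp add: d_def)
  ultimately show ?thesis by (simp add: mult_2)
qed

lemma mixed_volume_fedotov:
  assumes k: "0 < k" and ij: "i < 3" "j < 3"
  defines "B \<equiv> \<lambda>i. box_at0 (2 * k) (fedotov_side k i)"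
  shows "mixed_volume (2 * k) (replicate k (B i) @ replicate k (B j)) =
    (if i = j then (if i = 2 then 1 else 0) else 1 / real (2 * k choose k))"
proof (cases i j rule: linorder_cases)
  case less
  then show ?thesis using mixed_volume_fedotov_upper[OF k less ij(2)] by (simp add: B_def)
next
  case equal
  then show ?thesis using mixed_volume_fedotov_diagonal[OF k ij(1)] by (simp add: B_def)
next
  case greater
  have "mixed_volume (2 * k) (replicate k (B i) @ replicate k (B j)) =
    mixed_volume (2 * k) (replicate k (B j) @ replicate k (B i))"
    by (rule mixed_volume_sym) (simp add: add.commute)
  then show ?thesis using greater mixed_volume_fedotov_upper[OF k greater ij(1)] by (simp add: B_def)
qed

section \<open>Determinants of size two and three\<close>

lemma det_two_by_two:
  fixes A :: "'a :: comm_ring_1 mat"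
  assumes A: "A \<in> carrier_mat 2 2"
  shows "Determinant.det A = A $$ (0, 0) * A $$ (1, 1) - A $$ (0, 1) * A $$ (1, 0)"
proof -
  have minor: "Determinant.det (mat_delete A 0 j) = mat_delete A 0 j $$ (0, 0)" for j
    by (rule det_single) (use A in \<open>simp add: mat_delete_def\<close>)
  have "Determinant.det A = (\<Sum>j<2. A $$ (0, j) * cofactor A 0 j)"
    by (rule laplace_expansion_row[OF A]) simp
  also have "\<dots> = A $$ (0, 0) * cofactor A 0 0 + A $$ (0, 1) * cofactor A 0 1"
    by (simp add: numeral_2_eq_2)
  also have "\<dots> = A $$ (0, 0) * A $$ (1, 1) - A $$ (0, 1) * A $$ (1, 0)"
    using A by (simp add: cofactor_def minor) (simp add: mat_delete_def)
  finally show ?thesis .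
qed

lemma det_fedotov:
  fixes c :: real
  shows "Determinant.det (mat 3 3 (\<lambda>(i, j). if i = j then (if i = 2 then 1 else 0) else c)) = 2 * c ^ 3 - c ^ 2"
proof -
  let ?M = "mat 3 3 (\<lambda>(i, j). if i = j then (if i = 2 then 1 else 0) else c)"
  have M: "?M \<in> carrier_mat 3 3" by simp
  have minor: "Determinant.det (mat_delete ?M 0 j) = mat_delete ?M 0 j $$ (0, 0) * mat_delete ?M 0 j $$ (1, 1) -
    mat_delete ?M 0 j $$ (0, 1) * mat_delete ?M 0 j $$ (1, 0)" for j
    by (rule det_two_by_two) (simp add: mat_delete_def)
  have "Determinant.det ?M = (\<Sum>j<3. ?M $$ (0, j) * cofactor ?M 0 j)"
    by (rule laplace_expansion_row[OF M]) simp
  also have "\<dots> = ?M $$ (0, 0) * cofactor ?M 0 0 + ?M $$ (0, 1) * cofactor ?M 0 1 + ?M $$ (0, 2) * cofactor ?M 0 2"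
    by (simp add: numeral_3_eq_3 numeral_2_eq_2)
  also have "\<dots> = 2 * c ^ 3 - c ^ 2"
    by (simp add: cofactor_def minor) (simp add: mat_delete_def power2_eq_square power3_eq_cube right_diff_distrib)
  finally show ?thesis .
qed

theorem theorem1p4:
  fixes k :: nat
  assumes "k \<ge> 2"
  shows "\<exists>(n::nat) (m::nat) (K :: nat \<Rightarrow> (nat \<Rightarrow> real) set) (C :: (nat \<Rightarrow> real) set list).
           n \<ge> 2 * k \<and> m > 2 \<and>
           (\<forall>i<m. convex_body n (K i)) \<and>
           length C = n - 2 * k \<and> (\<forall>c\<in>set C. convex_body n c) \<and>
           (-1) ^ m * Determinant.det (mat m m (\<lambda>(i, j).
               mixed_volume n (replicate k (K i) @ replicate k (K j) @ C))) > (0::real)"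
proof -
  define K where "K i = box_at0 (2 * k) (fedotov_side k i)" for i
  define c where "c = 1 / real (2 * k choose k)"
  \<comment> \<open>The central binomial coefficient is at least \<open>2 * k\<close>, hence at
    least 4; for k = 1 it would be 2 and the determinant 0.\<close>
  have "2 < 2 * k choose k"
  proof -
    have "2 * k choose 1 \<le> 2 * k choose k" by (rule binomial_maximum')
    then show ?thesis using assms by simp
  qed
  then have c: "0 < c" "2 * c < 1" by (auto simp: c_def field_simps)
  \<comment> \<open>In dimension 2k the repeated bodies fill all places, so \<open>C\<close> is the
    empty list.\<close>
  have "mat 3 3 (\<lambda>(i, j). mixed_volume (2 * k) (replicate k (K i) @ replicate k (K j) @ [])) =
    mat 3 3 (\<lambda>(i, j). if i = j then (if i = 2 then 1 else 0) else c)"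
    by (rule cong_mat) (use mixed_volume_fedotov[of k] assms in \<open>auto simp: K_def c_def\<close>)
  moreover have "- (2 * c ^ 3 - c ^ 2) = c ^ 2 * (1 - 2 * c)"
    by (simp add: power2_eq_square power3_eq_cube right_diff_distrib)
  ultimately have "(-1) ^ 3 * Determinant.det (mat 3 3 (\<lambda>(i, j).
      mixed_volume (2 * k) (replicate k (K i) @ replicate k (K j) @ []))) = c ^ 2 * (1 - 2 * c)"
    by (simp add: det_fedotov)
  also have "\<dots> > 0" using c by simp
  finally have "(-1) ^ 3 * Determinant.det (mat 3 3 (\<lambda>(i, j).
      mixed_volume (2 * k) (replicate k (K i) @ replicate k (K j) @ []))) > (0 :: real)" .
  moreover have "convex_body (2 * k) (K i)" for i
    unfolding K_def by (rule convex_body_box) (simp add: fedotov_side_def)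
  ultimately show ?thesis
    by (intro exI[of _ "2 * k"] exI[of _ 3] exI[of _ K] exI[of _ "[]"] conjI allI impI) simp_all
qed

end
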